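(* Consider the billiard in the square $S=[-1/2,1/2]^2$ with one small obstacle $O$. Then its admissible rotation set $AR\subset\mathbb{R}$ is convex, and consequently, it is a closed interval symmetric with respect to $0$.
   Context: Setting: $O\subset S$ is a compact convex set with nonempty interior and smooth boundary. It is small if it is contained in a closed ball of radius smaller than $\sqrt{2}/4$ centered at the origin. Billiard trajectories in $S\setminus\operatorname{int}O$ move with unit speed along straight lines and reflect from the sides of $S$ and from $\partial O$ with angle of incidence equal to angle of reflection; a trajectory reaching a vertex of $S$ returns along the same line. Time along a trajectory piece equals its length. A tangency to the obstacle is not counted as a reflection. Unfolding: cover $\mathbb{R}^2$ by the squares $S+\mathbf{k}$, $\mathbf{k}\in\mathbb{Z}^2$, obtained from $S$ by consecutive reflections in the lines $x=n+1/2$, $y=n+1/2$, $n\in\mathbb{Z}$. For $\mathbf{k}=(p,q)$ the obstacle in $S+\mathbf{k}$ is $O_{\mathbf{k}}=\{(p+(-1)^p x,\,q+(-1)^q y):(x,y)\in O\}$. Trajectories in $S$ with obstacle $O$ unfold to billiard trajectories in $\mathbb{R}^2$ with obstacles $O_{\mathbf{k}}$. Admissibility: $O_{\mathbf{k}}$ is between $O_{\mathbf{i}}$ and $O_{\mathbf{j}}$ if $\mathbf{k}\ne\mathbf{i},\mathbf{j}$ and $O_{\mathbf{k}}$ intersects the convex hull of $O_{\mathbf{i}}\cup O_{\mathbf{j}}$. A (finite or infinite) sequence $(\mathbf{k}_n)_{n\ge 0}$ in $\mathbb{Z}^2$ is admissible if (1) $\mathbf{k}_0=\mathbf{0}$;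 (2) $\mathbf{k}_{n+1}\ne\mathbf{k}_n$ for every $n$; (3) for every $n$ there is no obstacle between $O_{\mathbf{k}_n}$ and $O_{\mathbf{k}_{n+1}}$; (4) for every $n$ the obstacle $O_{\mathbf{k}_{n+1}}$ is not between $O_{\mathbf{k}_n}$ and $O_{\mathbf{k}_{n+2}}$. A trajectory piece starting and ending on $\partial O$ has type $(\mathbf{k}_n)_{n=0}^s$ if its unfolding starts on the boundary of $O_{\mathbf{k}_0}=O_{\mathbf{0}}$, reflects consecutively from $O_{\mathbf{k}_1},\dots,O_{\mathbf{k}_{s-1}}$ and ends on the boundary of $O_{\mathbf{k}_s}$. Displacement: fix a point $\mathbf{z}$ in the interior of $O$ and set $\phi(\mathbf{x})=\arg(\mathbf{x}-\mathbf{z})/(2\pi)$, identifying $\mathbb{R}^2$ with $\mathbb{C}$; the displacement along a trajectory piece in $S$ is the (continuous) increment of $\phi$ along it. The admissible rotation set $AR$ is the set of all limits of sequences $d_n/t_n$, where $d_n$ and $t_n$ are the displacement and the length of a trajectory piece of admissible type, and $t_n\to\infty$ (it does not depend on the choice of $\mathbf{z}$). *)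

theory Defs
  imports "HOL-Analysis.Analysis"
begin

text \<open>The plane is identified with the complex numbers throughout.\<close>

definition square :: "complex set" where
  "square = {x. \<bar>Re x\<bar> \<le> 1/2 \<and> \<bar>Im x\<bar> \<le> 1/2}"

text \<open>
  Smoothness is \<open>C\<^sup>\<infinity>\<close>: the boundary is the trace of a regular simple closed curve
  \<open>D 0\<close> of period 1, and \<open>D n\<close> is its derivative of order \<open>n\<close>.
\<close>
definition smooth_boundary :: "complex set \<Rightarrow> bool" where
  "smooth_boundary K \<longleftrightarrow> (\<exists>D :: nat \<Rightarrow> real \<Rightarrow> complex.
     (\<forall>n t. (D n has_vector_derivative D (Suc n) t) (at t)) \<and>
     (\<forall>t. D 1 t \<noteq> 0) \<and>
     (\<forall>t. D 0 (t + 1) = D 0 t) \<and> inj_on (D 0) {0..<1} \<and>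
     frontier K = D 0 ` {0..<1})"

definition obstacle :: "complex set \<Rightarrow> bool" where
  "obstacle Ob \<longleftrightarrow> Ob \<subseteq> square \<and> compact Ob \<and> convex Ob \<and> interior Ob \<noteq> {} \<and>
     smooth_boundary Ob"

definition small :: "complex set \<Rightarrow> bool" where
  "small Ob \<longleftrightarrow> (\<exists>r. r < sqrt 2 / 4 \<and> Ob \<subseteq> cball 0 r)"


subsection \<open>Billiard trajectories\<close>

definition arrives :: "(real \<Rightarrow> complex) \<Rightarrow> real \<Rightarrow> complex \<Rightarrow> bool" where
  "arrives g t v \<longleftrightarrow> norm v = 1 \<and> (\<forall>\<^sub>F s in at_left t. g s = g t + (s - t) *\<^sub>R v)"

definition departs :: "(real \<Rightarrow> complex) \<Rightarrow> real \<Rightarrow> complex \<Rightarrow> bool" where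
  "departs g t w \<longleftrightarrow> norm w = 1 \<and> (\<forall>\<^sub>F s in at_right t. g s = g t + (s - t) *\<^sub>R w)"

text \<open>
  A trajectory piece of length \<open>T\<close> is a curve on \<open>{0..T}\<close> (its values elsewhere are irrelevant)
  staying in the region \<open>R\<close>. It is locally a unit speed straight motion on either side
  of each time, and \<open>law x v w\<close> says that arriving at \<open>x\<close> with velocity \<open>v\<close> one may leave with
  velocity \<open>w\<close>. By compactness of \<open>{0..T}\<close> there are only finitely many changes of velocity.
\<close>
definition billiard_piece ::
  "complex set \<Rightarrow> (complex \<Rightarrow> complex \<Rightarrow> complex \<Rightarrow> bool) \<Rightarrow> real \<Rightarrow> (real \<Rightarrow> complex) \<Rightarrow> bool" where
  "billiard_piece R law T g \<longleftrightarrow> 0 < T \<and> g ` {0..T} \<subseteq> R \<and>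
     (\<exists>w. departs g 0 w) \<and> (\<exists>v. arrives g T v) \<and>
     (\<forall>t\<in>{0<..<T}. \<exists>v w. arrives g t v \<and> departs g t w \<and> law (g t) v w)"

text \<open>Reflection in the line orthogonal to the unit vector \<open>n\<close>.\<close>
definition mirror :: "complex \<Rightarrow> complex \<Rightarrow> complex" where
  "mirror n v = v - (2 * (v \<bullet> n)) *\<^sub>R n"

text \<open>
  For a convex set with smooth boundary the supporting line at a boundary point is the tangent line,
  so this is the unit outward normal.
\<close>
definition outward_normal :: "complex set \<Rightarrow> complex \<Rightarrow> complex \<Rightarrow> bool" where
  "outward_normal K x n \<longleftrightarrow> x \<in> frontier K \<and> norm n = 1 \<and> (\<forall>y\<in>K. n \<bullet> (y - x) \<le> 0)"

text \<open>
  At a tangency to the obstacle \<open>v\<close> is orthogonal to \<open>n\<close>, and the law gives \<open>w = v\<close>.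
  The sides have normals \<open>1\<close> and \<open>\<i>\<close>.
\<close>
definition square_law :: "complex set \<Rightarrow> complex \<Rightarrow> complex \<Rightarrow> complex \<Rightarrow> bool" where
  "square_law Ob x v w \<longleftrightarrow>
     (if x \<in> frontier Ob then \<exists>n. outward_normal Ob x n \<and> w = mirror n v
      else if \<bar>Re x\<bar> = 1/2 \<and> \<bar>Im x\<bar> = 1/2 then w = - v
      else if \<bar>Re x\<bar> = 1/2 then w = mirror 1 v
      else if \<bar>Im x\<bar> = 1/2 then w = mirror \<i> v
      else w = v)"

definition square_piece :: "complex set \<Rightarrow> real \<Rightarrow> (real \<Rightarrow> complex) \<Rightarrow> bool" where
  "square_piece Ob T g \<longleftrightarrow> billiard_piece (square - interior Ob) (square_law Ob) T g"


subsection \<open>Unfolding\<close>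

text \<open>The isometry from \<open>S\<close> onto \<open>S + k\<close> obtained by consecutive reflections.\<close>
definition cell_map :: "int \<times> int \<Rightarrow> complex \<Rightarrow> complex" where
  "cell_map k x = Complex (of_int (fst k) + (-1) powi fst k * Re x)
                          (of_int (snd k) + (-1) powi snd k * Im x)"

definition copy :: "complex set \<Rightarrow> int \<times> int \<Rightarrow> complex set" where
  "copy Ob k = cell_map k ` Ob"

definition plane_law :: "complex set \<Rightarrow> complex \<Rightarrow> complex \<Rightarrow> complex \<Rightarrow> bool" where
  "plane_law Ob x v w \<longleftrightarrow>
     (if \<exists>k. x \<in> frontier (copy Ob k)
      then \<exists>k n. outward_normal (copy Ob k) x n \<and> w = mirror n v
      else w = v)"

definition plane_piece :: "complex set \<Rightarrow> real \<Rightarrow> (real \<Rightarrow> complex) \<Rightarrow> bool" where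
  "plane_piece Ob T h \<longleftrightarrow> billiard_piece (- (\<Union>k. interior (copy Ob k))) (plane_law Ob) T h"

definition unfolding_of ::
  "complex set \<Rightarrow> real \<Rightarrow> (real \<Rightarrow> complex) \<Rightarrow> (real \<Rightarrow> complex) \<Rightarrow> bool" where
  "unfolding_of Ob T g h \<longleftrightarrow> plane_piece Ob T h \<and> (\<forall>t\<in>{0..T}. \<exists>k. h t = cell_map k (g t))"


subsection \<open>Types and admissibility\<close>

definition lies_between ::
  "complex set \<Rightarrow> int \<times> int \<Rightarrow> int \<times> int \<Rightarrow> int \<times> int \<Rightarrow> bool" where
  "lies_between Ob k i j \<longleftrightarrow> k \<noteq> i \<and> k \<noteq> j \<and>
     copy Ob k \<inter> convex hull (copy Ob i \<union> copy Ob j) \<noteq> {}"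

text \<open>Only finite sequences occur as types of trajectory pieces.\<close>
definition admissible :: "complex set \<Rightarrow> (int \<times> int) list \<Rightarrow> bool" where
  "admissible Ob ks \<longleftrightarrow> ks \<noteq> [] \<and> ks ! 0 = (0, 0) \<and>
     (\<forall>n. n + 1 < length ks \<longrightarrow> ks ! (n + 1) \<noteq> ks ! n) \<and>
     (\<forall>n. n + 1 < length ks \<longrightarrow> \<not> (\<exists>k. lies_between Ob k (ks ! n) (ks ! (n + 1)))) \<and>
     (\<forall>n. n + 2 < length ks \<longrightarrow> \<not> lies_between Ob (ks ! (n + 1)) (ks ! n) (ks ! (n + 2)))"

definition reflects_at :: "(real \<Rightarrow> complex) \<Rightarrow> real \<Rightarrow> bool" where
  "reflects_at h t \<longleftrightarrow> (\<exists>v w. arrives h t v \<and> departs h t w \<and> v \<noteq> w)"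

text \<open>
  The times \<open>\<tau> 1, \<dots>, \<tau> (s - 1)\<close> are exactly the reflection times of the unfolding; they
  do not include the end points.
\<close>
definition has_type ::
  "complex set \<Rightarrow> real \<Rightarrow> (real \<Rightarrow> complex) \<Rightarrow> (int \<times> int) list \<Rightarrow> bool" where
  "has_type Ob T g ks \<longleftrightarrow> ks \<noteq> [] \<and> ks ! 0 = (0, 0) \<and>
     (\<exists>h \<tau>. let s = length ks - 1 in
        unfolding_of Ob T g h \<and>
        \<tau> 0 = 0 \<and> \<tau> s = T \<and> strict_mono_on {0..s} \<tau> \<and>
        (\<forall>i\<le>s. h (\<tau> i) \<in> frontier (copy Ob (ks ! i))) \<and>
        {t \<in> {0<..<T}. reflects_at h t} = \<tau> ` {0<..<s})"


subsection \<open>Displacement and the admissible rotation set\<close>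

text \<open>\<open>\<phi>\<close> is a continuous branch of \<open>arg (x - z) / (2 \<pi>)\<close> along the curve.\<close>
definition has_displacement ::
  "complex \<Rightarrow> real \<Rightarrow> (real \<Rightarrow> complex) \<Rightarrow> real \<Rightarrow> bool" where
  "has_displacement z T g d \<longleftrightarrow> (\<exists>\<phi>. continuous_on {0..T} \<phi> \<and>
     (\<forall>t\<in>{0..T}. is_Arg (g t - z) (2 * pi * \<phi> t)) \<and> d = \<phi> T - \<phi> 0)"

definition admissible_rotation_set :: "complex set \<Rightarrow> complex \<Rightarrow> real set" where
  "admissible_rotation_set Ob z = {\<rho>. \<exists>d t :: nat \<Rightarrow> real.
     (\<forall>n. \<exists>g ks. square_piece Ob (t n) g \<and> admissible Ob ks \<and> has_type Ob (t n) g ks \<and>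
                  has_displacement z (t n) g (d n)) \<and>
     filterlim t at_top sequentially \<and> (\<lambda>n. d n / t n) \<longlonglongrightarrow> \<rho>}"

end

theory Submission
  imports Defs
begin

text \<open>
  Lengths and displacements of trajectory pieces depend, up to additive constants, only on their
  type, and types can be concatenated and reversed. So the pairs (length, displacement) form a
  set that is closed, up to bounded errors, under addition and under change of sign of the
  displacement; the asymptotic slopes of such a set form a convex symmetric set.

  Length: the length of a polygonal path is a convex function of its vertices, and the reflection law
  is exactly the first order condition for a minimum when the vertex \<open>i\<close> ranges over the convex set
  \<open>O\<^sub>k\<close>, where \<open>k\<close> is the entry \<open>i\<close> of the type. Hence a piece with fixed end points is the shortest path
  through the obstacles of its type, and moving the end points costs a bounded amount (\<open>length_le\<close>).
  Conversely a shortest path through the obstacles of an admissible type is a trajectory of this type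
  (\<open>shortest_piece\<close>), so every admissible type with at least one step is realised.

  Displacement: a polygonal path with vertices anywhere in the obstacles of its type, possibly
  passing through copies of \<open>z\<close>, is given a rotation \<open>path_swing\<close>. Near a vertex the angle is measured
  around the vertex itself instead of \<open>z\<close>, and at the vertex the angle of the corner is added, which
  is never \<open>\<plusminus>\<pi>\<close> because the middle obstacle is not between its neighbours. This and the absence
  of obstacles between consecutive ones make the rotation continuous in the vertices. Its value modulo a full turn depends only
  on the first and the last direction, so it varies by at most one turn within a type (\<open>path_swing_change\<close>).
  For a trajectory it agrees with the displacement up to a constant (\<open>displacement_path_swing\<close>),
  because at a reflection the path stays on one side of the tangent line and \<open>z\<close> is on the other.

  Combinatorics: the maps \<open>x \<mapsto> k + \<sigma>\<^sub>k x\<close> from \<open>S\<close> onto the cells form a group of isometries of the plane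
  permuting the obstacles. In terms of steps \<open>k\<^sub>n\<inverse> k\<^sub>n\<^sub>+\<^sub>1\<close> in this group, admissibility is a condition on letters
  and on pairs of consecutive letters, so types are words. The four unit steps are
  involutions. Since the obstacle is small, a unit step may be followed by itself and by a
  perpendicular one, and any word can be continued by some unit step; so two words are joined by at most three
  unit steps (\<open>join\<close>). The word of a reversed path consists of the inverse steps in reverse order, and has
  the opposite rotation.
\<close>

section \<open>Angles along plane curves\<close>

text \<open>
  The angle is principal; it is only meaningful when the segment from \<open>p\<close> to \<open>q\<close> avoids 0.
\<close>
definition turn :: "complex \<Rightarrow> complex \<Rightarrow> real" where
  "turn p q = Arg (q / p)"

definition has_swing :: "(real \<Rightarrow> complex) \<Rightarrow> real \<Rightarrow> real \<Rightarrow> real \<Rightarrow> bool" where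
  "has_swing f a b d \<longleftrightarrow> (\<exists>\<theta>. continuous_on {a..b} \<theta> \<and>
     (\<forall>t\<in>{a..b}. is_Arg (f t) (\<theta> t)) \<and> d = \<theta> b - \<theta> a)"

lemma abs_turn_le: "\<bar>turn p q\<bar> \<le> pi"
  using mpi_less_Arg[of "q/p"] Arg_le_pi[of "q/p"] by (auto simp: turn_def)

lemma segment_avoids_0D:
  fixes p q :: complex
  assumes "0 \<notin> closed_segment p q"
  shows "p \<noteq> 0" "q \<noteq> 0" "q / p \<notin> \<real>\<^sub>\<le>\<^sub>0"
proof -
  show p: "p \<noteq> 0" and q: "q \<noteq> 0" using assms by auto
  show "q / p \<notin> \<real>\<^sub>\<le>\<^sub>0"
  proof
    assume "q / p \<in> \<real>\<^sub>\<le>\<^sub>0"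
    then obtain r where r: "r \<le> 0" "q / p = of_real r" by (auto simp: nonpos_Reals_def)
    then have "q = of_real r * p" using p by (simp add: nonzero_divide_eq_eq)
    then have qr: "q = r *\<^sub>R p" by (simp add: scaleR_conv_of_real)
    define u where "u = 1 / (1 - r)"
    have "(1 - u) + u * r = 0" "0 \<le> u" "u \<le> 1" using r by (auto simp: u_def field_simps)
    moreover have "(1 - u) *\<^sub>R p + u *\<^sub>R q = ((1 - u) + u * r) *\<^sub>R p"
      unfolding qr by (simp only: scaleR_left_distrib scaleR_scaleR)
    ultimately have "0 = (1 - u) *\<^sub>R p + u *\<^sub>R q" by simp
    with \<open>0 \<le> u\<close> \<open>u \<le> 1\<close> show False using assms \<open>0 \<le> u\<close> \<open>u \<le> 1\<close> unfolding closed_segment_def by blast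
  qed
qed

lemma segment_avoids_0I:
  fixes n p q :: complex
  assumes "n \<bullet> p > 0" "n \<bullet> q > 0"
  shows "0 \<notin> closed_segment p q"
proof
  assume "0 \<in> closed_segment p q"
  then obtain u where u: "0 \<le> u" "u \<le> 1" "0 = (1 - u) *\<^sub>R p + u *\<^sub>R q"
    unfolding closed_segment_def by blast
  have "0 = (1 - u) * (n \<bullet> p) + u * (n \<bullet> q)"
    using arg_cong[OF u(3), of "inner n"] unfolding inner_add_right inner_scaleR_right inner_zero_right .
  moreover have "(1 - u) * (n \<bullet> p) + u * (n \<bullet> q) > 0"
  proof (cases "u = 0")
    case False
    then have "u * (n \<bullet> q) > 0" using assms(2) u(1) by (intro mult_pos_pos) auto
    moreover have "(1 - u) * (n \<bullet> p) \<ge> 0" using assms(1) u(2) by (intro mult_nonneg_nonneg) auto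
    ultimately
    show ?thesis by linarith
  qed (use assms(1) in simp)
  ultimately show False by simp
qed

lemma turn_swap: "0 \<notin> closed_segment p q \<Longrightarrow> turn q p = - turn p q"
proof -
  assume "0 \<notin> closed_segment p q"
  from segment_avoids_0D[OF this] have *: "q / p \<notin> \<real>\<^sub>\<le>\<^sub>0" "p \<noteq> 0" "q \<noteq> 0" by auto
  have "p / q = inverse (q / p)" by simp
  then have "turn q p = Arg (inverse (q/p))" by (simp only: turn_def)
  also have "\<dots> = - Arg (q/p)"
  proof (cases "q / p \<in> \<real>")
    case True
    then have "Arg (q/p) = 0" using * by (auto simp: Arg_real nonpos_Reals_def Reals_def)
    then show ?thesis using True by (simp only: Arg_inverse if_True)
  qed (simp only: Arg_inverse if_False)
  finally show ?thesis by (simp add: turn_def)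
qed

lemma is_Arg_mult: "is_Arg x r \<Longrightarrow> is_Arg y s \<Longrightarrow> is_Arg (x * y) (r + s)"
proof -
  assume x: "is_Arg x r" and y: "is_Arg y s"
  have "x * y = (of_real (norm x) * exp (\<i> * of_real r)) * (of_real (norm y) * exp (\<i> * of_real s))"
    by (rule arg_cong2[of _ _ _ _ "(*)"]; rule x[unfolded is_Arg_def] y[unfolded is_Arg_def])
  then show ?thesis unfolding is_Arg_def
    by (simp add: norm_mult exp_add algebra_simps)
qed

lemma is_Arg_turn:
  assumes "is_Arg p r" "p \<noteq> 0" "q \<noteq> 0"
  shows "is_Arg q (r + turn p q)"
proof -
  have "is_Arg (q / p) (turn p q)" unfolding turn_def using assms by (intro is_Arg_Arg) auto
  from is_Arg_mult[OF assms(1) this] show ?thesis using assms by simp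
qed

lemma is_Arg_diff_2pi:
  assumes "is_Arg p r" "is_Arg p s" "p \<noteq> 0"
  shows "\<exists>k::int. r - s = 2 * pi * of_int k"
proof -
  have "exp (\<i> * of_real r) = exp (\<i> * of_real s)"
  proof -
    have "of_real (norm p) * exp (\<i> * of_real r) = of_real (norm p) * exp (\<i> * of_real s)"
      by (rule trans[OF sym]; rule assms(1,2)[unfolded is_Arg_def])
    then show ?thesis using assms(3) by simp
  qed
  then obtain k :: int where "\<i> * of_real r = \<i> * of_real s + of_real (2 * of_int k * pi) * \<i>"
    by (auto simp: exp_eq)
  then have "\<i> * (of_real r) = \<i> * (of_real (s + 2 * of_int k * pi))"
    by (simp add: algebra_simps)
  then have "(of_real r :: complex) = of_real (s + 2 * of_int k * pi)"
    by (metis mult_cancel_left complex_i_not_zero)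
  then have "r = s + 2 * of_int k * pi" using of_real_eq_iff by blast
  then show ?thesis by (intro exI[of _ k]) simp
qed

lemma has_swing_unique:
  assumes "has_swing f a b d" "has_swing f a b e" "a \<le> b" "\<And>t. t \<in> {a..b} \<Longrightarrow> f t \<noteq> 0"
  shows "d = e"
proof -
  obtain \<theta> where \<theta>: "continuous_on {a..b} \<theta>" "\<And>t. t\<in>{a..b} \<Longrightarrow> is_Arg (f t) (\<theta> t)" "d = \<theta> b - \<theta> a"
    using assms(1) by (auto simp: has_swing_def)
  obtain \<psi> where \<psi>: "continuous_on {a..b} \<psi>" "\<And>t. t\<in>{a..b} \<Longrightarrow> is_Arg (f t) (\<psi> t)" "e = \<psi> b - \<psi> a"
    using assms(2) by (auto simp: has_swing_def)
  define h where "h = (\<lambda>t. (\<theta> t - \<psi> t) / (2*pi))"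
  have "continuous_on {a..b} h" unfolding h_def by (intro continuous_intros \<theta> \<psi>) auto
  moreover have "h t \<in> \<int>" if "t \<in> {a..b}" for t
    using is_Arg_diff_2pi[OF \<theta>(2) \<psi>(2), OF that that assms(4)[OF that]] by (auto simp: h_def)
  ultimately have "h constant_on {a..b}"
  proof (intro continuous_discrete_range_constant)
    fix x assume x: "x \<in> {a..b}"
    assume "\<And>t. t \<in> {a..b} \<Longrightarrow> h t \<in> \<int>"
    then have "1 \<le> norm (h y - h x)" if "y \<in> {a..b}" "h y \<noteq> h x" for y
      using that x Ints_nonzero_abs_ge1[of "h y - h x"] by auto
    then show "\<exists>e>0. \<forall>y. y \<in> {a..b} \<and> h y \<noteq> h x \<longrightarrow> e \<le> norm (h y - h x)"
      by (intro exI[of _ 1]) auto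
  qed simp
  then have "h a = h b" using assms(3) by (auto simp: constant_on_def)
  then show ?thesis using \<theta> \<psi> by (auto simp: h_def)
qed

lemma has_swing_exists:
  assumes "continuous_on {a..b} f" "\<And>t. t \<in> {a..b} \<Longrightarrow> f t \<noteq> 0"
  shows "\<exists>d. has_swing f a b d"
proof -
  obtain g where g: "continuous_on {a..b} g" "\<And>t. t \<in> {a..b} \<Longrightarrow> f t = exp (g t)"
    using continuous_logarithm_on_contractible[OF assms(1) convex_imp_contractible assms(2)] by auto
  show ?thesis unfolding has_swing_def
    by (intro exI[of _ "Im (g b) - Im (g a)"] exI[of _ "\<lambda>t. Im (g t)"])
       (auto simp: g is_Arg_exp_Im intro!: continuous_intros)
qed

lemma has_swing_sub:
  assumes "continuous_on S \<theta>" "{a..b} \<subseteq> S" "\<And>t. t \<in> S \<Longrightarrow> is_Arg (f t) (\<theta> t)"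
  shows "has_swing f a b (\<theta> b - \<theta> a)"
  unfolding has_swing_def
  by (intro exI[of _ \<theta>] conjI ballI refl continuous_on_subset[OF assms(1,2)] assms(3))
     (use assms(2) in blast)

lemma has_swing_cong:
  assumes "has_swing f a b d" "\<And>t. t \<in> {a..b} \<Longrightarrow> f t = g t"
  shows "has_swing g a b d"
proof -
  obtain \<theta> where \<theta>: "continuous_on {a..b} \<theta>" "\<And>t. t\<in>{a..b} \<Longrightarrow> is_Arg (f t) (\<theta> t)" "d = \<theta> b - \<theta> a"
    using assms(1) by (auto simp: has_swing_def)
  then show ?thesis unfolding has_swing_def using assms(2) by (intro exI[of _ \<theta>]) auto
qed

text \<open>
  A principal angle from \<open>f\<close> to \<open>g\<close> is continuous as long as the two vectors are never opposite,
  so adding it to a continuous argument of \<open>f\<close> gives one of \<open>g\<close>.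
\<close>
lemma has_swing_turn:
  assumes "has_swing f a b d" "a \<le> b" "continuous_on {a..b} f" "continuous_on {a..b} g"
    and "\<And>t. t \<in> {a..b} \<Longrightarrow> 0 \<notin> closed_segment (f t) (g t)"
  shows "has_swing g a b (d + turn (f b) (g b) - turn (f a) (g a))"
proof -
  obtain \<theta> where \<theta>: "continuous_on {a..b} \<theta>" "\<And>t. t\<in>{a..b} \<Longrightarrow> is_Arg (f t) (\<theta> t)" "d = \<theta> b - \<theta> a"
    using assms(1) by (auto simp: has_swing_def)
  note nz = segment_avoids_0D[OF assms(5)]
  have "continuous_on {a..b} (\<lambda>t. turn (f t) (g t))" unfolding turn_def
    by (intro continuous_intros assms(3,4)) (use nz in auto)
  then show ?thesis unfolding has_swing_def using \<theta>
    by (intro exI[of _ "\<lambda>t. \<theta> t + turn (f t) (g t)"])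
       (auto intro!: continuous_intros is_Arg_turn nz)
qed

lemma has_swing_from_start:
  assumes "a \<le> b" "continuous_on {a..b} f"
    and "\<And>t. t \<in> {a..b} \<Longrightarrow> 0 \<notin> closed_segment (f a) (f t)"
  shows "has_swing f a b (turn (f a) (f b))"
proof -
  have nz: "f a \<noteq> 0" using segment_avoids_0D assms by force
  have "has_swing (\<lambda>_. f a) a b 0"
    unfolding has_swing_def using is_Arg_Arg[OF nz] by (intro exI[of _ "\<lambda>_. Arg (f a)"]) auto
  from has_swing_turn[OF this assms(1) continuous_on_const assms(2) assms(3)]
  show ?thesis using nz by (simp add: turn_def)
qed

lemma has_swing_linear:
  assumes "0 \<notin> closed_segment p q"
  shows "has_swing (\<lambda>u. (1 - u) *\<^sub>R p + u *\<^sub>R q) 0 1 (turn p q)"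
proof -
  have "has_swing (\<lambda>u. (1 - u) *\<^sub>R p + u *\<^sub>R q) 0 1
     (turn ((1 - 0) *\<^sub>R p + 0 *\<^sub>R q) ((1 - 1) *\<^sub>R p + 1 *\<^sub>R q))"
  proof (rule has_swing_from_start)
    fix t :: real assume "t \<in> {0..1}"
    then have "(1 - t) *\<^sub>R p + t *\<^sub>R q \<in> closed_segment p q" by (auto simp: closed_segment_def)
    then have "closed_segment p ((1 - t) *\<^sub>R p + t *\<^sub>R q) \<subseteq> closed_segment p q"
      by (simp add: subset_closed_segment)
    then show "0 \<notin> closed_segment ((1 - 0) *\<^sub>R p + 0 *\<^sub>R q) ((1 - t) *\<^sub>R p + t *\<^sub>R q)"
      using assms by auto
  qed (auto intro!: continuous_intros)
  then show ?thesis by simp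
qed

lemma has_swing_half_plane:
  assumes "a \<le> b" "continuous_on {a..b} f" "\<And>t. t \<in> {a..b} \<Longrightarrow> n \<bullet> f t > 0"
  shows "has_swing f a b (turn (f a) (f b))"
proof (rule has_swing_from_start[OF assms(1,2)])
  fix t assume "t \<in> {a..b}"
  then show "0 \<notin> closed_segment (f a) (f t)"
    using assms(1) by (intro segment_avoids_0I[of n] assms(3)) auto
qed

text \<open>
  Within an open half plane all arguments lie in an interval of length \<open>\<pi>\<close>, so no full turns are lost.
\<close>
lemma turn_half_plane:
  assumes "n \<bullet> p > 0" "n \<bullet> q > 0" "n \<bullet> r > 0"
  shows "turn p q + turn q r = turn p r"
proof -
  have n: "n \<noteq> 0" using assms by auto
  have pos: "Re (x / n) > 0" if "n \<bullet> x > 0" for x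
  proof -
    have "Re (x / n) = (n \<bullet> x) / (norm n)\<^sup>2"
      by (simp add: Re_divide inner_complex_def cmod_power2 algebra_simps)
    then show ?thesis using that n by simp
  qed
  have *: "turn x y = Arg (y / n) - Arg (x / n)" if "n \<bullet> x > 0" "n \<bullet> y > 0" for x y
  proof -
    note px = pos[OF that(1)] and py = pos[OF that(2)]
    have nz: "x / n \<noteq> 0" "y / n \<noteq> 0" using px py by force+
    have b: "\<bar>Arg (x / n)\<bar> < pi/2" "\<bar>Arg (y / n)\<bar> < pi/2" using px py Arg_Re_pos by blast+
    have eq: "y / x = (y / n) / (x / n)" using n by simp
    have a: "is_Arg (y / x) (Arg (y / x))" using nz n by (intro is_Arg_Arg) auto
    have "is_Arg (y / n) (Arg (x / n) + turn (x / n) (y / n))"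
      using nz by (intro is_Arg_turn is_Arg_Arg)
    moreover have "is_Arg (y / n) (Arg (y / n))" using nz by (intro is_Arg_Arg)
    moreover have "\<bar>turn (x/n) (y/n)\<bar> \<le> pi" by (rule abs_turn_le)
    ultimately have "Arg (x / n) + turn (x / n) (y / n) = Arg (y / n)"
      using nz b by (intro is_Arg_eqI[of "y/n"]) auto
    moreover have "turn (x / n) (y / n) = turn x y" by (simp only: turn_def eq)
    ultimately show ?thesis by simp
  qed
  show ?thesis using *[of p q] *[of q r] *[of p r] assms by simp
qed

lemma has_swing_reverse:
  assumes "has_swing f a b d"
  shows "has_swing (\<lambda>t. f (a + b - t)) a b (- d)"
proof -
  obtain \<theta> where \<theta>: "continuous_on {a..b} \<theta>" "\<And>t. t\<in>{a..b} \<Longrightarrow> is_Arg (f t) (\<theta> t)" "d = \<theta> b - \<theta> a"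
    using assms(1) by (auto simp: has_swing_def)
  have "continuous_on {a..b} (\<lambda>t. \<theta> (a + b - t))"
    by (rule continuous_on_compose2[OF \<theta>(1)]) (auto intro!: continuous_intros)
  then show ?thesis unfolding has_swing_def using \<theta>
    by (intro exI[of _ "\<lambda>t. \<theta> (a + b - t)"]) auto
qed

lemma has_swing_scale:
  assumes "has_swing (\<lambda>t. c *\<^sub>R f t) a b d" "c > 0"
  shows "has_swing f a b d"
proof -
  have "is_Arg x r" if "is_Arg (c *\<^sub>R x) r" for x r
    using that assms(2) unfolding is_Arg_def scaleR_conv_of_real
    by (simp add: norm_mult) 
  then show ?thesis using assms(1) unfolding has_swing_def by metis
qed

text \<open>
  On the rectangle there is a continuous logarithm, and the increments of its imaginary part along the
  four sides add up to 0.
\<close>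
lemma has_swing_homotopy:
  assumes cont: "continuous_on ({0..1} \<times> {a..b}) (\<lambda>(u,t). f u t)" and "a \<le> b"
    and nz: "\<And>u t. u \<in> {0..1} \<Longrightarrow> t \<in> {a..b} \<Longrightarrow> f u t \<noteq> 0"
    and "has_swing (f 0) a b d0" "has_swing (f 1) a b d1"
    and "has_swing (\<lambda>u. f u a) 0 1 e0" "has_swing (\<lambda>u. f u b) 0 1 e1"
  shows "d1 - d0 = e1 - e0"
proof -
  have "convex ({0..1::real} \<times> {a..b})" by (intro convex_Times) auto
  then obtain g where g: "continuous_on ({0..1} \<times> {a..b}) g"
     "\<And>x. x \<in> {0..1} \<times> {a..b} \<Longrightarrow> (\<lambda>(u,t). f u t) x = exp (g x)"
  proof (rule continuous_logarithm_on_contractible[OF cont convex_imp_contractible])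
    show "(\<lambda>(u,t). f u t) x \<noteq> 0" if "x \<in> {0..1} \<times> {a..b}" for x using nz that by auto
  qed auto
  have ge: "f u t = exp (g (u,t))" if "u \<in> {0..1}" "t \<in> {a..b}" for u t using g(2)[of "(u,t)"] that by auto
  have c1: "continuous_on {a..b} (\<lambda>t. g (u,t))" if "u \<in> {0..1}" for u
    by (rule continuous_on_compose2[OF g(1)]) (use that in \<open>auto intro!: continuous_intros\<close>)
  have c2: "continuous_on {0..1} (\<lambda>u. g (u,t))" if "t \<in> {a..b}" for t
    by (rule continuous_on_compose2[OF g(1)]) (use that in \<open>auto intro!: continuous_intros\<close>)
  have s1: "has_swing (f u) a b (Im (g (u,b)) - Im (g (u,a)))" if "u \<in> {0..1}" for u
    by (rule has_swing_sub[of "{a..b}"]) (use that in \<open>auto intro!: continuous_intros c1 simp: ge is_Arg_exp_Im\<close>)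
  have s2: "has_swing (\<lambda>u. f u t) 0 1 (Im (g (1,t)) - Im (g (0,t)))" if "t \<in> {a..b}" for t
    by (rule has_swing_sub[of "{0..1}"]) (use that in \<open>auto intro!: continuous_intros c2 simp: ge is_Arg_exp_Im\<close>)
  have "d0 = Im (g (0,b)) - Im (g (0,a))" "d1 = Im (g (1,b)) - Im (g (1,a))"
    using has_swing_unique[OF assms(4) s1] has_swing_unique[OF assms(5) s1] nz \<open>a \<le> b\<close> by auto
  moreover have "e0 = Im (g (1,a)) - Im (g (0,a))" "e1 = Im (g (1,b)) - Im (g (0,b))"
    using has_swing_unique[OF assms(6) s2] has_swing_unique[OF assms(7) s2] nz \<open>a \<le> b\<close> by auto
  ultimately show ?thesis by simp
qed

text \<open>
  In time less than \<open>\<rho>\<close> the curve stays in a disc that does not contain 0, which gives less than half a turn.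
\<close>
lemma swing_Lipschitz_bound:
  assumes "has_swing f 0 T d" "0 \<le> T" "0 < \<rho>"
    and lip: "\<And>s t. s \<in> {0..T} \<Longrightarrow> t \<in> {0..T} \<Longrightarrow> norm (f s - f t) \<le> \<bar>s - t\<bar>"
    and far: "\<And>t. t \<in> {0..T} \<Longrightarrow> \<rho> \<le> norm (f t)"
  shows "\<bar>d\<bar> \<le> pi * (T / \<rho> + 2)"
proof -
  obtain \<theta> where \<theta>: "continuous_on {0..T} \<theta>" "\<And>t. t\<in>{0..T} \<Longrightarrow> is_Arg (f t) (\<theta> t)" "d = \<theta> T - \<theta> 0"
    using assms(1) by (auto simp: has_swing_def)
  have cf: "continuous_on {0..T} f"
    by (rule lipschitz_on_continuous_on[of 1], rule lipschitz_onI) (use lip in \<open>auto simp: dist_norm\<close>)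
  have fnz: "f t \<noteq> 0" if "0 \<le> t" "t \<le> T" for t using far[of t] that \<open>0 < \<rho>\<close> by auto
  have step: "\<bar>\<theta> b - \<theta> a\<bar> \<le> pi" if ab: "0 \<le> a" "a \<le> b" "b \<le> T" "b - a < \<rho>" for a b
  proof -
    have "has_swing f a b (\<theta> b - \<theta> a)" by (rule has_swing_sub[of "{0..T}"]) (use \<theta> ab in auto)
    moreover have "has_swing f a b (turn (f a) (f b))"
    proof (rule has_swing_from_start)
      fix t assume t: "t \<in> {a..b}"
      have "dist (f a) (f t) < \<rho>" using lip[of a t] t ab by (auto simp: dist_norm)
      then have "closed_segment (f a) (f t) \<subseteq> ball (f a) \<rho>"
        using \<open>0 < \<rho>\<close> by (intro closed_segment_subset) auto
      then show "0 \<notin> closed_segment (f a) (f t)" using far[of a] ab by (auto simp: dist_norm)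
    qed (use ab cf in \<open>auto intro: continuous_on_subset\<close>)
    ultimately have "\<theta> b - \<theta> a = turn (f a) (f b)"
      using ab by (intro has_swing_unique[of f a b]) (auto simp: fnz)
    then show ?thesis using abs_turn_le by metis
  qed
  define N where "N = nat \<lfloor>T / \<rho>\<rfloor> + 1"
  have N: "T / \<rho> < real N" "real N \<le> T / \<rho> + 1" using assms(2,3)
    by (auto simp: N_def of_nat_nat nat_add_distrib) linarith+
  have Np: "N > 0" by (simp add: N_def)
  define x where "x i = T * real i / N" for i
  have "\<bar>\<theta> (x n) - \<theta> 0\<bar> \<le> pi * n" if "n \<le> N" for n
    using that
  proof (induction n)
    case 0 then show ?case by (simp add: x_def)
  next
    case (Suc n)
    have "x (Suc n) - x n = T / N" by (simp add: x_def algebra_simps add_divide_distrib)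
    moreover have "T / N < \<rho>" using N(1) Np assms(3) by (simp add: field_simps)
    moreover have "x (Suc n) \<le> T" using Suc.prems Np assms(2)
      unfolding x_def by (simp add: pos_divide_le_eq mult_left_mono del: of_nat_Suc)
    moreover have "0 \<le> x n" "0 \<le> T / N" using assms(2) by (auto simp: x_def)
    ultimately have "\<bar>\<theta> (x (Suc n)) - \<theta> (x n)\<bar> \<le> pi" by (intro step) auto
    with Suc show ?case by (auto simp: algebra_simps)
  qed
  from this[of N] have "\<bar>d\<bar> \<le> pi * real N" using Np \<theta>(3) by (simp add: x_def)
  also have "\<dots> \<le> pi * (T / \<rho> + 2)" using N by (intro mult_left_mono) auto
  finally show ?thesis .
qed

section \<open>The unfolding group and the folding map\<close>

definition sg :: "int \<Rightarrow> 'a::comm_ring_1" where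
  "sg p = (if even p then 1 else - 1)"

text \<open>
  Composition in the group of the isometries \<open>cell_map k\<close>, transported to \<open>\<int> \<times> \<int>\<close>.
\<close>
definition act :: "int \<times> int \<Rightarrow> int \<times> int \<Rightarrow> int \<times> int" where
  "act k m = (fst k + sg (fst k) * fst m, snd k + sg (snd k) * snd m)"

definition cell_inv :: "int \<times> int \<Rightarrow> int \<times> int" where
  "cell_inv k = (- (sg (fst k) * fst k), - (sg (snd k) * snd k))"

definition lin :: "int \<times> int \<Rightarrow> complex \<Rightarrow> complex" where
  "lin k v = Complex (sg (fst k) * Re v) (sg (snd k) * Im v)"

definition centre :: "int \<times> int \<Rightarrow> complex" where
  "centre k = Complex (of_int (fst k)) (of_int (snd k))"

lemma centre_sel [simp]: "Re (centre k) = of_int (fst k)" "Im (centre k) = of_int (snd k)"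
  by (auto simp: centre_def)

lemma centre_0 [simp]: "centre (0,0) = 0"
  by (auto simp: centre_def complex_eq_iff)

lemma lin_sel [simp]: "Re (lin k v) = sg (fst k) * Re v" "Im (lin k v) = sg (snd k) * Im v"
  by (auto simp: lin_def)

lemma sg_square [simp]: "sg p * (sg p * x) = x"
  by (simp add: sg_def)

lemma cell_map_eq: "cell_map k x = centre k + lin k x"
  by (simp add: cell_map_def complex_eq_iff sg_def)

lemma cell_map_sel [simp]:
  "Re (cell_map k x) = of_int (fst k) + sg (fst k) * Re x"
  "Im (cell_map k x) = of_int (snd k) + sg (snd k) * Im x"
  by (simp_all add: cell_map_eq)

lemma cell_map_act: "cell_map (act k m) x = cell_map k (cell_map m x)"
  by (simp add: complex_eq_iff act_def sg_def)

lemma cell_map_0 [simp]: "cell_map (0,0) x = x"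
  by (simp add: complex_eq_iff sg_def)

lemma act_0 [simp]: "act k (0,0) = k" "act (0,0) k = k"
  by (simp_all add: act_def sg_def)

lemma act_assoc: "act (act k m) l = act k (act m l)"
  by (simp add: act_def sg_def)

lemma act_inv [simp]: "act k (cell_inv k) = (0,0)" "act (cell_inv k) k = (0,0)"
  by (simp_all add: act_def cell_inv_def sg_def)

lemma act_cancel [simp]: "act (cell_inv k) (act k m) = m" "act k (act (cell_inv k) m) = m"
  by (simp_all add: act_assoc[symmetric])

lemma act_inj: "act k m = act k l \<longleftrightarrow> m = l"
  by (metis act_cancel(1))

lemma cell_inv_inv [simp]: "cell_inv (cell_inv k) = k"
  by (simp add: cell_inv_def sg_def prod_eq_iff)

lemma cell_inv_0 [simp]: "cell_inv (0,0) = (0,0)" "cell_inv k = (0,0) \<longleftrightarrow> k = (0,0)"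
  by (auto simp add: cell_inv_def sg_def prod_eq_iff)

lemma cell_map_inv [simp]: "cell_map (cell_inv k) (cell_map k x) = x" "cell_map k (cell_map (cell_inv k) x) = x"
  by (simp_all add: cell_map_act[symmetric])

lemma linear_lin: "linear (lin k)"
  by (rule linearI) (simp_all add: complex_eq_iff algebra_simps)

lemma lin_diff: "lin k (x - y) = lin k x - lin k y"
  by (simp add: complex_eq_iff algebra_simps)

lemma lin_scaleR: "lin k (c *\<^sub>R x) = c *\<^sub>R lin k x"
  by (simp add: complex_eq_iff algebra_simps)

lemma lin_lin [simp]: "lin k (lin k x) = x"
  by (simp add: complex_eq_iff)

lemma inner_lin: "lin k x \<bullet> lin k y = x \<bullet> y"
  by (simp add: inner_complex_def sg_def)

lemma norm_lin [simp]: "norm (lin k x) = norm x"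
  by (simp add: norm_eq_sqrt_inner inner_lin)

lemma inj_lin: "inj (lin k)"
  by (metis injI lin_lin)

lemma cell_map_diff: "cell_map k x - cell_map k y = lin k (x - y)"
  by (simp add: cell_map_eq lin_diff)

lemma cell_map_add: "cell_map k (x + y) = cell_map k x + lin k y"
  by (simp add: complex_eq_iff algebra_simps)

lemma norm_cell_map_diff: "norm (cell_map k x - cell_map k y) = norm (x - y)"
  by (simp add: cell_map_diff)

lemma cell_map_convex_comb:
  "cell_map k ((1 - u) *\<^sub>R x + u *\<^sub>R y) = (1 - u) *\<^sub>R cell_map k x + u *\<^sub>R cell_map k y"
  by (simp add: complex_eq_iff algebra_simps)

lemma cell_map_inv_eq: "cell_map (cell_inv k) y = lin k (y - centre k)"
  by (simp add: complex_eq_iff cell_inv_def sg_def)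

lemma continuous_on_lin [continuous_intros]:
  "continuous_on S f \<Longrightarrow> continuous_on S (\<lambda>x. lin k (f x))"
  unfolding lin_def by (intro continuous_intros)

lemma continuous_on_cell_map [continuous_intros]:
  "continuous_on S f \<Longrightarrow> continuous_on S (\<lambda>x. cell_map k (f x))"
  unfolding cell_map_eq by (intro continuous_intros)

text \<open>
  The triangle wave, equal to \<open>(-1)^p (y - p)\<close> on \<open>[p - 1/2, p + 1/2]\<close>. In this form its continuity and
  its symmetries are those of the sine.
\<close>
definition tri :: "real \<Rightarrow> real" where
  "tri y = arcsin (sin (pi * y)) / pi"

lemma tri_eq:
  assumes "\<bar>y - of_int p\<bar> \<le> 1/2"
  shows "tri y = sg p * (y - of_int p)"
proof -
  define d where "d = y - of_int p"
  have d: "- (pi/2) \<le> pi * d" "pi * d \<le> pi/2"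
  proof -
    have "-1/2 \<le> d" "d \<le> 1/2" using assms unfolding d_def by linarith+
    then show "- (pi/2) \<le> pi * d" "pi * d \<le> pi/2"
      using mult_left_mono[of d "1/2" pi] mult_left_mono[of "-1/2" d pi] by auto
  qed
  have "sin (pi * y) = sin (pi * of_int p + pi * d)" by (simp add: d_def algebra_simps)
  also have "\<dots> = sg p * sin (pi * d)"
    by (simp add: sin_add sg_def)
  also have "\<dots> = sin (sg p * (pi * d))" by (simp add: sg_def)
  finally have "sin (pi * y) = sin (sg p * (pi * d))" .
  moreover have "arcsin (sin (sg p * (pi * d))) = sg p * (pi * d)"
  proof (cases "even p")
    case False
    then have "sg p * (pi * d) = - (pi * d)" by (simp add: sg_def)
    then show ?thesis using d by (intro arcsin_sin) linarith+
  qed (use d in \<open>simp add: sg_def arcsin_sin\<close>)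
  ultimately have "arcsin (sin (pi * y)) = sg p * (pi * d)" by simp
  then show ?thesis by (simp add: tri_def d_def)
qed

lemma ex_cell: "\<exists>p::int. \<bar>(y::real) - of_int p\<bar> \<le> 1/2"
  using of_int_round_abs_le[of y] by (intro exI[of _ "round y"]) (simp add: abs_minus_commute)

lemma abs_tri_le: "\<bar>tri y\<bar> \<le> 1/2"
proof -
  obtain p :: int where "\<bar>y - of_int p\<bar> \<le> 1/2" using ex_cell by blast
  then show ?thesis by (simp add: tri_eq sg_def abs_minus_commute)
qed

lemma tri_reflect: "tri (of_int p + sg p * y) = tri y"
proof -
  obtain q :: int where q: "\<bar>y - of_int q\<bar> \<le> 1/2" using ex_cell by blast
  have "\<bar>of_int p + sg p * y - of_int (p + sg p * q)\<bar> \<le> 1/2" using q by (auto simp: sg_def abs_minus_commute)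
  from tri_eq[OF this] tri_eq[OF q] show ?thesis by (simp add: sg_def)
qed

lemma continuous_on_tri [continuous_intros]:
  fixes f :: "'a::t2_space \<Rightarrow> real"
  shows "continuous_on S f \<Longrightarrow> continuous_on S (\<lambda>x. tri (f x))"
  unfolding tri_def by (intro continuous_on_divide continuous_on_arcsin continuous_on_sin continuous_on_mult continuous_on_const) auto

text \<open>
  The symmetry \<open>tri_reflect\<close> moves \<open>x\<close> into \<open>[-1/2, 1/2]\<close>, where \<open>tri\<close> is the identity.
\<close>
lemma tri_Lipschitz: "\<bar>tri x - tri y\<bar> \<le> \<bar>x - y\<bar>"
proof -
  have base: "\<bar>a - tri b\<bar> \<le> \<bar>a - b\<bar>" if a: "\<bar>a\<bar> \<le> 1/2" for a b
  proof -
    obtain q :: int where q: "\<bar>b - of_int q\<bar> \<le> 1/2" using ex_cell by blast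
    consider "q = 0" | "q = 1" | "q = -1" | "q \<ge> 2" | "q \<le> -2" by linarith
    then show ?thesis
    proof cases
      case 4 then have "b \<ge> 3/2" using q by linarith
      then show ?thesis using a abs_tri_le[of b] by linarith
    next
      case 5 then have "b \<le> -3/2" using q by linarith
      then show ?thesis using a abs_tri_le[of b] by linarith
    qed (use a q tri_eq[OF q] in \<open>auto simp: sg_def abs_if split: if_splits\<close>)
  qed
  obtain p :: int where p: "\<bar>x - of_int p\<bar> \<le> 1/2" using ex_cell by blast
  define a b where "a = sg p * (x - of_int p)" and "b = sg p * (y - of_int p)"
  have "tri x = a" using p by (simp add: tri_eq a_def)
  moreover have "tri y = tri b" using tri_reflect[of p b] by (simp add: b_def)
  moreover have "\<bar>a\<bar> \<le> 1/2" using p by (simp add: a_def sg_def abs_minus_commute)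
  ultimately have "\<bar>tri x - tri y\<bar> \<le> \<bar>a - b\<bar>" using base by simp
  also have "\<dots> = \<bar>x - y\<bar>" by (simp add: a_def b_def sg_def abs_minus_commute)
  finally show ?thesis .
qed

definition fold_plane :: "complex \<Rightarrow> complex" where
  "fold_plane x = Complex (tri (Re x)) (tri (Im x))"

lemma fold_plane_sel [simp]: "Re (fold_plane x) = tri (Re x)" "Im (fold_plane x) = tri (Im x)"
  by (simp_all add: fold_plane_def)

lemma fold_cell_map [simp]: "fold_plane (cell_map k x) = fold_plane x"
  by (simp add: complex_eq_iff tri_reflect)

lemma fold_square: "x \<in> square \<Longrightarrow> fold_plane x = x"
  using tri_eq[of "Re x" 0] tri_eq[of "Im x" 0] by (simp add: square_def complex_eq_iff sg_def)

lemma fold_in_square: "fold_plane x \<in> square"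
  using abs_tri_le by (simp add: square_def)

lemma ex_cell_map_fold: "\<exists>k. x = cell_map k (fold_plane x)"
proof -
  obtain p :: int where p: "\<bar>Re x - of_int p\<bar> \<le> 1/2" using ex_cell by blast
  obtain q :: int where q: "\<bar>Im x - of_int q\<bar> \<le> 1/2" using ex_cell by blast
  show ?thesis using tri_eq[OF p] tri_eq[OF q]
    by (intro exI[of _ "(p,q)"]) (simp add: complex_eq_iff)
qed

lemma continuous_on_fold [continuous_intros]:
  fixes f :: "'a::t2_space \<Rightarrow> complex"
  shows "continuous_on S f \<Longrightarrow> continuous_on S (\<lambda>x. fold_plane (f x))"
  unfolding fold_plane_def by (intro continuous_intros)

lemma fold_Lipschitz: "norm (fold_plane x - fold_plane y) \<le> norm (x - y)"
  using tri_Lipschitz[of "Re x" "Re y"] tri_Lipschitz[of "Im x" "Im y"]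
  by (simp add: cmod_def power2_le_iff_abs_le abs_le_square_iff real_sqrt_le_iff add_mono)

lemma in_square_norm: "norm x \<le> 1/2 \<Longrightarrow> x \<in> square"
  using abs_Re_le_cmod[of x] abs_Im_le_cmod[of x] by (auto simp: square_def)

lemma norm_centre_ge_1: "k \<noteq> (0,0) \<Longrightarrow> 1 \<le> norm (centre k)"
proof -
  assume "k \<noteq> (0,0)"
  then have "fst k \<noteq> 0 \<or> snd k \<noteq> 0" by (auto simp: prod_eq_iff)
  then have "1 \<le> \<bar>Re (centre k)\<bar> \<or> 1 \<le> \<bar>Im (centre k)\<bar>" by auto
  then show ?thesis using abs_Re_le_cmod[of "centre k"] abs_Im_le_cmod[of "centre k"] by linarith
qed

text \<open>
  The rational radius 9/25 is good enough for every estimate except the one for two perpendicular unit steps.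
\<close>
lemma sqrt2_bound: "sqrt 2 / 4 < 9/25"
  using real_less_lsqrt[of "36/25" 2] by (simp add: power2_eq_square)

section \<open>The obstacle and its copies\<close>

locale small_obstacle =
  fixes Ob :: "complex set" and z :: complex
  assumes Ob: "obstacle Ob" and small_Ob: "small Ob" and z_interior: "z \<in> interior Ob"
begin

lemma compact_Ob: "compact Ob" and convex_Ob: "convex Ob" and closed_Ob: "closed Ob"
  using Ob by (auto simp: obstacle_def compact_imp_closed)

lemma Ob_norm_less: "x \<in> Ob \<Longrightarrow> norm x < sqrt 2 / 4"
  using small_Ob unfolding small_def by force

lemma Ob_norm: "x \<in> Ob \<Longrightarrow> norm x \<le> 9/25"
  using Ob_norm_less[of x] sqrt2_bound by simp

lemma Ob_square: "x \<in> Ob \<Longrightarrow> x \<in> square"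
  by (intro in_square_norm) (use Ob_norm[of x] in simp)

lemma z_Ob: "z \<in> Ob"
  using z_interior interior_subset by auto

lemma fold_Ob [simp]: "x \<in> Ob \<Longrightarrow> fold_plane x = x"
  by (simp add: Ob_square fold_square)

lemma in_copy_iff: "x \<in> copy Ob k \<longleftrightarrow> cell_map (cell_inv k) x \<in> Ob"
  unfolding copy_def by (metis cell_map_inv image_iff)

lemma cell_map_in_copy [simp]: "cell_map k x \<in> copy Ob k \<longleftrightarrow> x \<in> Ob"
  by (simp add: in_copy_iff)

lemma copy_act: "copy Ob (act g k) = cell_map g ` copy Ob k"
  unfolding copy_def by (force simp: cell_map_act)

lemma copy_0 [simp]: "copy Ob (0,0) = Ob"
  by (auto simp: in_copy_iff)

lemma fold_copy: "x \<in> copy Ob k \<Longrightarrow> fold_plane x \<in> Ob"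
  by (auto simp: copy_def)

lemma fold_in_Ob_iff: "fold_plane x \<in> Ob \<longleftrightarrow> (\<exists>k. x \<in> copy Ob k)"
  using fold_copy ex_cell_map_fold[of x] by (metis cell_map_in_copy)

lemma copy_centre: "x \<in> copy Ob k \<Longrightarrow> norm (x - centre k) \<le> 9/25"
  using Ob_norm by (auto simp: copy_def cell_map_eq)

lemma copy_unique: assumes "x \<in> copy Ob k" "x \<in> copy Ob m" shows "k = m"
proof (rule ccontr)
  assume "k \<noteq> m"
  have "norm (centre k - centre m) < 1"
    using copy_centre[OF assms(1)] copy_centre[OF assms(2)]
      norm_triangle_ineq4[of "x - centre m" "x - centre k"] by simp
  moreover have "centre k - centre m = centre (fst k - fst m, snd k - snd m)"
    by (simp add: complex_eq_iff)
  ultimately show False using norm_centre_ge_1[of "(fst k - fst m, snd k - snd m)"] \<open>k \<noteq> m\<close>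
    by (auto simp: prod_eq_iff)
qed

lemma copy_translate: "copy Ob k = (+) (centre k) ` (lin k ` Ob)"
  by (auto simp: copy_def cell_map_eq image_image)

lemma compact_copy: "compact (copy Ob k)" and convex_copy: "convex (copy Ob k)"
  unfolding copy_translate
  by (auto intro!: compact_translation compact_continuous_image continuous_intros compact_Ob
      convex_translation convex_linear_image[OF linear_lin] convex_Ob)

lemma closed_copy: "closed (copy Ob k)"
  using compact_copy compact_imp_closed by blast

lemma interior_copy: "interior (copy Ob k) = cell_map k ` interior Ob"
proof -
  have "interior (copy Ob k) = (+) (centre k) ` interior (lin k ` Ob)"
    unfolding copy_translate by (rule interior_translation)
  also have "interior (lin k ` Ob) = lin k ` interior Ob"
    by (rule interior_injective_linear_image[OF linear_lin inj_lin])
  finally show ?thesis by (simp add: image_image cell_map_eq)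
qed

lemma frontier_copy: "frontier (copy Ob k) = cell_map k ` frontier Ob"
proof -
  have inj: "inj (cell_map k)" by (metis injI cell_map_inv(1))
  have "frontier (copy Ob k) = copy Ob k - interior (copy Ob k)"
    using closed_copy by (simp add: frontier_def)
  also have "\<dots> = cell_map k ` (Ob - interior Ob)"
    unfolding interior_copy image_set_diff[OF inj] by (simp add: copy_def)
  finally show ?thesis using closed_Ob by (simp add: frontier_def)
qed

lemma frontier_copy_subset: "frontier (copy Ob k) \<subseteq> copy Ob k"
  using closed_copy frontier_subset_closed by blast

lemma outward_normal_cell_map:
  "outward_normal (copy Ob k) (cell_map k x) (lin k n) \<longleftrightarrow> outward_normal Ob x n"
proof -
  have inj: "inj (cell_map k)" by (metis injI cell_map_inv(1))
  show ?thesis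
    unfolding outward_normal_def frontier_copy inj_image_mem_iff[OF inj]
    by (simp add: copy_def cell_map_diff inner_lin)
qed

lemma mirror_lin: "mirror (lin k n) (lin k v) = lin k (mirror n v)"
  by (simp add: mirror_def inner_lin lin_diff lin_scaleR)

lemma convex_hull_cell_map: "convex hull (cell_map g ` S) = cell_map g ` (convex hull S)"
proof -
  have *: "cell_map g ` T = (+) (centre g) ` (lin g ` T)" for T
    by (auto simp: cell_map_eq image_image)
  show ?thesis unfolding * convex_hull_translation convex_hull_linear_image[OF linear_lin, symmetric] ..
qed

lemma lies_between_act: "lies_between Ob (act g k) (act g i) (act g j) \<longleftrightarrow> lies_between Ob k i j"
proof -
  have inj: "inj (cell_map g)" by (metis injI cell_map_inv(1))
  show ?thesis
    unfolding lies_between_def copy_act image_Un[symmetric] convex_hull_cell_map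
      image_Int[OF inj, symmetric] act_inj by simp
qed

text \<open>
  Admissibility of a single step, seen from the cell in which the step starts.
\<close>
definition free :: "int \<times> int \<Rightarrow> bool" where
  "free m \<longleftrightarrow> m \<noteq> (0,0) \<and> \<not> (\<exists>k. lies_between Ob k (0,0) m)"

text \<open>
  Admissibility of two consecutive steps, seen from the cell of the middle obstacle: the path comes from
  the cell \<open>cell_inv m\<close> and goes on to the cell \<open>m'\<close>.
\<close>
definition turnable :: "int \<times> int \<Rightarrow> int \<times> int \<Rightarrow> bool" where
  "turnable m m' \<longleftrightarrow> \<not> lies_between Ob (0,0) (cell_inv m) m'"

lemma free_segment:
  assumes "free m" "a \<in> Ob" "b \<in> Ob" "x \<in> closed_segment a (cell_map m b)" "x \<in> copy Ob k"
  shows "k = (0,0) \<or> k = m"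
proof -
  have "closed_segment a (cell_map m b) \<subseteq> convex hull (copy Ob (0,0) \<union> copy Ob m)"
    by (intro closed_segment_subset) (auto intro!: hull_inc simp: assms)
  then show ?thesis using assms unfolding free_def lies_between_def by blast
qed

lemma free_cell_inv: assumes "free m" shows "free (cell_inv m)"
proof -
  have "lies_between Ob (act m k) (0,0) m" if "lies_between Ob k (0,0) (cell_inv m)" for k
  proof -
    have "lies_between Ob (act m k) (act m (0,0)) (act m (cell_inv m))"
      using that by (simp only: lies_between_act)
    then show ?thesis by (simp add: lies_between_def Un_commute conj_commute)
  qed
  then show ?thesis using assms unfolding free_def by (metis cell_inv_0(2))
qed

lemma turnable_cell_inv: "turnable m m' \<Longrightarrow> turnable (cell_inv m') (cell_inv m)"
  unfolding turnable_def by (auto simp: lies_between_def Un_commute)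

text \<open>
  If the directions back and forth were opposite, the vertex \<open>b\<close> would lie in the convex hull of the two
  neighbouring obstacles.
\<close>
lemma turnable_segment:
  assumes "turnable m m'" "free m" "free m'" "a \<in> Ob" "b \<in> Ob" "c \<in> Ob"
  shows "0 \<notin> closed_segment (cell_map (cell_inv m) a - b) (cell_map m' c - b)"
proof
  assume "0 \<in> closed_segment (cell_map (cell_inv m) a - b) (cell_map m' c - b)"
  then obtain u where u: "0 \<le> u" "u \<le> 1"
    "0 = (1 - u) *\<^sub>R (cell_map (cell_inv m) a - b) + u *\<^sub>R (cell_map m' c - b)"
    unfolding closed_segment_def by blast
  then have "b = (1 - u) *\<^sub>R cell_map (cell_inv m) a + u *\<^sub>R cell_map m' c"
    by (simp add: algebra_simps)
  then have "b \<in> closed_segment (cell_map (cell_inv m) a) (cell_map m' c)"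
    unfolding closed_segment_def using u by blast
  also have "\<dots> \<subseteq> convex hull (copy Ob (cell_inv m) \<union> copy Ob m')"
    by (intro closed_segment_subset) (auto intro!: hull_inc simp: assms)
  finally have "lies_between Ob (0,0) (cell_inv m) m'"
    unfolding lies_between_def using assms(2,3,5) copy_0 free_def cell_inv_0(2) by (metis disjoint_iff)
  then show False using assms by (simp add: turnable_def)
qed

lemma step_nonzero:
  assumes "free m" "a \<in> Ob" "b \<in> Ob" shows "a \<noteq> cell_map m b"
  using assms copy_unique[of a "(0,0)" m] by (auto simp: free_def)

text \<open>
  This is where the smoothness of the boundary enters. If the ray in direction \<open>u\<close> missed the interior,
  a line separating them would be a second supporting line at \<open>x\<close>, but both supporting lines contain the tangent
  vector of the boundary curve.
\<close>
lemma smooth_inward: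
  assumes n: "outward_normal Ob x n" and u: "n \<bullet> u < 0"
  shows "\<exists>e>0. x + e *\<^sub>R u \<in> interior Ob"
proof (rule ccontr)
  assume none: "\<not> (\<exists>e>0. x + e *\<^sub>R u \<in> interior Ob)"
  have xf: "x \<in> frontier Ob" and nn: "norm n = 1" and nle: "\<And>y. y \<in> Ob \<Longrightarrow> n \<bullet> (y - x) \<le> 0"
    using n by (auto simp: outward_normal_def)
  define ray where "ray = (\<lambda>e. x + e *\<^sub>R u) ` {0..}"
  have "convex ray"
  proof -
    have "ray = (+) x ` ((\<lambda>e. e *\<^sub>R u) ` {0..})" by (auto simp: ray_def image_image)
    moreover have "convex ((\<lambda>e::real. e *\<^sub>R u) ` {0..})"
      by (intro convex_linear_image linearI) (auto simp: scaleR_left_distrib)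
    ultimately show ?thesis using convex_translation by metis
  qed
  moreover have "x \<notin> interior Ob" using xf by (simp add: frontier_def)
  then have "x + e *\<^sub>R u \<notin> interior Ob" if "0 \<le> e" for e
    using none that by (cases "e = 0") auto
  then have "ray \<inter> interior Ob = {}" by (auto simp: ray_def)
  moreover have "x \<in> ray" unfolding ray_def by (rule image_eqI[of _ _ 0]) auto
  ultimately obtain m b where mb: "m \<noteq> 0" "\<And>y. y \<in> ray \<Longrightarrow> m \<bullet> y \<le> b" "\<And>y. y \<in> interior Ob \<Longrightarrow> b \<le> m \<bullet> y"
    using separating_hyperplane_sets[of ray "interior Ob"] convex_interior[OF convex_Ob] z_interior by blast
  have "Ob \<subseteq> closure (interior Ob)"
    using convex_closure_interior[OF convex_Ob] z_interior closure_subset by auto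
  moreover have "closure (interior Ob) \<subseteq> {y. b \<le> m \<bullet> y}"
    by (rule closure_minimal) (use mb(3) closed_halfspace_ge in auto)
  ultimately have mOb: "b \<le> m \<bullet> y" if "y \<in> Ob" for y using that by blast
  have xOb: "x \<in> Ob" using xf closed_Ob frontier_subset_closed by blast
  have mx: "m \<bullet> x = b" using mb(2)[OF \<open>x \<in> ray\<close>] mOb[OF xOb] by simp
  have "x + 1 *\<^sub>R u \<in> ray" unfolding ray_def by (rule image_eqI[of _ _ 1]) auto
  from mb(2)[OF this] have mu: "m \<bullet> u \<le> 0" using mx by (simp add: inner_add_right)
  obtain D where D: "\<And>n t. (D n has_vector_derivative D (Suc n) t) (at t)" "\<And>t. D 1 t \<noteq> (0::complex)"
    "frontier Ob = D 0 ` {0..<1::real}" "\<And>t. D 0 (t + 1) = D 0 t"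
    using Ob unfolding obstacle_def smooth_boundary_def by blast
  obtain t0 where t0: "x = D 0 t0" "t0 \<in> {0..<1}" using D(3) xf by blast
  have DOb: "D 0 t \<in> Ob" if "t \<in> {-1<..<1}" for t
  proof -
    have "D 0 t \<in> frontier Ob"
    proof (cases "t \<ge> 0")
      case False
      then have "D 0 (t + 1) \<in> frontier Ob" using that unfolding D(3) by auto
      then show ?thesis by (simp add: D(4))
    qed (use that D(3) in auto)
    then show ?thesis using closed_Ob frontier_subset_closed by blast
  qed
  have der: "((\<lambda>t. c \<bullet> D 0 t) has_real_derivative c \<bullet> D 1 t0) (at t0)" for c
    using D(1)[of 0 t0] unfolding has_real_derivative_iff_has_vector_derivative has_vector_derivative_def
    by (auto intro!: derivative_eq_intros simp: inner_scaleR_right)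
  define e where "e = min (1 - t0) (t0 + 1)"
  have e: "0 < e" using t0 by (auto simp: e_def)
  have near: "t \<in> {-1<..<1}" if "\<bar>t0 - t\<bar> < e" for t using that by (auto simp: e_def abs_if split: if_splits)
  \<comment> \<open>Both linear functionals have an extremum over the boundary curve at \<open>t0\<close>.\<close>
  have n0: "n \<bullet> D 1 t0 = 0"
    by (rule DERIV_local_max[OF der e]) (use nle[OF DOb[OF near]] t0 in \<open>auto simp: inner_diff_right\<close>)
  have m0: "m \<bullet> D 1 t0 = 0"
    by (rule DERIV_local_min[OF der e]) (use mOb[OF DOb[OF near]] t0 mx in auto)
  obtain c where c: "m = c *\<^sub>R n"
  proof -
    have "Re n * Re (D 1 t0) + Im n * Im (D 1 t0) = 0" "Re m * Re (D 1 t0) + Im m * Im (D 1 t0) = 0"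
      using n0 m0 by (auto simp: inner_complex_def)
    moreover have "Re (D 1 t0) \<noteq> 0 \<or> Im (D 1 t0) \<noteq> 0" using D(2)[of t0] by (auto simp: complex_eq_iff)
    ultimately have det: "Re n * Im m = Im n * Re m" by algebra
    have n1: "Re n * Re n + Im n * Im n = 1" using nn by (simp add: cmod_def power2_eq_square)
    have "m = (Re n * Re m + Im n * Im m) *\<^sub>R n"
    proof (rule complex_eqI)
      show "Re m = Re ((Re n * Re m + Im n * Im m) *\<^sub>R n)" using det n1 by simp algebra
      show "Im m = Im ((Re n * Re m + Im n * Im m) *\<^sub>R n)" using det n1 by simp algebra
    qed
    then show ?thesis using that by blast
  qed
  have "c \<noteq> 0" using c mb(1) by auto
  have "c * (n \<bullet> u) \<le> 0" using mu c by simp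
  then have "c > 0" using u \<open>c \<noteq> 0\<close> by (simp add: mult_le_0_iff)
  \<comment> \<open>Now \<open>m\<close> is a positive multiple of \<open>n\<close> and gives the opposite inequality, so the obstacle would be flat.\<close>
  have flat: "n \<bullet> (y - x) = 0" if "y \<in> Ob" for y
  proof -
    have "c * (n \<bullet> (y - x)) \<ge> 0" using mOb[OF that] mx c by (simp add: inner_diff_right algebra_simps)
    then show ?thesis using nle[OF that] \<open>c > 0\<close> by (simp add: zero_le_mult_iff)
  qed
  obtain r where r: "0 < r" "cball z r \<subseteq> Ob" using z_interior mem_interior_cball by blast
  have "z + r *\<^sub>R n \<in> cball z r" using r nn by (simp add: dist_norm)
  then have "n \<bullet> (z + r *\<^sub>R n - x) = 0" "n \<bullet> (z - x) = 0" using flat r z_Ob by auto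
  moreover have "n \<bullet> (z + r *\<^sub>R n - x) = n \<bullet> (z - x) + r"
    using nn by (simp add: inner_diff_right inner_add_right dot_square_norm)
  ultimately show False using r by simp
qed

lemma outward_normal_interior:
  assumes "outward_normal Ob x n" "y \<in> interior Ob" shows "n \<bullet> (y - x) < 0"
proof -
  obtain r where r: "0 < r" "cball y r \<subseteq> Ob" using assms(2) mem_interior_cball by blast
  have nn: "norm n = 1" using assms by (simp add: outward_normal_def)
  have "y + r *\<^sub>R n \<in> Ob" using r nn by (intro subsetD[OF r(2)]) (simp add: dist_norm)
  then have "n \<bullet> (y + r *\<^sub>R n - x) \<le> 0" using assms by (simp add: outward_normal_def)
  moreover have "n \<bullet> (y + r *\<^sub>R n - x) = n \<bullet> (y - x) + r"
    using nn by (simp add: inner_diff_right inner_add_right dot_square_norm)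
  ultimately show ?thesis using r by simp
qed

end

section \<open>Regularised rotation of a polygonal path\<close>

text \<open>
  It is 1 up to distance 2/5, which leaves a margin of 1/25 around the disc of radius 9/25 containing the obstacle, and
  0 from distance 1/2 on, so that bumps around different lattice points do not overlap.
\<close>
definition bump :: "real \<Rightarrow> real" where
  "bump y = max 0 (min 1 (5 - 10 * y))"

lemma bump_range: "0 \<le> bump y" "bump y \<le> 1"
  by (auto simp: bump_def)

lemma bump_near: "y \<le> 2/5 \<Longrightarrow> bump y = 1" and bump_far: "1/2 \<le> y \<Longrightarrow> bump y = 0"
  by (auto simp: bump_def)

text \<open>
  After the proportion \<open>margin m\<close> of a link of type \<open>m\<close> the path has moved by at most 1/25, since the
  link is not longer than \<open>norm (centre m) + 1\<close>.
\<close>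
definition margin :: "int \<times> int \<Rightarrow> real" where
  "margin m = 1 / (25 * (norm (centre m) + 1))"

lemma margin_bounds: "0 < margin m" "margin m < 1/2" "margin m \<le> 1 - margin m"
proof -
  have "0 < norm (centre m) + 1" using norm_ge_zero[of "centre m"] by linarith
  then show *: "0 < margin m" unfolding margin_def by simp
  have "margin m \<le> 1 / 25" unfolding margin_def by (rule frac_le) auto
  then show "margin m < 1/2" "margin m \<le> 1 - margin m" by auto
qed

lemma norm_centre_inv [simp]: "norm (centre (cell_inv m)) = norm (centre m)"
  by (simp add: cmod_def cell_inv_def sg_def)

lemma margin_inv [simp]: "margin (cell_inv m) = margin m"
  by (simp add: margin_def)

context small_obstacle
begin

definition link :: "int \<times> int \<Rightarrow> complex \<Rightarrow> complex \<Rightarrow> real \<Rightarrow> complex" where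
  "link m a b t = (1 - t) *\<^sub>R a + t *\<^sub>R cell_map m b"

text \<open>
  The point around which the angle is measured when the moving point is at \<open>x\<close>, in folded coordinates:
  \<open>z\<close> away from the two obstacles, but the end point of the link itself close to its obstacle. The vector from
  the pivot to the moving point therefore never vanishes inside the link, even where the link passes through
  a copy of \<open>z\<close>.
\<close>
definition pivot :: "int \<times> int \<Rightarrow> complex \<Rightarrow> complex \<Rightarrow> complex \<Rightarrow> complex" where
  "pivot m a b x = z + bump (norm x) *\<^sub>R (a - z) + bump (norm (x - centre m)) *\<^sub>R (b - z)"

definition spoke :: "int \<times> int \<Rightarrow> complex \<Rightarrow> complex \<Rightarrow> real \<Rightarrow> complex" where
  "spoke m a b t = fold_plane (link m a b t) - pivot m a b (link m a b t)"

lemma bump_disjoint: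
  assumes "m \<noteq> (0,0)" shows "bump (norm x) = 0 \<or> bump (norm (x - centre m)) = 0"
proof (rule ccontr)
  assume "\<not> ?thesis"
  then have "norm x < 1/2" "norm (x - centre m) < 1/2" using bump_far not_le by metis+
  moreover have "norm (centre m) \<le> norm x + norm (x - centre m)"
    using norm_triangle_ineq4[of x "x - centre m"] by simp
  ultimately show False using norm_centre_ge_1[OF assms] by simp
qed

lemma convex_Ob_scaled: "a \<in> Ob \<Longrightarrow> 0 \<le> r \<Longrightarrow> r \<le> 1 \<Longrightarrow> z + r *\<^sub>R (a - z) \<in> Ob"
  using convexD_alt[OF convex_Ob z_Ob, of a r] by (simp add: algebra_simps)

lemma pivot_in_Ob:
  assumes "free m" "a \<in> Ob" "b \<in> Ob" shows "pivot m a b x \<in> Ob"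
proof -
  have "bump (norm x) = 0 \<or> bump (norm (x - centre m)) = 0"
    by (rule bump_disjoint) (use assms in \<open>simp add: free_def\<close>)
  then show ?thesis
    using convex_Ob_scaled[OF assms(2) bump_range] convex_Ob_scaled[OF assms(3) bump_range]
    by (auto simp: pivot_def)
qed

lemma link_in_segment: "t \<in> {0..1} \<Longrightarrow> link m a b t \<in> closed_segment a (cell_map m b)"
  by (auto simp: link_def closed_segment_def)

text \<open>
  The pivot lies in the obstacle, so a zero of the spoke would lie in some copy of the obstacle; as nothing is in between, this
  is one of the two end copies, and there the pivot is the end point.
\<close>
lemma spoke_nonzero:
  assumes m: "free m" "a \<in> Ob" "b \<in> Ob" and t: "0 < t" "t < 1"
  shows "spoke m a b t \<noteq> 0"
proof
  assume s0: "spoke m a b t = 0"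
  define x where "x = link m a b t"
  have xe: "fold_plane x = pivot m a b x" using s0 by (simp add: spoke_def x_def)
  then have "fold_plane x \<in> Ob" using pivot_in_Ob[OF m] by simp
  then obtain k where k: "x \<in> copy Ob k" using fold_in_Ob_iff by blast
  have "x \<in> closed_segment a (cell_map m b)" using link_in_segment t by (simp add: x_def)
  then have "k = (0,0) \<or> k = m" using free_segment[OF m] k by blast
  then show False
  proof
    assume "k = (0,0)"
    then have xO: "x \<in> Ob" using k by simp
    then have "bump (norm x) = 1" using Ob_norm[of x] by (intro bump_near) simp
    then have "pivot m a b x = a" using bump_disjoint[of m x] m(1) by (auto simp: pivot_def free_def)
    then have "x = a" using xe xO by simp
    then have "t *\<^sub>R (cell_map m b - a) = 0" by (simp add: x_def link_def algebra_simps)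
    then show False using step_nonzero[OF m] t by auto
  next
    assume "k = m"
    then have xO: "x \<in> copy Ob m" using k by simp
    then have "bump (norm (x - centre m)) = 1" using copy_centre[of x m] by (intro bump_near) simp
    then have "pivot m a b x = b" using bump_disjoint[of m x] m(1) by (auto simp: pivot_def free_def)
    moreover obtain y where y: "y \<in> Ob" "x = cell_map m y" using xO by (auto simp: copy_def)
    ultimately have "x = cell_map m b" using xe by simp
    then have "(1 - t) *\<^sub>R (a - cell_map m b) = 0" by (simp add: x_def link_def algebra_simps)
    then show False using step_nonzero[OF m] t by auto
  qed
qed

lemma step_length_le:
  assumes "a \<in> Ob" "b \<in> Ob" shows "norm (cell_map m b - a) \<le> norm (centre m) + 18/25"
proof -
  have "cell_map m b - a = centre m + (lin m b - a)" by (simp only: cell_map_eq add_diff_eq)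
  then have "norm (cell_map m b - a) = norm (centre m + (lin m b - a))" by (rule arg_cong)
  then have "norm (cell_map m b - a) \<le> norm (centre m) + (norm (lin m b) + norm a)"
    using norm_triangle_ineq[of "centre m" "lin m b - a"] norm_triangle_ineq4[of "lin m b" a] by linarith
  then show ?thesis using Ob_norm[OF assms(1)] Ob_norm[OF assms(2)] by simp
qed

text \<open>
  Close to the end point the spoke keeps the direction of the link; the rotation of the link may
  therefore be read off between the two margins.
\<close>
lemma spoke_start:
  assumes m: "free m" "a \<in> Ob" "b \<in> Ob" and t: "0 \<le> t" "t \<le> margin m"
  shows "link m a b t \<in> square" "spoke m a b t = t *\<^sub>R (cell_map m b - a)"
proof -
  define x where "x = link m a b t"
  have xa: "x = a + t *\<^sub>R (cell_map m b - a)" by (simp add: x_def link_def algebra_simps)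
  have "norm (t *\<^sub>R (cell_map m b - a)) \<le> margin m * (norm (centre m) + 18/25)"
    using t margin_bounds[of m] step_length_le[OF m(2,3), of m] by (auto intro!: mult_mono)
  also have "\<dots> \<le> 1 / (25 * (norm (centre m) + 1)) * (norm (centre m) + 1)"
    unfolding margin_def by (intro mult_left_mono) auto
  also have "\<dots> = 1/25" using norm_ge_zero[of "centre m"] by (simp add: field_simps add_nonneg_eq_0_iff)
  finally have "norm x \<le> 2/5"
    unfolding xa using norm_triangle_ineq[of a "t *\<^sub>R (cell_map m b - a)"] Ob_norm[OF m(2)] by linarith
  then have b1: "bump (norm x) = 1" and sq: "x \<in> square"
    using bump_near in_square_norm[of x] by auto
  then show "link m a b t \<in> square" by (simp add: x_def)
  have "pivot m a b x = a" using bump_disjoint[of m x] b1 m(1) by (auto simp: pivot_def free_def)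
  then have "spoke m a b t = x - a" using fold_square[OF sq] by (simp add: spoke_def x_def)
  then show "spoke m a b t = t *\<^sub>R (cell_map m b - a)" by (simp add: xa)
qed

lemma link_cell_inv: "cell_map (cell_inv m) (link m a b t) = link (cell_inv m) b a (1 - t)"
  unfolding link_def cell_map_convex_comb by (simp add: algebra_simps)

lemma fold_cell_inv: "fold_plane (link m a b t) = fold_plane (link (cell_inv m) b a (1 - t))"
  by (metis link_cell_inv fold_cell_map)

lemma spoke_reverse: "spoke (cell_inv m) b a (1 - t) = spoke m a b t"
proof -
  define x where "x = link m a b t"
  have x': "link (cell_inv m) b a (1 - t) = cell_map (cell_inv m) x" by (simp add: x_def link_cell_inv)
  have "norm (cell_map (cell_inv m) x) = norm (x - centre m)" by (simp add: cell_map_inv_eq)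
  moreover have "cell_map (cell_inv m) x - centre (cell_inv m) = lin (cell_inv m) x"
    by (simp add: cell_map_eq)
  ultimately show ?thesis unfolding spoke_def x' x_def[symmetric] by (simp add: pivot_def)
qed

lemma spoke_end:
  assumes m: "free m" "a \<in> Ob" "b \<in> Ob" and t: "1 - margin m \<le> t" "t \<le> 1"
  shows "spoke m a b t = (1 - t) *\<^sub>R (cell_map (cell_inv m) a - b)"
  using spoke_start(2)[OF free_cell_inv[OF m(1)] m(3) m(2), of "1 - t"] t by (simp add: spoke_reverse)

text \<open>
  The rotation of the spoke between the two margins, that is, from the direction of departure to the
  reversed direction of arrival, both in folded coordinates.
\<close>
definition link_swing :: "int \<times> int \<Rightarrow> complex \<Rightarrow> complex \<Rightarrow> real" where
  "link_swing m a b = (SOME d. has_swing (spoke m a b) (margin m) (1 - margin m) d)"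

lemma continuous_spoke: "continuous_on S (\<lambda>(u,t). spoke m (A u) (B u) t)" if
  "continuous_on UNIV A" "continuous_on UNIV B" for S :: "(real \<times> real) set"
proof -
  have "continuous_on S (\<lambda>x::real\<times>real. A (fst x))" "continuous_on S (\<lambda>x::real\<times>real. B (fst x))"
    by (rule continuous_on_compose2[OF that(1)] continuous_on_compose2[OF that(2)]; auto intro!: continuous_intros)+
  then show ?thesis
    unfolding spoke_def link_def pivot_def bump_def split_def by (intro continuous_intros)
qed

lemma continuous_spoke1: "continuous_on S (spoke m a b)"
  unfolding spoke_def link_def pivot_def bump_def by (intro continuous_intros)

lemma has_swing_link:
  assumes "free m" "a \<in> Ob" "b \<in> Ob"
  shows "has_swing (spoke m a b) (margin m) (1 - margin m) (link_swing m a b)"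
  unfolding link_swing_def
proof (rule someI_ex, rule has_swing_exists)
  show "spoke m a b t \<noteq> 0" if "t \<in> {margin m..1 - margin m}" for t
    using spoke_nonzero[OF assms, of t] margin_bounds[of m] that by auto
qed (rule continuous_spoke1)

lemma link_swing_eqI:
  assumes "free m" "a \<in> Ob" "b \<in> Ob" "has_swing (spoke m a b) (margin m) (1 - margin m) d"
  shows "link_swing m a b = d"
  by (rule has_swing_unique[OF has_swing_link[OF assms(1-3)] assms(4)])
     (use spoke_nonzero[OF assms(1-3)] margin_bounds[of m] in auto)

text \<open>
  The directions from the vertex \<open>b\<close> back to its predecessor \<open>a\<close> and on to its successor \<open>c\<close>, both unfolded
  into the cell of \<open>b\<close>.
\<close>
definition corner :: "int \<times> int \<Rightarrow> int \<times> int \<Rightarrow> complex \<Rightarrow> complex \<Rightarrow> complex \<Rightarrow> real" where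
  "corner m m' a b c = turn (cell_map (cell_inv m) a - b) (cell_map m' c - b)"

definition glide :: "complex \<Rightarrow> complex \<Rightarrow> real \<Rightarrow> complex" where
  "glide a a' u = (1 - u) *\<^sub>R a + u *\<^sub>R a'"

lemma glide_Ob: "a \<in> Ob \<Longrightarrow> a' \<in> Ob \<Longrightarrow> u \<in> {0..1} \<Longrightarrow> glide a a' u \<in> Ob"
  using convexD_alt[OF convex_Ob, of a a' u] by (auto simp: glide_def)

lemma continuous_glide [continuous_intros]: "continuous_on S (glide a a')"
  unfolding glide_def by (intro continuous_intros)

lemma glide_diff: "cell_map m (glide b b' u) - glide a a' u = glide (cell_map m b - a) (cell_map m b' - a') u"
  unfolding glide_def cell_map_convex_comb by (simp add: algebra_simps)

lemma glide_segment:
  assumes "free m" "a \<in> Ob" "a' \<in> Ob" "b \<in> Ob" "b' \<in> Ob"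
  shows "0 \<notin> closed_segment (cell_map m b - a) (cell_map m b' - a')"
proof
  assume "0 \<in> closed_segment (cell_map m b - a) (cell_map m b' - a')"
  then obtain u where u: "0 \<le> u" "u \<le> 1" "0 = glide (cell_map m b - a) (cell_map m b' - a') u"
    unfolding closed_segment_def glide_def by blast
  then have "glide a a' u = cell_map m (glide b b' u)" by (simp add: glide_diff[symmetric])
  then show False using step_nonzero[OF assms(1) glide_Ob glide_Ob, of a a' u b b' u] u assms by auto
qed

lemma has_swing_glide:
  assumes "free m" "a \<in> Ob" "a' \<in> Ob" "b \<in> Ob" "b' \<in> Ob"
  shows "has_swing (\<lambda>u. cell_map m (glide b b' u) - glide a a' u) 0 1
           (turn (cell_map m b - a) (cell_map m b' - a'))"
  unfolding glide_diff unfolding glide_def by (rule has_swing_linear[OF glide_segment[OF assms]])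

lemma has_swing_scaleI:
  assumes "has_swing f a b d" "c > 0" shows "has_swing (\<lambda>t. c *\<^sub>R f t) a b d"
  by (rule has_swing_scale[of "1/c"]) (use assms in simp_all)

text \<open>
  Move both end points linearly and apply the homotopy lemma. At the margins the spoke is a positive
  multiple of the direction, which moves along a segment avoiding 0.
\<close>
lemma link_swing_change:
  assumes m: "free m" and ab: "a \<in> Ob" "a' \<in> Ob" "b \<in> Ob" "b' \<in> Ob"
  shows "link_swing m a' b' - link_swing m a b =
     turn (cell_map (cell_inv m) a - b) (cell_map (cell_inv m) a' - b')
     - turn (cell_map m b - a) (cell_map m b' - a')"
proof -
  note mb = margin_bounds[of m]
  have gO: "glide a a' u \<in> Ob" "glide b b' u \<in> Ob" if "u \<in> {0..1}" for u using that ab glide_Ob by auto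
  define f where "f u t = spoke m (glide a a' u) (glide b b' u) t" for u t
  show ?thesis
  proof (rule has_swing_homotopy[of "margin m" "1 - margin m" f])
    show "continuous_on ({0..1} \<times> {margin m..1 - margin m}) (\<lambda>(u, t). f u t)"
      unfolding f_def by (rule continuous_spoke) (intro continuous_intros)+
    show "f u t \<noteq> 0" if "u \<in> {0..1}" "t \<in> {margin m..1 - margin m}" for u t
      unfolding f_def using spoke_nonzero[OF m gO[OF that(1)]] that mb by auto
    show "has_swing (f 0) (margin m) (1 - margin m) (link_swing m a b)"
         "has_swing (f 1) (margin m) (1 - margin m) (link_swing m a' b')"
      unfolding f_def using has_swing_link m ab by (simp_all add: glide_def)
    have s: "f u (margin m) = margin m *\<^sub>R (cell_map m (glide b b' u) - glide a a' u)" if "u \<in> {0..1}" for u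
      unfolding f_def using spoke_start(2)[OF m gO[OF that], of "margin m"] mb by auto
    have e: "f u (1 - margin m) = margin m *\<^sub>R (cell_map (cell_inv m) (glide a a' u) - glide b b' u)" if "u \<in> {0..1}" for u
      unfolding f_def using spoke_end[OF m gO[OF that], of "1 - margin m"] mb by auto
    show "has_swing (\<lambda>u. f u (margin m)) 0 1 (turn (cell_map m b - a) (cell_map m b' - a'))"
      by (rule has_swing_cong[OF has_swing_scaleI[OF has_swing_glide[OF m ab] mb(1)]]) (simp add: s)
    show "has_swing (\<lambda>u. f u (1 - margin m)) 0 1 (turn (cell_map (cell_inv m) a - b) (cell_map (cell_inv m) a' - b'))"
      by (rule has_swing_cong[OF has_swing_scaleI[OF has_swing_glide[OF free_cell_inv[OF m] ab(3,4,1,2)] mb(1)]]) (simp add: e)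
  qed (use mb in auto)
qed

lemma corner_change:
  assumes m: "free m" "free m'" "turnable m m'"
    and abc: "a \<in> Ob" "a' \<in> Ob" "b \<in> Ob" "b' \<in> Ob" "c \<in> Ob" "c' \<in> Ob"
  shows "corner m m' a' b' c' - corner m m' a b c =
     turn (cell_map m' c - b) (cell_map m' c' - b')
     - turn (cell_map (cell_inv m) a - b) (cell_map (cell_inv m) a' - b')"
proof -
  define f where "f u = cell_map (cell_inv m) (glide a a' u) - glide b b' u" for u
  define g where "g u = cell_map m' (glide c c' u) - glide b b' u" for u
  have f: "has_swing f 0 1 (turn (cell_map (cell_inv m) a - b) (cell_map (cell_inv m) a' - b'))"
    unfolding f_def by (rule has_swing_glide[OF free_cell_inv]) (use m abc in auto)
  have g: "has_swing g 0 1 (turn (cell_map m' c - b) (cell_map m' c' - b'))"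
    unfolding g_def by (rule has_swing_glide) (use m abc in auto)
  have nz: "0 \<notin> closed_segment (f u) (g u)" if "u \<in> {0..1}" for u
    unfolding f_def g_def by (intro turnable_segment m glide_Ob abc that)
  have "has_swing g 0 1 (turn (cell_map (cell_inv m) a - b) (cell_map (cell_inv m) a' - b')
          + turn (f 1) (g 1) - turn (f 0) (g 0))"
    by (rule has_swing_turn[OF f _ _ _ nz]) (auto simp: f_def g_def intro!: continuous_intros)
  from has_swing_unique[OF g this] segment_avoids_0D(2)[OF nz]
  show ?thesis by (simp add: corner_def f_def g_def glide_def)
qed

definition path_swing :: "(nat \<Rightarrow> int \<times> int) \<Rightarrow> (nat \<Rightarrow> complex) \<Rightarrow> nat \<Rightarrow> real" where
  "path_swing m b s = (\<Sum>i<s. link_swing (m i) (b i) (b (Suc i))) +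
     (\<Sum>i<s - 1. corner (m i) (m (Suc i)) (b i) (b (Suc i)) (b (Suc (Suc i))))"

text \<open>
  The changes of direction of departure and arrival contribute to the links and to the corners with opposite
  signs, so only the first and the last one survive.
\<close>
lemma path_swing_change:
  assumes m: "\<And>i. i < s \<Longrightarrow> free (m i)" "\<And>i. Suc i < s \<Longrightarrow> turnable (m i) (m (Suc i))"
    and b: "\<And>i. i \<le> s \<Longrightarrow> b i \<in> Ob" "\<And>i. i \<le> s \<Longrightarrow> c i \<in> Ob"
  shows "\<bar>path_swing m c s - path_swing m b s\<bar> \<le> 2 * pi"
proof (cases s)
  case 0 then show ?thesis by (simp add: path_swing_def)
next
  case (Suc n)
  define P where "P i = turn (cell_map (m i) (b (Suc i)) - b i) (cell_map (m i) (c (Suc i)) - c i)" for i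
  define Q where "Q i = turn (cell_map (cell_inv (m i)) (b i) - b (Suc i)) (cell_map (cell_inv (m i)) (c i) - c (Suc i))" for i
  have "path_swing m c s - path_swing m b s = Q n - P 0"
    using m b unfolding Suc
  proof (induction n)
    case 0
    then show ?case using link_swing_change[of "m 0" "b 0" "c 0" "b 1" "c 1"] by (simp add: path_swing_def P_def Q_def)
  next
    case (Suc n)
    have "path_swing m x (Suc (Suc n)) = path_swing m x (Suc n) + link_swing (m (Suc n)) (x (Suc n)) (x (Suc (Suc n)))
        + corner (m n) (m (Suc n)) (x n) (x (Suc n)) (x (Suc (Suc n)))" for x
      by (simp add: path_swing_def)
    moreover have "path_swing m c (Suc n) - path_swing m b (Suc n) = Q n - P 0"
      by (rule Suc.IH) (use Suc.prems in auto)
    moreover have "link_swing (m (Suc n)) (c (Suc n)) (c (Suc (Suc n))) - link_swing (m (Suc n)) (b (Suc n)) (b (Suc (Suc n)))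
        = Q (Suc n) - P (Suc n)"
      unfolding P_def Q_def by (rule link_swing_change) (use Suc.prems in auto)
    moreover have "corner (m n) (m (Suc n)) (c n) (c (Suc n)) (c (Suc (Suc n)))
        - corner (m n) (m (Suc n)) (b n) (b (Suc n)) (b (Suc (Suc n))) = P (Suc n) - Q n"
      unfolding P_def Q_def by (rule corner_change) (use Suc.prems in auto)
    ultimately show ?case by simp
  qed
  moreover have "\<bar>Q n\<bar> \<le> pi" "\<bar>P 0\<bar> \<le> pi" unfolding P_def Q_def by (rule abs_turn_le)+
  ultimately show ?thesis by linarith
qed

end

section \<open>Rotation and length of a trajectory\<close>

lemma arrives_unique:
  assumes "arrives h t v" "arrives h t w" shows "v = w"
proof -
  have "\<forall>\<^sub>F s in at_left t. h s = h t + (s - t) *\<^sub>R v \<and> h s = h t + (s - t) *\<^sub>R w \<and> s < t"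
    using assms unfolding arrives_def
    by (intro eventually_conj) (auto simp: eventually_at_left_field intro: exI[of _ "t - 1"])
  then obtain s where "h s = h t + (s - t) *\<^sub>R v" "h s = h t + (s - t) *\<^sub>R w" "s < t"
    using eventually_happens trivial_limit_at_left_real by blast
  then show ?thesis by simp
qed

lemma departs_unique:
  assumes "departs h t v" "departs h t w" shows "v = w"
proof -
  have "\<forall>\<^sub>F s in at_right t. h s = h t + (s - t) *\<^sub>R v \<and> h s = h t + (s - t) *\<^sub>R w \<and> t < s"
    using assms unfolding departs_def
    by (intro eventually_conj) (auto simp: eventually_at_right_field intro: exI[of _ "t + 1"])
  then obtain s where "h s = h t + (s - t) *\<^sub>R v" "h s = h t + (s - t) *\<^sub>R w" "t < s"
    using eventually_happens trivial_limit_at_right_real by blast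
  then show ?thesis by simp
qed

text \<open>
  Let \<open>c\<close> be the supremum of the times up to which the motion is straight. The velocity arriving at \<open>c\<close> is the
  initial one, so if \<open>c\<close> came before \<open>q\<close>, the motion would go on straight beyond \<open>c\<close>.
\<close>
lemma straight_between:
  assumes pq: "p < q" and w: "departs h p w" and vq: "arrives h q vq"
    and mid: "\<And>t. t \<in> {p<..<q} \<Longrightarrow> \<exists>v. arrives h t v \<and> departs h t v"
  shows "\<And>t. t \<in> {p..q} \<Longrightarrow> h t = h p + (t - p) *\<^sub>R w" "arrives h q w"
proof -
  define L where "L t \<longleftrightarrow> h t = h p + (t - p) *\<^sub>R w" for t
  define S where "S = {t \<in> {p..q}. \<forall>s\<in>{p..t}. L s}"
  define c where "c = Sup S"
  have S_down: "L s" if "s \<in> {p..t}" "t \<in> S" for s t using that by (auto simp: S_def)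
  have pS: "p \<in> S" using pq by (auto simp: S_def L_def)
  have bS: "bdd_above S" by (auto simp: S_def intro!: bdd_aboveI[of _ q])
  have cpq: "p \<le> c" "c \<le> q" unfolding c_def
    using pS bS by (auto intro!: cSup_upper cSup_least simp: S_def)
  have below: "L s" if s: "p \<le> s" "s < c" for s
  proof -
    obtain t where "t \<in> S" "s < t" using s(2) less_cSup_iff[of S] pS bS by (auto simp: c_def)
    then show ?thesis using S_down[of s t] s by auto
  qed
  have extend: "\<exists>e>0. c + e \<in> S" if upto: "\<And>s. s \<in> {p..c} \<Longrightarrow> L s" and dep: "departs h c w" and cq: "c < q"
  proof -
    obtain b where b: "c < b" "\<And>s. c < s \<Longrightarrow> s < b \<Longrightarrow> h s = h c + (s - c) *\<^sub>R w"
      using dep unfolding departs_def eventually_at_right_field by blast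
    have Lc: "L c" using upto cpq by auto
    have "L s" if "c < s" "s < b" for s
      using b(2)[OF that] Lc unfolding L_def by (simp add: algebra_simps)
    then have "L s" if "s \<in> {p..min ((c + b) / 2) q}" for s
      using that b(1) upto[of s] by (cases "s \<le> c") auto
    then have "min ((c + b) / 2) q \<in> S"
      using b(1) cpq by (auto simp: S_def)
    then show ?thesis using b(1) cq by (intro exI[of _ "min ((c + b) / 2) q - c"]) auto
  qed
  have no_extend: "\<not> (\<exists>e>0. c + e \<in> S)"
  proof
    assume "\<exists>e>0. c + e \<in> S"
    then obtain e where "0 < e" "c + e \<in> S" by blast
    then show False using cSup_upper[OF _ bS, of "c + e"] by (simp add: c_def)
  qed
  have "c \<noteq> p"
  proof
    assume "c = p"
    have "\<exists>e>0. c + e \<in> S" by (rule extend) (use \<open>c = p\<close> w pq in \<open>auto simp: L_def\<close>)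
    then show False using no_extend by simp
  qed
  then have pc: "p < c" using cpq by simp
  obtain v where v: "arrives h c v" "c < q \<Longrightarrow> departs h c v"
    using mid[of c] vq pc cpq by (cases "c = q") auto
  obtain b where b: "b < c" "\<And>s. b < s \<Longrightarrow> s < c \<Longrightarrow> h s = h c + (s - c) *\<^sub>R v"
    using v(1) unfolding arrives_def eventually_at_left_field by blast
  define a where "a = max b p"
  have a: "a < c" "b \<le> a" "p \<le> a" using b(1) pc by (auto simp: a_def)
  define s1 where "s1 = (a + c) / 2"
  define s2 where "s2 = (s1 + c) / 2"
  have s: "a < s1" "s1 < s2" "s2 < c" using a by (auto simp: s1_def s2_def)
  have e1: "h s1 = h c + (s1 - c) *\<^sub>R v" "h s1 = h p + (s1 - p) *\<^sub>R w"
    using b(2)[of s1] below[of s1] s a by (auto simp: L_def)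
  have e2: "h s2 = h c + (s2 - c) *\<^sub>R v" "h s2 = h p + (s2 - p) *\<^sub>R w"
    using b(2)[of s2] below[of s2] s a by (auto simp: L_def)
  have "(s2 - s1) *\<^sub>R v = h s2 - h s1" unfolding e1(1) e2(1) by (simp add: algebra_simps)
  also have "\<dots> = (s2 - s1) *\<^sub>R w" unfolding e1(2) e2(2) by (simp add: algebra_simps)
  finally have vw: "v = w" using s by simp
  have "h c = h s1 - (s1 - c) *\<^sub>R w" using e1(1) vw by simp
  then have Lc: "L c" using e1(2) unfolding L_def by (simp add: algebra_simps)
  have upto: "L s" if "s \<in> {p..c}" for s
    using below[of s] Lc that by (cases "s = c") auto
  have "c = q"
  proof (rule ccontr)
    assume "c \<noteq> q"
    then have "c < q" using cpq by simp
    then show False using extend[OF upto] v(2) vw no_extend by blast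
  qed
  then show "arrives h q w" using v(1) vw by simp
  show "h t = h p + (t - p) *\<^sub>R w" if "t \<in> {p..q}" for t
    using upto[of t] that \<open>c = q\<close> unfolding L_def by blast
qed

lemma turn_scale_left: "0 < c \<Longrightarrow> turn (c *\<^sub>R p) q = turn p q"
proof -
  assume c: "0 < c"
  have "q / (c *\<^sub>R p) = of_real (1 / c) * (q / p)" by (simp add: scaleR_conv_of_real field_simps)
  moreover have "Arg (of_real (1 / c) * (q / p)) = Arg (q / p)"
    by (rule Arg_times_of_real) (use c in simp)
  ultimately show ?thesis by (simp only: turn_def)
qed

lemma affine_swing_le:
  assumes "a \<le> b" "\<And>t. t \<in> {a..b} \<Longrightarrow> f t = p + t *\<^sub>R q" "\<And>t. t \<in> {a..b} \<Longrightarrow> f t \<noteq> 0"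
    and "has_swing f a b d"
  shows "\<bar>d\<bar> \<le> pi"
proof -
  have "has_swing f a b (turn (f a) (f b))"
  proof (rule has_swing_from_start[OF assms(1)])
    show "continuous_on {a..b} f"
      by (rule continuous_on_eq[of _ "\<lambda>t. p + t *\<^sub>R q"]) (auto intro!: continuous_intros simp: assms(2))
    fix t assume t: "t \<in> {a..b}"
    show "0 \<notin> closed_segment (f a) (f t)"
    proof
      assume "0 \<in> closed_segment (f a) (f t)"
      then obtain u where u: "0 \<le> u" "u \<le> 1" "0 = (1 - u) *\<^sub>R f a + u *\<^sub>R f t"
        unfolding closed_segment_def by blast
      define r where "r = a + u * (t - a)"
      have "0 \<le> u * (t - a)" using u t by (intro mult_nonneg_nonneg) auto
      moreover have "u * (t - a) \<le> 1 * (t - a)" using u t by (intro mult_right_mono) auto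
      ultimately have r: "r \<in> {a..b}" using t unfolding r_def by auto
      have "a \<in> {a..b}" using assms(1) by auto
      moreover have "p + r *\<^sub>R q = (1 - u) *\<^sub>R (p + a *\<^sub>R q) + u *\<^sub>R (p + t *\<^sub>R q)"
        unfolding r_def by (simp add: algebra_simps)
      ultimately have "f r = (1 - u) *\<^sub>R f a + u *\<^sub>R f t"
        using assms(2) r t by simp
      then show False using u(3) assms(3)[OF r] by simp
    qed
  qed
  from has_swing_unique[OF assms(4) this assms(1,3)] show ?thesis using abs_turn_le by simp
qed

text \<open>
  A piece in \<open>S\<close> with its unfolding, decomposed at the reflections. The signs in \<open>normal\<close> say that the unfolding arrives
  from outside the obstacle and leaves to the outside.
\<close>
locale trajectory = small_obstacle +
  fixes T :: real and g h :: "real \<Rightarrow> complex" and k :: "nat \<Rightarrow> int \<times> int"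
    and \<tau> :: "nat \<Rightarrow> real" and v :: "nat \<Rightarrow> complex" and s :: nat
  assumes s_pos: "0 < s" and \<tau>_0: "\<tau> 0 = 0" and \<tau>_s: "\<tau> s = T"
    and \<tau>_less: "\<And>i. i < s \<Longrightarrow> \<tau> i < \<tau> (Suc i)"
    and unit: "\<And>i. i < s \<Longrightarrow> norm (v i) = 1"
    and straight: "\<And>i t. i < s \<Longrightarrow> t \<in> {\<tau> i..\<tau> (Suc i)} \<Longrightarrow> h t = h (\<tau> i) + (t - \<tau> i) *\<^sub>R v i"
    and vertex: "\<And>i. i \<le> s \<Longrightarrow> h (\<tau> i) \<in> copy Ob (k i)"
    and folded: "\<And>t. t \<in> {0..T} \<Longrightarrow> g t = fold_plane (h t)"
    and outside: "\<And>t. t \<in> {0..T} \<Longrightarrow> g t \<notin> interior Ob"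
    and normal: "\<And>i. Suc i < s \<Longrightarrow> \<exists>n. outward_normal (copy Ob (k (Suc i))) (h (\<tau> (Suc i))) n \<and>
        n \<bullet> v i < 0 \<and> n \<bullet> v (Suc i) > 0 \<and> v (Suc i) = mirror n (v i)"
    and free_step: "\<And>i. i < s \<Longrightarrow> free (act (cell_inv (k i)) (k (Suc i)))"
begin

text \<open>
  The steps, the folded vertices and the lengths of the links.
\<close>
definition m where "m i = act (cell_inv (k i)) (k (Suc i))"
definition b where "b i = cell_map (cell_inv (k i)) (h (\<tau> i))"
definition l where "l i = \<tau> (Suc i) - \<tau> i"

lemma l_pos: "i < s \<Longrightarrow> 0 < l i" using \<tau>_less by (simp add: l_def)

lemma b_Ob: "i \<le> s \<Longrightarrow> b i \<in> Ob"
  using vertex by (simp add: b_def in_copy_iff)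

lemma h_b: "h (\<tau> i) = cell_map (k i) (b i)" by (simp add: b_def)

lemma h_m: "h (\<tau> (Suc i)) = cell_map (k i) (cell_map (m i) (b (Suc i)))"
  by (simp add: b_def m_def cell_map_act)

lemma h_diff: "i < s \<Longrightarrow> h (\<tau> (Suc i)) - h (\<tau> i) = l i *\<^sub>R v i"
  using straight[of i "\<tau> (Suc i)"] \<tau>_less[of i] by (simp add: l_def)

lemma inner_time:
  assumes "i < s" "u \<in> {0..1}" shows "\<tau> i + u * l i \<in> {\<tau> i..\<tau> (Suc i)}"
proof -
  have "0 \<le> u * l i" using assms l_pos[of i] by (intro mult_nonneg_nonneg) auto
  moreover have "u * l i \<le> 1 * l i" using assms l_pos[of i] by (intro mult_right_mono) auto
  moreover have "\<tau> (Suc i) = \<tau> i + l i" by (simp add: l_def)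
  ultimately show ?thesis by auto
qed

lemma cell_map_h:
  assumes "i < s" "u \<in> {0..1}"
  shows "cell_map (cell_inv (k i)) (h (\<tau> i + u * l i)) = link (m i) (b i) (b (Suc i)) u"
proof -
  from straight[OF assms(1) inner_time[OF assms]] have "h (\<tau> i + u * l i) = h (\<tau> i) + u *\<^sub>R (h (\<tau> (Suc i)) - h (\<tau> i))"
    by (simp add: h_diff assms)
  also have "\<dots> = (1 - u) *\<^sub>R h (\<tau> i) + u *\<^sub>R h (\<tau> (Suc i))" by (simp add: algebra_simps)
  finally show ?thesis by (simp add: cell_map_convex_comb link_def h_b[of i] h_m[of i])
qed

lemma \<tau>_range: assumes "i \<le> s" shows "\<tau> i \<in> {0..T}"
proof -
  have "\<tau> i \<le> \<tau> j" if "i \<le> j" "j \<le> s" for i j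
    using that by (induction j) (auto simp: le_Suc_eq intro: order_trans[OF _ less_imp_le[OF \<tau>_less]])
  from this[of 0 i] this[of i s] show ?thesis using assms \<tau>_0 \<tau>_s by auto
qed

lemma T_pos: "0 < T"
  using \<tau>_less[of 0] \<tau>_range[of 1] s_pos \<tau>_0 by simp

lemma piece_range: "i < s \<Longrightarrow> t \<in> {\<tau> i..\<tau> (Suc i)} \<Longrightarrow> t \<in> {0..T}"
  using \<tau>_range[of i] \<tau>_range[of "Suc i"] by auto

lemma g_link:
  assumes "i < s" "u \<in> {0..1}"
  shows "g (\<tau> i + u * l i) = fold_plane (link (m i) (b i) (b (Suc i)) u)"
proof -
  have "g (\<tau> i + u * l i) = fold_plane (h (\<tau> i + u * l i))" using folded[OF piece_range[OF assms(1) inner_time[OF assms]]] .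
  then show ?thesis using arg_cong[OF cell_map_h[OF assms], of fold_plane] by simp
qed

lemma free_m: "i < s \<Longrightarrow> free (m i)"
  using free_step by (simp add: m_def)

lemma departure_direction: assumes "i < s" shows "cell_map (m i) (b (Suc i)) - b i = l i *\<^sub>R lin (k i) (v i)"
proof -
  have "lin (k i) (cell_map (m i) (b (Suc i)) - b i) = l i *\<^sub>R v i"
    using h_diff[OF assms] unfolding h_b[of i] h_m cell_map_diff .
  then show ?thesis by (metis lin_lin lin_scaleR)
qed

lemma arrival_direction: assumes "i < s"
  shows "cell_map (cell_inv (m i)) (b i) - b (Suc i) = - (l i *\<^sub>R lin (k (Suc i)) (v i))"
proof -
  have "cell_map (k (Suc i)) (cell_map (cell_inv (m i)) (b i)) = cell_map (k i) (b i)"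
  proof -
    have "k (Suc i) = act (k i) (m i)" by (simp add: m_def)
    then show ?thesis by (simp add: cell_map_act)
  qed
  then have "lin (k (Suc i)) (cell_map (cell_inv (m i)) (b i) - b (Suc i)) = - (l i *\<^sub>R v i)"
    using h_diff[OF assms] unfolding cell_map_diff[symmetric] h_b by (simp add: algebra_simps)
  then have "cell_map (cell_inv (m i)) (b i) - b (Suc i) = lin (k (Suc i)) (- (l i *\<^sub>R v i))"
    by (metis lin_lin)
  also have "\<dots> = - (l i *\<^sub>R lin (k (Suc i)) (v i))"
    using lin_scaleR[of "k (Suc i)" "- l i" "v i"] by simp
  finally show ?thesis .
qed

lemma g_after:
  assumes "i < s" "u \<in> {0..margin (m i)}"
  shows "g (\<tau> i + u * l i) = b i + (u * l i) *\<^sub>R lin (k i) (v i)"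
proof -
  have u: "0 \<le> u" "u \<le> margin (m i)" "u \<in> {0..1}" using assms margin_bounds[of "m i"] by auto
  have "link (m i) (b i) (b (Suc i)) u \<in> square"
    using spoke_start(1)[OF free_m b_Ob b_Ob u(1,2)] assms by auto
  then have "g (\<tau> i + u * l i) = link (m i) (b i) (b (Suc i)) u"
    using g_link[OF assms(1) u(3)] fold_square by simp
  also have "\<dots> = b i + u *\<^sub>R (cell_map (m i) (b (Suc i)) - b i)" by (simp add: link_def algebra_simps)
  finally show ?thesis by (simp add: departure_direction assms)
qed

lemma g_before:
  assumes "i < s" "u \<in> {0..margin (m i)}"
  shows "g (\<tau> (Suc i) - u * l i) = b (Suc i) - (u * l i) *\<^sub>R lin (k (Suc i)) (v i)"
proof -
  have u: "0 \<le> u" "u \<le> margin (m i)" "1 - u \<in> {0..1}" using assms margin_bounds[of "m i"] by auto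
  have sq: "link (cell_inv (m i)) (b (Suc i)) (b i) u \<in> square"
    using spoke_start(1)[OF free_cell_inv[OF free_m[OF assms(1)]] b_Ob b_Ob, of "Suc i" i u] u assms by auto
  have e: "\<tau> (Suc i) - u * l i = \<tau> i + (1 - u) * l i" by (simp add: l_def algebra_simps)
  have "g (\<tau> (Suc i) - u * l i) = link (cell_inv (m i)) (b (Suc i)) (b i) u"
    unfolding e g_link[OF assms(1) u(3)] fold_cell_inv[of "m i"] using sq fold_square by simp
  also have "\<dots> = b (Suc i) + u *\<^sub>R (cell_map (cell_inv (m i)) (b i) - b (Suc i))"
    by (simp add: link_def algebra_simps)
  finally show ?thesis by (simp add: arrival_direction assms)
qed

lemma g_not_z: "t \<in> {0..T} \<Longrightarrow> g t - z \<noteq> 0"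
  using outside z_interior by auto

text \<open>
  If the segment met 0, the point \<open>g t\<close> would be a convex combination of \<open>C\<close> and the interior point \<open>z\<close>, hence an
  interior point of the obstacle.
\<close>
lemma g_segment:
  assumes t: "t \<in> {0..T}" and C: "C \<in> Ob" "g t \<noteq> C"
  shows "0 \<notin> closed_segment (g t - C) (g t - z)"
proof
  assume "0 \<in> closed_segment (g t - C) (g t - z)"
  then obtain u where u: "0 \<le> u" "u \<le> 1" "0 = (1 - u) *\<^sub>R (g t - C) + u *\<^sub>R (g t - z)"
    unfolding closed_segment_def by blast
  then have e: "g t = C - u *\<^sub>R (C - z)" by (simp add: algebra_simps)
  then have "u \<noteq> 0" using C by auto
  then have "g t \<in> interior Ob"
    unfolding e using u by (intro mem_interior_convex_shrink convex_Ob z_interior C) auto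
  then show False using outside t by blast
qed

theorem length_eq: "T = (\<Sum>i<s. norm (h (\<tau> (Suc i)) - h (\<tau> i)))"
proof -
  have "(\<Sum>i<s. norm (h (\<tau> (Suc i)) - h (\<tau> i))) = (\<Sum>i<s. \<tau> (Suc i) - \<tau> i)"
    by (intro sum.cong refl) (use h_diff unit l_pos in \<open>force simp: l_def\<close>)
  also have "\<dots> = T" by (simp add: sum_lessThan_telescope \<tau>_0 \<tau>_s)
  finally show ?thesis ..
qed

text \<open>
  Comparing each distance with its projection to the direction \<open>v i\<close> reduces the claim to
  the sum of \<open>v i \<bullet> (e (i + 1) - e i)\<close>, where \<open>e i\<close> is the displacement of the vertex \<open>i\<close>. After summation by parts the
  inner terms are \<open>(v (i - 1) - v i) \<bullet> e i \<ge> 0\<close>, since \<open>v (i - 1) - v i\<close> is a negative multiple of the outward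
  normal. The two end terms are at most 1.
\<close>
theorem length_le:
  assumes y: "\<And>i. i \<le> s \<Longrightarrow> y i \<in> copy Ob (k i)"
  shows "T \<le> (\<Sum>i<s. norm (y (Suc i) - y i)) + 2"
proof -
  define e where "e i = y i - h (\<tau> i)" for i
  have near: "norm (e i) \<le> 1" if "i \<le> s" for i
  proof -
    have "norm (y i - centre (k i)) \<le> 9/25" "norm (h (\<tau> i) - centre (k i)) \<le> 9/25"
      using copy_centre y vertex that by auto
    then show ?thesis unfolding e_def
      using norm_triangle_ineq4[of "y i - centre (k i)" "h (\<tau> i) - centre (k i)"] by simp
  qed
  have mono: "v (Suc i) \<bullet> e (Suc i) \<le> v i \<bullet> e (Suc i)" if i: "Suc i < s" for i
  proof -
    obtain n where n: "outward_normal (copy Ob (k (Suc i))) (h (\<tau> (Suc i))) n" "n \<bullet> v i < 0"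
      "v (Suc i) = mirror n (v i)" using normal[OF i] by blast
    have "n \<bullet> e (Suc i) \<le> 0" using n(1) y[of "Suc i"] i by (auto simp: outward_normal_def e_def)
    then have "(n \<bullet> v i) * (n \<bullet> e (Suc i)) \<ge> 0" using n(2) by (simp add: mult_nonpos_nonpos)
    then show ?thesis unfolding n(3) mirror_def
      unfolding inner_diff_left inner_scaleR_left by (simp add: inner_commute[of "v i" n])
  qed
  have inner_e: "\<bar>v i \<bullet> e j\<bar> \<le> 1" if "i < s" "j \<le> s" for i j
    using order_trans[OF Cauchy_Schwarz_ineq2[of "v i" "e j"]] near[OF that(2)] unit[OF that(1)] by simp
  have tele: "(\<Sum>i<Suc j. v i \<bullet> (e (Suc i) - e i)) \<ge> v j \<bullet> e (Suc j) - 1" if "Suc j \<le> s" for j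
    using that
  proof (induction j)
    case 0
    then show ?case using inner_e[of 0 0] by (simp add: inner_diff_right)
  next
    case (Suc j)
    then show ?case using mono[of j] by (simp add: inner_diff_right)
  qed
  obtain j where j: "s = Suc j" using s_pos gr0_implies_Suc by blast
  have t2: "(\<Sum>i<s. v i \<bullet> (e (Suc i) - e i)) \<ge> - 2"
    using tele[of j] inner_e[of j s] j by simp
  have "norm (y (Suc i) - y i) \<ge> l i + v i \<bullet> (e (Suc i) - e i)" if "i < s" for i
  proof -
    have "y (Suc i) - y i = l i *\<^sub>R v i + (e (Suc i) - e i)"
      using h_diff[OF that] by (simp add: e_def algebra_simps)
    then have "v i \<bullet> (y (Suc i) - y i) = l i + v i \<bullet> (e (Suc i) - e i)"
      using unit[OF that] by (simp add: inner_add_right dot_square_norm)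
    then show ?thesis using Cauchy_Schwarz_ineq2[of "v i" "y (Suc i) - y i"] unit[OF that] by simp
  qed
  then have "(\<Sum>i<s. norm (y (Suc i) - y i)) \<ge> (\<Sum>i<s. l i + v i \<bullet> (e (Suc i) - e i))"
    by (intro sum_mono) auto
  moreover have "(\<Sum>i<s. l i) = T" unfolding l_def by (simp add: sum_lessThan_telescope \<tau>_0 \<tau>_s)
  ultimately show ?thesis using t2 by (simp add: sum.distrib)
qed

lemma Lipschitz: assumes "p \<in> {0..T}" "q \<in> {0..T}" shows "norm (g p - g q) \<le> \<bar>p - q\<bar>"
proof -
  have step: "norm (h t - h (\<tau> i)) \<le> t - \<tau> i" if "i < s" "t \<in> {\<tau> i..\<tau> (Suc i)}" for i t
    using straight[OF that] unit[OF that(1)] that by simp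
  have *: "norm (h q - h p) \<le> q - p" if "j \<le> s" "0 \<le> p" "p \<le> q" "q \<le> \<tau> j" for p q j
    using that
  proof (induction j arbitrary: p q)
    case 0
    then have "p = q" using \<tau>_0 by simp
    then show ?case by simp
  next
    case (Suc j)
    have js: "j < s" using Suc.prems by simp
    consider "q \<le> \<tau> j" | "\<tau> j \<le> p" | "p < \<tau> j" "\<tau> j < q" by linarith
    then show ?case
    proof cases
      case 1 then show ?thesis using Suc by simp
    next
      case 2
      then have pq: "p \<in> {\<tau> j..\<tau> (Suc j)}" "q \<in> {\<tau> j..\<tau> (Suc j)}" using Suc.prems by auto
      have "h q - h p = (h (\<tau> j) + (q - \<tau> j) *\<^sub>R v j) - (h (\<tau> j) + (p - \<tau> j) *\<^sub>R v j)"
        by (rule arg_cong2[OF straight[OF js pq(2)] straight[OF js pq(1)]])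
      then have "h q - h p = (q - p) *\<^sub>R v j" by (simp add: scaleR_diff_left)
      then show ?thesis using unit[OF js] Suc.prems by simp
    next
      case 3
      have "norm (h (\<tau> j) - h p) \<le> \<tau> j - p" using Suc.IH[of p "\<tau> j"] Suc.prems 3 by auto
      moreover have "norm (h q - h (\<tau> j)) \<le> q - \<tau> j" using step[OF js, of q] 3 Suc.prems by auto
      ultimately show ?thesis using norm_triangle_ineq[of "h q - h (\<tau> j)" "h (\<tau> j) - h p"] by simp
    qed
  qed
  have "norm (h p - h q) \<le> \<bar>p - q\<bar>"
    using *[of s p q] *[of s q p] assms \<tau>_s by (auto simp: norm_minus_commute abs_if)
  then show ?thesis using fold_Lipschitz[of "h p" "h q"] folded assms by force
qed

text \<open>
  Correct the actual argument \<open>\<theta>\<close> of \<open>g - z\<close> at the margins by the principal angle to the spoke. On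
  links the two vectors are never opposite by \<open>g_segment\<close>, and at a corner all vectors involved lie in the
  half plane of the outward normal. So the corrected argument changes by \<open>link_swing\<close> along links and
  by \<open>corner\<close> at corners; its first and last value are off by at most one turn each.
\<close>
theorem displacement_path_swing:
  assumes \<phi>: "continuous_on {0..T} \<theta>" "\<And>t. t \<in> {0..T} \<Longrightarrow> is_Arg (g t - z) (\<theta> t)"
  shows "\<bar>path_swing m b s - (\<theta> T - \<theta> 0)\<bar> \<le> 4 * pi"
proof -
  define \<delta> where "\<delta> i = margin (m i)" for i
  \<comment> \<open>The times of the margins: the link \<open>i\<close> is entered at \<open>Q i\<close> and left at \<open>P i\<close>.\<close>
  define P where "P i = \<tau> (Suc i) - \<delta> i * l i" for i
  define Q where "Q i = \<tau> i + \<delta> i * l i" for i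
  define p where "p i = cell_map (cell_inv (m i)) (b i) - b (Suc i)" for i
  define q where "q i = cell_map (m i) (b (Suc i)) - b i" for i
  \<comment> \<open>The corrections from the spoke to \<open>g - z\<close> at these times.\<close>
  define eP where "eP i = turn (p i) (g (P i) - z)" for i
  define eQ where "eQ i = turn (q i) (g (Q i) - z)" for i
  have \<delta>: "0 < \<delta> i" "\<delta> i < 1/2" for i using margin_bounds unfolding \<delta>_def by auto
  have dl: "0 < \<delta> i * l i" "\<delta> i * l i < l i" if "i < s" for i
    using \<delta>[of i] l_pos[OF that] by auto
  have PQ: "\<tau> i < Q i" "Q i < \<tau> (Suc i)" "\<tau> i < P i" "P i < \<tau> (Suc i)" if "i < s" for i
    using dl[OF that] by (auto simp: P_def Q_def l_def)
  have PQr: "P i \<in> {0..T}" "Q i \<in> {0..T}" if "i < s" for i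
    using PQ[OF that] piece_range[OF that] by auto
  have cg: "continuous_on {0..T} g"
    by (rule lipschitz_on_continuous_on[of 1], rule lipschitz_onI) (use Lipschitz in \<open>auto simp: dist_norm\<close>)
  have sw: "has_swing (\<lambda>t. g t - z) x y (\<theta> y - \<theta> x)" if "{x..y} \<subseteq> {0..T}" for x y
    by (rule has_swing_sub[OF \<phi>(1) that]) (use \<phi>(2) in auto)
  have link_swing: "link_swing (m i) (b i) (b (Suc i)) = (\<theta> (P i) - eP i) - (\<theta> (Q i) - eQ i)" if i: "i < s" for i
  proof -
    define F where "F = spoke (m i) (b i) (b (Suc i))"
    define G where "G u = g (\<tau> i + u * l i) - z" for u
    have mO: "free (m i)" "b i \<in> Ob" "b (Suc i) \<in> Ob" using i free_m b_Ob by auto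
    have r: "\<tau> i + u * l i \<in> {0..T}" if "u \<in> {\<delta> i..1 - \<delta> i}" for u
    proof -
      have "u \<in> {0..1}" using that \<delta>[of i] by auto
      then show ?thesis using piece_range[OF i] inner_time[OF i] by blast
    qed
    have nz: "0 \<notin> closed_segment (F u) (G u)" if u: "u \<in> {\<delta> i..1 - \<delta> i}" for u
    proof -
      have u': "u \<in> {0..1}" "0 < u" "u < 1" using u \<delta>[of i] by auto
      define C where "C = pivot (m i) (b i) (b (Suc i)) (link (m i) (b i) (b (Suc i)) u)"
      have "F u = g (\<tau> i + u * l i) - C" unfolding F_def spoke_def C_def g_link[OF i u'(1)] ..
      moreover have "F u \<noteq> 0" unfolding F_def by (rule spoke_nonzero[OF mO u'(2,3)])
      moreover have "C \<in> Ob" unfolding C_def by (rule pivot_in_Ob[OF mO])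
      ultimately show ?thesis unfolding G_def using g_segment[OF r[OF u], of C] by auto
    qed
    have cG: "continuous_on {\<delta> i..1 - \<delta> i} G" unfolding G_def
      by (intro continuous_intros continuous_on_compose2[OF cg]) (use r in auto)
    have "has_swing G (\<delta> i) (1 - \<delta> i) (link_swing (m i) (b i) (b (Suc i)) + turn (F (1 - \<delta> i)) (G (1 - \<delta> i)) - turn (F (\<delta> i)) (G (\<delta> i)))"
      by (rule has_swing_turn[OF has_swing_link[OF mO, folded \<delta>_def F_def] _ _ cG nz])
         (use \<delta>[of i] in \<open>auto simp: F_def intro: continuous_spoke1\<close>)
    moreover have "has_swing G (\<delta> i) (1 - \<delta> i) (\<theta> (\<tau> i + (1 - \<delta> i) * l i) - \<theta> (\<tau> i + \<delta> i * l i))"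
    proof (rule has_swing_sub[of "{\<delta> i..1 - \<delta> i}"])
      show "continuous_on {\<delta> i..1 - \<delta> i} (\<lambda>u. \<theta> (\<tau> i + u * l i))"
        by (rule continuous_on_compose2[OF \<phi>(1)]) (use r in \<open>auto intro!: continuous_intros\<close>)
    qed (use r \<phi>(2) in \<open>auto simp: G_def\<close>)
    ultimately have "link_swing (m i) (b i) (b (Suc i)) + turn (F (1 - \<delta> i)) (G (1 - \<delta> i)) - turn (F (\<delta> i)) (G (\<delta> i))
        = \<theta> (\<tau> i + (1 - \<delta> i) * l i) - \<theta> (\<tau> i + \<delta> i * l i)"
      by (rule has_swing_unique) (use \<delta>[of i] segment_avoids_0D(2)[OF nz] in auto)
    moreover have "\<tau> i + (1 - \<delta> i) * l i = P i" "\<tau> i + \<delta> i * l i = Q i"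
      by (simp_all add: P_def Q_def l_def algebra_simps)
    moreover have "F (1 - \<delta> i) = \<delta> i *\<^sub>R p i" "F (\<delta> i) = \<delta> i *\<^sub>R q i"
      using spoke_end[OF mO, of "1 - \<delta> i"] spoke_start(2)[OF mO, of "\<delta> i"] \<delta>[of i]
      by (auto simp: F_def p_def q_def \<delta>_def)
    ultimately show ?thesis
      by (simp add: eP_def eQ_def G_def turn_scale_left \<delta>)
  qed
  have corner: "corner (m i) (m (Suc i)) (b i) (b (Suc i)) (b (Suc (Suc i))) = (\<theta> (Q (Suc i)) - eQ (Suc i)) - (\<theta> (P i) - eP i)"
    if i: "Suc i < s" for i
  proof -
    have is': "i < s" using i by simp
    obtain n where n: "outward_normal (copy Ob (k (Suc i))) (h (\<tau> (Suc i))) n" "n \<bullet> v i < 0" "n \<bullet> v (Suc i) > 0"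
      using normal[OF i] by blast
    define N where "N = lin (k (Suc i)) n"
    have "outward_normal Ob (b (Suc i)) N"
      using n(1) outward_normal_cell_map[of "k (Suc i)" "b (Suc i)" N] by (simp add: N_def h_b)
    from outward_normal_interior[OF this z_interior]
    have Nz: "0 < N \<bullet> (b (Suc i) - z)" by (simp add: inner_diff_right)
    have Nv: "N \<bullet> lin (k (Suc i)) (v i) < 0" "N \<bullet> lin (k (Suc i)) (v (Suc i)) > 0"
      using n by (simp_all add: N_def inner_lin)
    have Np: "N \<bullet> p i > 0" using Nv l_pos[OF is'] by (simp add: p_def arrival_direction is' mult_pos_neg)
    have Nq: "N \<bullet> q (Suc i) > 0" using Nv l_pos[OF i] by (simp add: q_def departure_direction i)
    have Ng: "N \<bullet> (g t - z) > 0" if t: "t \<in> {P i..Q (Suc i)}" for t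
    proof (cases "t \<le> \<tau> (Suc i)")
      case True
      define u where "u = (\<tau> (Suc i) - t) / l i"
      have tu: "t = \<tau> (Suc i) - u * l i" using l_pos[OF is'] by (simp add: u_def)
      have "u \<in> {0..margin (m i)}"
        using t True l_pos[OF is'] by (auto simp: u_def P_def \<delta>_def pos_divide_le_eq)
      then have "g t = b (Suc i) - (u * l i) *\<^sub>R lin (k (Suc i)) (v i)" "0 \<le> u * l i"
        using g_before[OF is', of u] l_pos[OF is'] tu by auto
      moreover have "(u * l i) * (N \<bullet> lin (k (Suc i)) (v i)) \<le> 0"
        using calculation(2) Nv(1) by (intro mult_nonneg_nonpos) auto
      ultimately show ?thesis using Nz by (simp add: inner_diff_right)
    next
      case False
      define u where "u = (t - \<tau> (Suc i)) / l (Suc i)"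
      have tu: "t = \<tau> (Suc i) + u * l (Suc i)" using l_pos[OF i] by (simp add: u_def)
      have "u \<in> {0..margin (m (Suc i))}"
        using t False l_pos[OF i] by (auto simp: u_def Q_def \<delta>_def pos_divide_le_eq)
      then have "g t = b (Suc i) + (u * l (Suc i)) *\<^sub>R lin (k (Suc i)) (v (Suc i))" "0 \<le> u * l (Suc i)"
        using g_after[OF i, of u] l_pos[OF i] tu by auto
      moreover have "(u * l (Suc i)) * (N \<bullet> lin (k (Suc i)) (v (Suc i))) \<ge> 0"
        by (rule mult_nonneg_nonneg[OF calculation(2) less_imp_le[OF Nv(2)]])
      ultimately show ?thesis using Nz by (simp add: inner_diff_right inner_add_right)
    qed
    have PQi: "P i \<le> Q (Suc i)" using PQ[OF is'] PQ[OF i] by simp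
    have sub: "{P i..Q (Suc i)} \<subseteq> {0..T}" using PQr[OF is'] PQr[OF i] by auto
    have "has_swing (\<lambda>t. g t - z) (P i) (Q (Suc i)) (turn (g (P i) - z) (g (Q (Suc i)) - z))"
      by (rule has_swing_half_plane[OF PQi _ Ng]) (use continuous_on_subset[OF cg sub] in \<open>auto intro!: continuous_intros\<close>)
    from has_swing_unique[OF sw[OF sub] this PQi] g_not_z sub
    have e1: "\<theta> (Q (Suc i)) - \<theta> (P i) = turn (g (P i) - z) (g (Q (Suc i)) - z)" by blast
    have "turn (p i) (g (P i) - z) + turn (g (P i) - z) (g (Q (Suc i)) - z) = turn (p i) (g (Q (Suc i)) - z)"
         "turn (p i) (q (Suc i)) + turn (q (Suc i)) (g (Q (Suc i)) - z) = turn (p i) (g (Q (Suc i)) - z)"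
      by (rule turn_half_plane[of N]; use Np Nq Ng PQi in auto)+
    then show ?thesis using e1 by (simp add: corner_def p_def q_def eP_def eQ_def)
  qed
  have "path_swing m b (Suc j) = (\<theta> (P j) - eP j) - (\<theta> (Q 0) - eQ 0)" if "Suc j \<le> s" for j
    using that
  proof (induction j)
    case 0 then show ?case using link_swing[of 0] by (simp add: path_swing_def)
  next
    case (Suc j)
    have "path_swing m b (Suc (Suc j)) = path_swing m b (Suc j) + link_swing (m (Suc j)) (b (Suc j)) (b (Suc (Suc j)))
        + corner (m j) (m (Suc j)) (b j) (b (Suc j)) (b (Suc (Suc j)))"
      by (simp add: path_swing_def)
    then show ?case using Suc link_swing[of "Suc j"] corner[of j] by simp
  qed
  from this[of "s - 1"] have path_swing: "path_swing m b s = (\<theta> (P (s - 1)) - eP (s - 1)) - (\<theta> (Q 0) - eQ 0)" using s_pos by simp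
  have first: "\<bar>\<theta> (Q 0) - \<theta> 0\<bar> \<le> pi"
  proof (rule affine_swing_le)
    have sub: "{0..Q 0} \<subseteq> {0..T}" using PQr[of 0] s_pos by auto
    show "has_swing (\<lambda>t. g t - z) 0 (Q 0) (\<theta> (Q 0) - \<theta> 0)" by (rule sw[OF sub])
    show "0 \<le> Q 0" using PQr[of 0] s_pos by auto
    show "g t - z \<noteq> 0" if "t \<in> {0..Q 0}" for t using that sub g_not_z by blast
    show "g t - z = (b 0 - z) + t *\<^sub>R lin (k 0) (v 0)" if t: "t \<in> {0..Q 0}" for t
    proof -
      have "t / l 0 \<in> {0..margin (m 0)}"
        using t l_pos[OF s_pos] \<tau>_0 by (auto simp: Q_def \<delta>_def pos_divide_le_eq)
      from g_after[OF s_pos this] show ?thesis using l_pos[OF s_pos] \<tau>_0 by simp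
    qed
  qed
  define j where "j = s - 1"
  have j: "j < s" "Suc j = s" using s_pos by (auto simp: j_def)
  have last: "\<bar>\<theta> T - \<theta> (P j)\<bar> \<le> pi"
  proof (rule affine_swing_le)
    have sub: "{P j..T} \<subseteq> {0..T}" using PQr[of j] j by auto
    show "has_swing (\<lambda>t. g t - z) (P j) T (\<theta> T - \<theta> (P j))" by (rule sw[OF sub])
    show "P j \<le> T" using PQr[of j] j by auto
    show "g t - z \<noteq> 0" if "t \<in> {P j..T}" for t using that sub g_not_z by blast
    show "g t - z = (b s - T *\<^sub>R lin (k s) (v j) - z) + t *\<^sub>R lin (k s) (v j)" if t: "t \<in> {P j..T}" for t
    proof -
      have "(T - t) / l j \<in> {0..margin (m j)}"
        using t l_pos[OF j(1)] \<tau>_s j by (auto simp: P_def \<delta>_def pos_divide_le_eq)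
      moreover have "\<tau> (Suc j) - (T - t) / l j * l j = t" using l_pos[OF j(1)] \<tau>_s j by simp
      ultimately have "g t = b s - (T - t) *\<^sub>R lin (k s) (v j)"
        using g_before[OF j(1), of "(T - t) / l j"] l_pos[OF j(1)] j by simp
      then show ?thesis by (simp add: algebra_simps)
    qed
  qed
  have "\<bar>eP j\<bar> \<le> pi" "\<bar>eQ 0\<bar> \<le> pi" unfolding eP_def eQ_def by (rule abs_turn_le)+
  then show ?thesis using path_swing first last unfolding j_def by linarith
qed

end

section \<open>Folding and unfolding trajectories\<close>

text \<open>
  The cell (in one coordinate) entered from \<open>y\<close> when moving with velocity \<open>c\<close>; for \<open>c = 0\<close> on a boundary either cell would do.
\<close>
definition facing :: "real \<Rightarrow> real \<Rightarrow> int" where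
  "facing y c = (if c < 0 then \<lceil>y - 1/2\<rceil> else \<lfloor>y + 1/2\<rfloor>)"

lemma facing_near: "\<exists>d>0. \<forall>e\<in>{0..d}. \<bar>y + e * c - of_int (facing y c)\<bar> \<le> 1/2"
proof (cases "c < 0")
  case True
  define p where "p = facing y c"
  have p: "of_int p - 1/2 < y" "y \<le> of_int p + 1/2"
    using True unfolding p_def facing_def by (auto simp: ceiling_less_iff) linarith+
  define d where "d = (y - (of_int p - 1/2)) / (- c)"
  have "d > 0" unfolding d_def using True p by (intro divide_pos_pos) auto
  moreover have "\<bar>y + e * c - of_int p\<bar> \<le> 1/2" if "e \<in> {0..d}" for e
  proof -
    have "e * (- c) \<le> d * (- c)" using that True by (intro mult_right_mono) auto
    then have "y + e * c \<ge> of_int p - 1/2" using True by (simp add: d_def)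
    moreover have "e * c \<le> 0" using that True by (simp add: mult_nonneg_nonpos)
    ultimately show ?thesis using p by linarith
  qed
  ultimately show ?thesis unfolding p_def by blast
next
  case False
  define p where "p = facing y c"
  have p: "of_int p - 1/2 \<le> y" "y < of_int p + 1/2"
    using False unfolding p_def facing_def by (auto simp: le_floor_iff floor_less_iff) linarith+
  define d where "d = (of_int p + 1/2 - y) / (c + 1)"
  have "d > 0" using False p by (simp add: d_def)
  moreover have "\<bar>y + e * c - of_int p\<bar> \<le> 1/2" if "e \<in> {0..d}" for e
  proof -
    have "e * c \<le> e * (c + 1)" using that by (intro mult_left_mono) auto
    also have "\<dots> \<le> d * (c + 1)" using that False by (intro mult_right_mono) auto
    also have "\<dots> = of_int p + 1/2 - y" using False by (simp add: d_def)
    finally have "y + e * c \<le> of_int p + 1/2" by simp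
    moreover have "e * c \<ge> 0" using that False by simp
    ultimately show ?thesis using p by linarith
  qed
  ultimately show ?thesis unfolding p_def by blast
qed

lemma facing_0: "\<bar>y - of_int (facing y c)\<bar> \<le> 1/2"
proof -
  obtain d where "d > 0" "\<forall>e\<in>{0..d}. \<bar>y + e * c - of_int (facing y c)\<bar> \<le> 1/2" using facing_near by blast
  then show ?thesis by (auto dest: bspec[of _ _ 0])
qed

lemma facing_interior:
  assumes "\<bar>y - of_int p\<bar> < 1/2" shows "facing y c = p"
proof -
  have "\<bar>of_int (facing y c) - of_int p :: real\<bar> < 1" using assms facing_0[of y c] by linarith
  then have "\<bar>of_int (facing y c - p) :: real\<bar> < 1" by simp
  then show ?thesis by linarith
qed

text \<open>
  On a line \<open>y = n + 1/2\<close> the cells on the two sides have opposite parity, which is the reflection law at the sides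
  of \<open>S\<close>.
\<close>
lemma facing_flip:
  "sg (facing y c) * c = (if \<bar>tri y\<bar> = 1/2 then - 1 else 1) * (sg (facing y (- c)) * c)"
proof (cases "\<bar>tri y\<bar> = 1/2")
  case False
  have "tri y = sg (facing y c) * (y - of_int (facing y c))" by (rule tri_eq[OF facing_0])
  then have "\<bar>y - of_int (facing y c)\<bar> \<noteq> 1/2" using False by (auto simp: sg_def abs_minus_commute split: if_splits)
  then have "facing y (- c) = facing y c" using facing_0[of y c] by (intro facing_interior) simp
  then show ?thesis using False by simp
next
  case True
  have half: "\<bar>y - of_int (facing y c')\<bar> = 1/2" for c'
    using True tri_eq[OF facing_0, of y c'] by (auto simp: sg_def abs_minus_commute split: if_splits)
  have "\<bar>facing y c - facing y (- c)\<bar> = 1" if "c \<noteq> 0"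
  proof -
    have u: "facing y \<bar>c\<bar> = \<lfloor>y + 1/2\<rfloor>" and d: "facing y (- \<bar>c\<bar>) = \<lceil>y - 1/2\<rceil>"
      using that by (auto simp: facing_def)
    have "of_int (facing y \<bar>c\<bar>) = y + 1/2" using half[of "\<bar>c\<bar>"] unfolding u by linarith
    moreover have "of_int (facing y (- \<bar>c\<bar>)) = y - 1/2" using half[of "- \<bar>c\<bar>"] unfolding d by linarith
    ultimately have "of_int (facing y \<bar>c\<bar>) - of_int (facing y (- \<bar>c\<bar>)) = (1::real)" by linarith
    then have "facing y \<bar>c\<bar> - facing y (- \<bar>c\<bar>) = 1" by linarith
    then show ?thesis by (auto simp: abs_if split: if_splits)
  qed
  moreover have "even (facing y c) \<longleftrightarrow> odd (facing y (- c))" if "\<bar>facing y c - facing y (- c)\<bar> = 1"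
    using that by presburger
  ultimately have "c = 0 \<or> (even (facing y c) \<longleftrightarrow> odd (facing y (- c)))" by blast
  then show ?thesis using True by (auto simp: sg_def)
qed

definition face :: "complex \<Rightarrow> complex \<Rightarrow> int \<times> int" where
  "face x w = (facing (Re x) (Re w), facing (Im x) (Im w))"

lemma fold_near:
  "\<exists>d>0. \<forall>e\<in>{0..d}. fold_plane (x + e *\<^sub>R w) = fold_plane x + e *\<^sub>R lin (face x w) w"
proof -
  obtain d1 where d1: "d1 > 0" "\<And>e. e \<in> {0..d1} \<Longrightarrow> \<bar>Re x + e * Re w - of_int (facing (Re x) (Re w))\<bar> \<le> 1/2"
    using facing_near by meson
  obtain d2 where d2: "d2 > 0" "\<And>e. e \<in> {0..d2} \<Longrightarrow> \<bar>Im x + e * Im w - of_int (facing (Im x) (Im w))\<bar> \<le> 1/2"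
    using facing_near by meson
  have "fold_plane (x + e *\<^sub>R w) = fold_plane x + e *\<^sub>R lin (face x w) w" if "e \<in> {0..min d1 d2}" for e
    using tri_eq[OF d1(2), of e] tri_eq[OF d2(2), of e] tri_eq[OF facing_0, of "Re x" "Re w"]
      tri_eq[OF facing_0, of "Im x" "Im w"] that
    by (simp add: complex_eq_iff face_def algebra_simps)
  then show ?thesis using d1 d2 by (intro exI[of _ "min d1 d2"]) auto
qed

lemma fold_departs:
  assumes "departs h t w" shows "departs (\<lambda>t. fold_plane (h t)) t (lin (face (h t) w) w)"
proof -
  obtain d where d: "d > 0" "\<And>e. e \<in> {0..d} \<Longrightarrow> fold_plane (h t + e *\<^sub>R w) = fold_plane (h t) + e *\<^sub>R lin (face (h t) w) w"
    using fold_near by meson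
  obtain b where b: "t < b" "\<And>s. t < s \<Longrightarrow> s < b \<Longrightarrow> h s = h t + (s - t) *\<^sub>R w"
    using assms unfolding departs_def eventually_at_right_field by blast
  have "fold_plane (h s) = fold_plane (h t) + (s - t) *\<^sub>R lin (face (h t) w) w"
    if "t < s" "s < min b (t + d)" for s
    using d(2)[of "s - t"] b(2)[of s] that by simp
  then show ?thesis using assms b(1) d(1)
    unfolding departs_def eventually_at_right_field norm_lin by (metis less_add_same_cancel1 min_less_iff_conj)
qed

lemma fold_arrives:
  assumes "arrives h t w" shows "arrives (\<lambda>t. fold_plane (h t)) t (lin (face (h t) (- w)) w)"
proof -
  define \<kappa> where "\<kappa> = face (h t) (- w)"
  obtain d where d: "d > 0" "\<And>e. e \<in> {0..d} \<Longrightarrow> fold_plane (h t + e *\<^sub>R (- w)) = fold_plane (h t) + e *\<^sub>R lin \<kappa> (- w)"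
    unfolding \<kappa>_def using fold_near by meson
  obtain b where b: "b < t" "\<And>s. b < s \<Longrightarrow> s < t \<Longrightarrow> h s = h t + (s - t) *\<^sub>R w"
    using assms unfolding arrives_def eventually_at_left_field by blast
  have "fold_plane (h s) = fold_plane (h t) + (s - t) *\<^sub>R lin \<kappa> w"
    if "max b (t - d) < s" "s < t" for s
  proof -
    have "h s = h t + (t - s) *\<^sub>R (- w)" using b(2)[of s] that by (simp add: algebra_simps)
    then have "fold_plane (h s) = fold_plane (h t) + (t - s) *\<^sub>R lin \<kappa> (- w)" using d(2)[of "t - s"] that by simp
    moreover have "lin \<kappa> (- w) = - lin \<kappa> w" by (simp add: complex_eq_iff)
    ultimately show ?thesis by (simp add: algebra_simps)
  qed
  moreover have "max b (t - d) < t" using b(1) d(1) by simp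
  moreover have "norm w = 1" using assms by (simp add: arrives_def)
  ultimately show ?thesis
    unfolding arrives_def eventually_at_left_field \<kappa>_def[symmetric] norm_lin by blast
qed

context small_obstacle
begin

lemma face_copy:
  assumes "x \<in> copy Ob k" shows "face x w = k"
proof -
  have "norm (x - centre k) < 1/2" using copy_centre[OF assms] by simp
  then have "\<bar>Re x - of_int (fst k)\<bar> < 1/2" "\<bar>Im x - of_int (snd k)\<bar> < 1/2"
    using abs_Re_le_cmod[of "x - centre k"] abs_Im_le_cmod[of "x - centre k"] by auto
  then show ?thesis by (simp add: face_def facing_interior)
qed

lemma frontier_fold: assumes "fold_plane x \<in> frontier Ob" shows "\<exists>k. x \<in> frontier (copy Ob k) \<and> x \<in> copy Ob k"
proof -
  obtain k where "x = cell_map k (fold_plane x)" using ex_cell_map_fold by blast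
  then have "x \<in> frontier (copy Ob k)" using assms by (metis frontier_copy image_eqI)
  then show ?thesis using frontier_copy_subset by blast
qed

lemma fold_frontier: assumes "x \<in> frontier (copy Ob k)" shows "fold_plane x \<in> frontier Ob"
proof -
  obtain y where y: "y \<in> frontier Ob" "x = cell_map k y" using assms by (auto simp: frontier_copy)
  then have "y \<in> Ob" using closed_Ob frontier_subset_closed by blast
  then show ?thesis using y by simp
qed

lemma fold_interior: "fold_plane x \<in> interior Ob \<Longrightarrow> \<exists>k. x \<in> interior (copy Ob k)"
  using ex_cell_map_fold[of x] by (metis interior_copy image_eqI)

lemma plane_law_copy:
  assumes "plane_law Ob x v w" "x \<in> frontier (copy Ob k)"
  shows "\<exists>n. outward_normal (copy Ob k) x n \<and> w = mirror n v"
proof -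
  have "\<exists>k. x \<in> frontier (copy Ob k)" using assms(2) by blast
  with assms(1) have "\<exists>k n. outward_normal (copy Ob k) x n \<and> w = mirror n v"
    unfolding plane_law_def by (simp only: if_True)
  then obtain k' n where n: "outward_normal (copy Ob k') x n" "w = mirror n v" by blast
  then have "x \<in> frontier (copy Ob k')" unfolding outward_normal_def by blast
  then have "k' = k"
    using assms(2) subsetD[OF frontier_copy_subset] copy_unique by blast
  then show ?thesis using n by blast
qed

text \<open>
  At an obstacle both directions face the same cell, whose isometry transports the law. Elsewhere the unfolding is straight and
  each coordinate is reflected exactly when it reaches a side; at a vertex of \<open>S\<close> both are, which is the reversal of the velocity.
\<close>
lemma fold_law:
  assumes "plane_law Ob x v w"
  shows "square_law Ob (fold_plane x) (lin (face x (- v)) v) (lin (face x w) w)"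
proof (cases "fold_plane x \<in> frontier Ob")
  case True
  obtain k where k: "x \<in> frontier (copy Ob k)" "x \<in> copy Ob k" using frontier_fold[OF True] by blast
  then obtain n where n: "outward_normal (copy Ob k) x n" "w = mirror n v"
    using plane_law_copy[OF assms] by blast
  obtain y where y: "y \<in> Ob" "x = cell_map k y" using k by (auto simp: copy_def)
  have "outward_normal Ob y (lin k n)"
    using n(1) outward_normal_cell_map[of k y "lin k n"] y by simp
  moreover have "lin k w = mirror (lin k n) (lin k v)" using n(2) by (simp add: mirror_lin)
  ultimately show ?thesis using True y unfolding face_copy[OF k(2)] square_law_def by auto
next
  case False
  then have "\<not> (\<exists>k. x \<in> frontier (copy Ob k))" using fold_frontier by blast
  then have wv: "w = v" using assms by (simp add: plane_law_def)
  have "mirror 1 y = Complex (- Re y) (Im y)" "mirror \<i> y = Complex (Re y) (- Im y)" for y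
    by (simp_all add: mirror_def complex_eq_iff inner_complex_def)
  then show ?thesis using False facing_flip[of "Re x" "Re v"] facing_flip[of "Im x" "Im v"]
    unfolding square_law_def wv by (simp add: complex_eq_iff face_def) auto
qed

lemma fold_piece:
  assumes "plane_piece Ob T h" shows "square_piece Ob T (\<lambda>t. fold_plane (h t))"
  unfolding square_piece_def billiard_piece_def
proof (intro conjI ballI)
  have p: "0 < T" "h ` {0..T} \<subseteq> - (\<Union>k. interior (copy Ob k))" "\<exists>w. departs h 0 w" "\<exists>v. arrives h T v"
    "\<And>t. t\<in>{0<..<T} \<Longrightarrow> \<exists>v w. arrives h t v \<and> departs h t w \<and> plane_law Ob (h t) v w"
    using assms unfolding plane_piece_def billiard_piece_def by blast+
  show "0 < T" by (rule p)
  show "(\<lambda>t. fold_plane (h t)) ` {0..T} \<subseteq> square - interior Ob"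
    using p(2) fold_in_square fold_interior by fastforce
  show "\<exists>w. departs (\<lambda>t. fold_plane (h t)) 0 w" "\<exists>v. arrives (\<lambda>t. fold_plane (h t)) T v"
    using p(3,4) fold_departs fold_arrives by blast+
  show "\<exists>v w. arrives (\<lambda>t. fold_plane (h t)) t v \<and> departs (\<lambda>t. fold_plane (h t)) t w \<and>
      square_law Ob (fold_plane (h t)) v w" if "t \<in> {0<..<T}" for t
    using p(5)[OF that] fold_departs fold_arrives fold_law by blast
qed

lemma cell_inv_act: "cell_inv (act k m) = act (cell_inv m) (cell_inv k)"
  by (simp add: cell_inv_def act_def sg_def)

lemma free_step_iff:
  "free (act (cell_inv k) k') \<longleftrightarrow> k' \<noteq> k \<and> \<not> (\<exists>j. lies_between Ob j k k')"
proof -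
  have e: "act (cell_inv k) k' = (0,0) \<longleftrightarrow> k' = k" by (metis act_cancel(2) act_inv(2) act_0(1))
  have "lies_between Ob (act k j) k k' \<longleftrightarrow> lies_between Ob j (0,0) (act (cell_inv k) k')" for j
    using lies_between_act[of k j "(0,0)" "act (cell_inv k) k'"] by simp
  then show ?thesis unfolding free_def e by (metis act_cancel(2))
qed

lemma turnable_step_iff:
  "turnable (act (cell_inv i) k) (act (cell_inv k) j) \<longleftrightarrow> \<not> lies_between Ob k i j"
  using lies_between_act[of k "(0,0)" "act (cell_inv k) i" "act (cell_inv k) j"]
  by (simp add: turnable_def cell_inv_act)

lemma admissible_iff:
  "admissible Ob ks \<longleftrightarrow> ks \<noteq> [] \<and> ks ! 0 = (0, 0) \<and>
     (\<forall>i. Suc i < length ks \<longrightarrow> free (act (cell_inv (ks ! i)) (ks ! Suc i))) \<and>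
     (\<forall>i. Suc (Suc i) < length ks \<longrightarrow>
        turnable (act (cell_inv (ks ! i)) (ks ! Suc i)) (act (cell_inv (ks ! Suc i)) (ks ! Suc (Suc i))))"
  unfolding admissible_def free_step_iff turnable_step_iff by auto

text \<open>
  Otherwise the departing ray would enter the interior by \<open>smooth_inward\<close>.
\<close>
lemma departs_outside:
  assumes n: "outward_normal (copy Ob k) x n" and dep: "departs h t w" "h t = x"
    and out: "\<And>s. s \<in> {t..t'} \<Longrightarrow> h s \<notin> interior (copy Ob k)" and "t < t'"
  shows "n \<bullet> w \<ge> 0"
proof (rule ccontr)
  assume neg: "\<not> ?thesis"
  have "x \<in> frontier (copy Ob k)" using n unfolding outward_normal_def by blast
  then have "x \<in> copy Ob k" using frontier_copy_subset by blast
  then obtain y where y: "y \<in> Ob" "x = cell_map k y" by (auto simp: copy_def)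
  have "outward_normal Ob y (lin k n)" using n outward_normal_cell_map[of k y "lin k n"] y by simp
  moreover have "lin k n \<bullet> lin k w < 0" using neg by (simp add: inner_lin)
  ultimately obtain e where e: "e > 0" "y + e *\<^sub>R lin k w \<in> interior Ob" using smooth_inward by blast
  obtain b where b: "t < b" "\<And>s. t < s \<Longrightarrow> s < b \<Longrightarrow> h s = h t + (s - t) *\<^sub>R w"
    using dep unfolding departs_def eventually_at_right_field by blast
  define s where "s = t + min (min e ((b - t)/2)) (t' - t)"
  have "min (min e ((b - t)/2)) (t' - t) \<le> (b - t) / 2" by (rule min.coboundedI1[OF min.cobounded2])
  then have s: "t < s" "s < b" "s \<le> t'" "s - t \<le> e" using b(1) \<open>t < t'\<close> e(1) by (auto simp: s_def)
  define r where "r = (s - t) / e"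
  have r: "0 < r" "r \<le> 1" using s e by (auto simp: r_def)
  have "y - r *\<^sub>R (y - (y + e *\<^sub>R lin k w)) \<in> interior Ob"
    by (rule mem_interior_convex_shrink[OF convex_Ob e(2) y(1) r])
  then have "y + (s - t) *\<^sub>R lin k w \<in> interior Ob" using e by (simp add: r_def)
  then have "cell_map k (y + (s - t) *\<^sub>R lin k w) \<in> interior (copy Ob k)" by (simp add: interior_copy)
  moreover have "cell_map k (y + (s - t) *\<^sub>R lin k w) = h s"
    using b(2)[OF s(1,2)] dep(2) y by (simp add: cell_map_add lin_scaleR)
  ultimately show False using out[of s] s by simp
qed

text \<open>
  Between consecutive reflection times the unfolding does not change its velocity, hence is straight. At a reflection the
  outgoing velocity does not point into the obstacle; by the reflection law the incoming one does, and equality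
  is excluded since the velocity changes.
\<close>
theorem piece_trajectory:
  assumes sq: "square_piece Ob T g" and adm: "admissible Ob ks" and ty: "has_type Ob T g ks"
  shows "\<exists>h \<tau> v. trajectory Ob z T g h (\<lambda>i. ks ! i) \<tau> v (length ks - 1)"
proof -
  define s where "s = length ks - 1"
  obtain h \<tau> where un: "unfolding_of Ob T g h" and \<tau>: "\<tau> 0 = 0" "\<tau> s = T" "strict_mono_on {0..s} \<tau>"
    and fr: "\<And>i. i \<le> s \<Longrightarrow> h (\<tau> i) \<in> frontier (copy Ob (ks ! i))"
    and ref: "{t \<in> {0<..<T}. reflects_at h t} = \<tau> ` {0<..<s}"
    using ty unfolding has_type_def Let_def s_def[symmetric] by blast
  have pl: "0 < T" "h ` {0..T} \<subseteq> - (\<Union>k. interior (copy Ob k))" "\<exists>w. departs h 0 w" "\<exists>v. arrives h T v"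
    "\<And>t. t\<in>{0<..<T} \<Longrightarrow> \<exists>v w. arrives h t v \<and> departs h t w \<and> plane_law Ob (h t) v w"
    using un unfolding unfolding_of_def plane_piece_def billiard_piece_def by blast+
  have s0: "0 < s" using \<tau> pl(1) by (cases s) auto
  have less: "\<tau> i < \<tau> j" if "i < j" "j \<le> s" for i j
    using \<tau>(3) that by (auto simp: strict_mono_on_def)
  have pos: "0 < \<tau> i" if "0 < i" "i \<le> s" for i using less[OF that] \<tau>(1) by simp
  have lt: "\<tau> i < T" if "i < s" for i using less[of i s] \<tau>(2) that by simp
  have range: "\<tau> i \<in> {0..T}" if "i \<le> s" for i
    using less[of 0 i] less[of i s] that \<tau> by (cases "i = 0"; cases "i = s") auto
  have "\<exists>v. departs h (\<tau> i) v" if "i < s" for i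
    using pl(3) pl(5)[of "\<tau> i"] pos[of i] lt[OF that] \<tau>(1) that by (cases "i = 0") auto
  then obtain v where v: "\<And>i. i < s \<Longrightarrow> departs h (\<tau> i) (v i)" by metis
  have arr: "\<exists>w. arrives h (\<tau> (Suc i)) w" if "i < s" for i
    using pl(4) pl(5)[of "\<tau> (Suc i)"] pos[of "Suc i"] lt[of "Suc i"] \<tau>(2) that by (cases "Suc i = s") auto
  have mid: "\<exists>w. arrives h t w \<and> departs h t w" if i: "i < s" and t: "t \<in> {\<tau> i<..<\<tau> (Suc i)}" for i t
  proof -
    have tT: "t \<in> {0<..<T}" using t range[of i] range[of "Suc i"] i by auto
    have "t \<notin> \<tau> ` {0<..<s}"
    proof
      assume "t \<in> \<tau> ` {0<..<s}"
      then obtain j where j: "t = \<tau> j" "j < s" by auto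
      then show False using t less[of j i] less[of "Suc i" j] i by (cases j i rule: linorder_cases; cases "j = Suc i") auto
    qed
    then have "\<not> reflects_at h t" using ref tT by blast
    then show ?thesis using pl(5)[OF tT] unfolding reflects_at_def by blast
  qed
  have st: "h t = h (\<tau> i) + (t - \<tau> i) *\<^sub>R v i" if "i < s" "t \<in> {\<tau> i..\<tau> (Suc i)}" for i t
    using arr[OF that(1)] straight_between(1)[OF less[of i "Suc i"] v[OF that(1)] _ mid[OF that(1)] that(2)] that(1) by auto
  have va: "arrives h (\<tau> (Suc i)) (v i)" if "i < s" for i
    using arr[OF that(1)] straight_between(2)[OF less[of i "Suc i"] v[OF that(1)] _ mid[OF that(1)]] that(1) by auto
  have outside: "h t \<notin> interior (copy Ob k)" if "t \<in> {0..T}" for t k using pl(2) that by blast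
  have normal: "\<exists>n. outward_normal (copy Ob (ks ! Suc i)) (h (\<tau> (Suc i))) n \<and>
        n \<bullet> v i < 0 \<and> n \<bullet> v (Suc i) > 0 \<and> v (Suc i) = mirror n (v i)" if i: "Suc i < s" for i
  proof -
    have tT: "\<tau> (Suc i) \<in> {0<..<T}" using pos[of "Suc i"] lt[OF i] i by simp
    obtain v' w' where "arrives h (\<tau> (Suc i)) v'" "departs h (\<tau> (Suc i)) w'" "plane_law Ob (h (\<tau> (Suc i))) v' w'"
      using pl(5)[OF tT] by blast
    then have law: "plane_law Ob (h (\<tau> (Suc i))) (v i) (v (Suc i))"
      using arrives_unique va departs_unique v i by (metis Suc_lessD)
    have "reflects_at h (\<tau> (Suc i))" using ref i by auto
    then have ne: "v i \<noteq> v (Suc i)" unfolding reflects_at_def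
      using arrives_unique[OF va[of i]] departs_unique[OF v[OF i]] i by (metis Suc_lessD)
    have frx: "h (\<tau> (Suc i)) \<in> frontier (copy Ob (ks ! Suc i))" using fr i by simp
    obtain n where n: "outward_normal (copy Ob (ks ! Suc i)) (h (\<tau> (Suc i))) n" "v (Suc i) = mirror n (v i)"
      using plane_law_copy[OF law frx] by blast
    have nn: "norm n = 1" using n(1) by (simp add: outward_normal_def)
    have flip: "n \<bullet> v (Suc i) = - (n \<bullet> v i)"
      using nn unfolding n(2) mirror_def by (simp add: inner_diff_right dot_square_norm inner_commute)
    have "n \<bullet> v (Suc i) \<ge> 0"
      by (rule departs_outside[OF n(1) v[OF i], of T]) (use tT outside in auto)
    moreover have "n \<bullet> v i \<noteq> 0" using ne n(2) by (auto simp: mirror_def inner_commute)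
    ultimately show ?thesis using n flip by (intro exI[of _ n]) auto
  qed
  have gsq: "g ` {0..T} \<subseteq> square - interior Ob" using sq by (auto simp: square_piece_def billiard_piece_def)
  have fold: "g t = fold_plane (h t)" if t: "t \<in> {0..T}" for t
  proof -
    obtain k where "h t = cell_map k (g t)" using un t unfolding unfolding_of_def by blast
    moreover have "g t \<in> square" using gsq t by blast
    ultimately show ?thesis by (simp add: fold_square)
  qed
  have "trajectory Ob z T g h (\<lambda>i. ks ! i) \<tau> v s"
  proof (unfold_locales)
    show "0 < s" "\<tau> 0 = 0" "\<tau> s = T" using s0 \<tau> by auto
    show "\<tau> i < \<tau> (Suc i)" if "i < s" for i using less that by auto
    show "norm (v i) = 1" if "i < s" for i using v[OF that] by (simp add: departs_def)
    show "h (\<tau> i) \<in> copy Ob (ks ! i)" if "i \<le> s" for i using fr[OF that] frontier_copy_subset by blast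
    show "g t \<notin> interior Ob" if "t \<in> {0..T}" for t using gsq that by blast
    show "free (act (cell_inv (ks ! i)) (ks ! Suc i))" if "i < s" for i
      using adm that unfolding admissible_iff s_def by auto
  qed (use st fold normal in blast)+
  then show ?thesis unfolding s_def by blast
qed

end

section \<open>Shortest paths are trajectories\<close>

lemma norm_line_derivative:
  fixes a d :: complex
  assumes "a \<noteq> 0"
  shows "((\<lambda>e. norm (a + e *\<^sub>R d)) has_real_derivative (sgn a \<bullet> d)) (at 0)"
proof -
  have "((\<lambda>e. a + e *\<^sub>R d) has_derivative (\<lambda>e. e *\<^sub>R d)) (at 0)"
    by (auto intro!: derivative_eq_intros)
  moreover have "(norm has_derivative (\<lambda>h. sgn a \<bullet> h)) (at (a + 0 *\<^sub>R d))"
    using has_derivative_norm[OF assms] by (simp add: inner_commute)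
  ultimately have "(norm \<circ> (\<lambda>e. a + e *\<^sub>R d) has_derivative (\<lambda>h. sgn a \<bullet> h) \<circ> (\<lambda>e. e *\<^sub>R d)) (at 0)"
    by (rule diff_chain_at)
  then show ?thesis unfolding has_field_derivative_def by (simp add: o_def mult_commute_abs)
qed

text \<open>
  The gradient of the length at \<open>x\<close> is \<open>v - w\<close>, so \<open>w - v\<close> is an outward normal. As \<open>v\<close> and \<open>w\<close> are unit vectors,
  reflection in the direction of \<open>w - v\<close> interchanges them.
\<close>
lemma reflection_of_shortest:
  fixes P Q x :: complex
  assumes "convex K" and x: "x \<in> K" "x \<notin> closed_segment P Q"
    and shortest: "\<And>y. y \<in> K \<Longrightarrow> norm (x - P) + norm (Q - x) \<le> norm (y - P) + norm (Q - y)"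
  defines "v \<equiv> sgn (x - P)" and "w \<equiv> sgn (Q - x)"
  shows "\<exists>n. norm n = 1 \<and> (\<forall>y\<in>K. n \<bullet> (y - x) \<le> 0) \<and> w = mirror n v \<and> n \<bullet> v < 0 \<and> n \<bullet> w > 0"
proof -
  have ne: "x - P \<noteq> 0" "Q - x \<noteq> 0" using x(2) by auto
  have vw1: "norm v = 1" "norm w = 1" unfolding v_def w_def using ne by (simp_all add: norm_sgn)
  have key: "(w - v) \<bullet> (y - x) \<le> 0" if "y \<in> K" for y
  proof (rule ccontr)
    assume neg: "\<not> ?thesis"
    define f where "f e = norm ((x - P) + e *\<^sub>R (y - x)) + norm ((Q - x) + e *\<^sub>R (- (y - x)))" for e
    have "(f has_real_derivative (v \<bullet> (y - x) + w \<bullet> (- (y - x)))) (at 0)"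
      unfolding f_def v_def w_def by (intro DERIV_add norm_line_derivative ne)
    moreover have "v \<bullet> (y - x) + w \<bullet> (- (y - x)) < 0"
      using neg by (simp add: inner_diff_left inner_diff_right)
    ultimately obtain d where d: "d > 0" "\<And>e. e > 0 \<Longrightarrow> e < d \<Longrightarrow> f (0 + e) < f 0"
      using DERIV_neg_dec_right by blast
    define e where "e = min (d / 2) 1"
    have e: "0 < e" "e < d" "e \<le> 1" using d(1) by (auto simp: e_def min_less_iff_disj)
    define y' where "y' = (1 - e) *\<^sub>R x + e *\<^sub>R y"
    have "y' \<in> K" unfolding y'_def using e by (intro convexD_alt[OF assms(1)] x that) auto
    moreover have "f e = norm (y' - P) + norm (Q - y')"
      unfolding f_def y'_def by (simp add: algebra_simps)
    moreover have "f 0 = norm (x - P) + norm (Q - x)" by (simp add: f_def)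
    ultimately show False using shortest[of y'] d(2)[OF e(1,2)] by simp
  qed
  \<comment> \<open>Otherwise \<open>x\<close> divides the segment from \<open>P\<close> to \<open>Q\<close> in the ratio \<open>p : q\<close>.\<close>
  have "w \<noteq> v"
  proof
    assume "w = v"
    define p q where "p = norm (x - P)" and "q = norm (Q - x)"
    have pq: "p > 0" "q > 0" using ne by (auto simp: p_def q_def)
    have scal: "norm a *\<^sub>R sgn a = a" for a :: complex by (cases "a = 0") (simp_all add: sgn_div_norm)
    have "x - P = p *\<^sub>R v" "Q - x = q *\<^sub>R v"
      using scal[of "x - P"] scal[of "Q - x"] \<open>w = v\<close> unfolding v_def w_def p_def q_def by simp_all
    then have xe: "P = x - p *\<^sub>R v" "Q = x + q *\<^sub>R v" by (simp_all add: algebra_simps)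
    define u where "u = p / (p + q)"
    have "(1 - u) * p = u * q" using pq by (simp add: u_def field_simps)
    then have "(1 - u) *\<^sub>R P + u *\<^sub>R Q = x" unfolding xe
      by (simp add: algebra_simps flip: scaleR_left_distrib)
    moreover have "0 \<le> u" "u \<le> 1" using pq by (auto simp: u_def)
    ultimately show False using x(2) unfolding closed_segment_def by (metis (mono_tags, lifting) mem_Collect_eq)
  qed
  define c where "c = norm (w - v)"
  have c: "c > 0" using \<open>w \<noteq> v\<close> by (simp add: c_def)
  have v2: "v \<bullet> v = 1" "w \<bullet> w = 1" using vw1 by (simp_all add: dot_square_norm)
  have c2: "c * c = 2 - 2 * (v \<bullet> w)"
    unfolding c_def power2_eq_square[symmetric] power2_norm_eq_inner
    using v2 by (simp add: inner_diff_left inner_diff_right inner_commute)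
  define n where "n = (1 / c) *\<^sub>R (w - v)"
  have nv: "n \<bullet> v = - c / 2" and nw: "n \<bullet> w = c / 2"
  proof -
    have eqs: "c * (- c / 2) = - (c * c) / 2" "c * (c / 2) = (c * c) / 2" by simp_all
    have "c * (n \<bullet> v) = v \<bullet> w - 1" "c * (n \<bullet> w) = 1 - v \<bullet> w"
      using c v2 by (simp_all add: n_def inner_diff_left inner_diff_right inner_commute)
    then have "c * (n \<bullet> v) = c * (- c / 2)" "c * (n \<bullet> w) = c * (c / 2)"       unfolding eqs using c2 by linarith+
    then show "n \<bullet> v = - c / 2" "n \<bullet> w = c / 2" using c by (auto simp only: mult_cancel_left)
  qed
  have "mirror n v = v + c *\<^sub>R n" by (simp add: mirror_def inner_commute[of v n] nv)
  then have "mirror n v = w" using c by (simp add: n_def)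
  moreover have "norm n = 1" using c by (simp add: n_def c_def)
  moreover have "n \<bullet> (y - x) \<le> 0" if "y \<in> K" for y
    using key[OF that] c by (simp add: n_def divide_le_0_iff)
  ultimately show ?thesis using nv nw c by (intro exI[of _ n]) auto
qed

context small_obstacle
begin

lemma shortest_exists:
  "\<exists>x. (\<forall>i. x i \<in> copy Ob (k i)) \<and>
     (\<forall>y. (\<forall>i\<le>s. y i \<in> copy Ob (k i)) \<longrightarrow>
        (\<Sum>i<s. norm (x (Suc i) - x i)) \<le> (\<Sum>i<s. norm (y (Suc i) - y i)))"
proof -
  define B where "B = PiE UNIV (\<lambda>i::nat. copy Ob (k i))"
  define f where "f = (\<lambda>x::nat \<Rightarrow> complex. \<Sum>i<s. norm (x (Suc i) - x i))"
  have "compactin (product_topology (\<lambda>i. euclidean) UNIV) B"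
    unfolding B_def compactin_PiE by (simp add: compact_copy)
  then have "compact B" by (simp add: euclidean_product_topology)
  moreover have mem: "cell_map (k i) z \<in> copy Ob (k i)" for i using z_Ob by simp
  then have "(\<lambda>i. cell_map (k i) z) \<in> B" unfolding B_def by (intro PiE_I) auto
  moreover have "continuous_on B f" unfolding f_def
    by (intro continuous_intros continuous_on_subset[OF continuous_on_product_coordinates]) auto
  ultimately obtain x where x: "x \<in> B" "\<And>y. y \<in> B \<Longrightarrow> f x \<le> f y"
    using continuous_attains_inf[of B f] by blast
  have "f x \<le> f y" if y: "\<forall>i\<le>s. y i \<in> copy Ob (k i)" for y
  proof -
    define y' where "y' i = (if i \<le> s then y i else cell_map (k i) z)" for i
    have "y' \<in> B" using y mem by (auto simp: B_def y'_def)
    moreover have "f y' = f y" unfolding f_def y'_def by (intro sum.cong) auto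
    ultimately show ?thesis using x(2) by metis
  qed
  then show ?thesis using x(1) unfolding B_def f_def by (intro exI[of _ x]) auto
qed

lemma outside_halfplane_interior:
  assumes "x \<in> copy Ob k" "norm n = 1" "\<And>y. y \<in> copy Ob k \<Longrightarrow> n \<bullet> (y - x) \<le> 0"
  shows "outward_normal (copy Ob k) x n"
proof -
  have "x \<notin> interior (copy Ob k)"
  proof
    assume "x \<in> interior (copy Ob k)"
    then obtain r where r: "0 < r" "cball x r \<subseteq> copy Ob k" using mem_interior_cball by blast
    have "x + r *\<^sub>R n \<in> cball x r" using r assms(2) by (simp add: dist_norm)
    then have "n \<bullet> (x + r *\<^sub>R n - x) \<le> 0" using r assms(3) by blast
    then show False using r assms(2) by (simp add: dot_square_norm)
  qed
  then have "x \<in> frontier (copy Ob k)" using assms(1) closure_subset by (auto simp: frontier_def)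
  then show ?thesis using assms by (simp add: outward_normal_def)
qed

text \<open>
  At an inner vertex of a shortest path the two-sided condition is the reflection law; the vertex does not lie on the segment
  between its neighbours because its obstacle is not between theirs. At the two ends the vertex is the point of its obstacle closest to the neighbour. Therefore every link leaves the
  supporting half planes of both its obstacles, and as nothing is in between, it meets no other obstacle.
\<close>
theorem shortest_piece:
  assumes s: "0 < s" and k0: "k 0 = (0,0)"
    and free: "\<And>i. i < s \<Longrightarrow> free (act (cell_inv (k i)) (k (Suc i)))"
    and turnable: "\<And>i. Suc i < s \<Longrightarrow> turnable (act (cell_inv (k i)) (k (Suc i))) (act (cell_inv (k (Suc i))) (k (Suc (Suc i))))"
  shows "\<exists>T g. square_piece Ob T g \<and> has_type Ob T g (map k [0..<Suc s])"
proof -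
  obtain x where xin: "\<And>i. x i \<in> copy Ob (k i)"
    and xmin: "\<And>y. (\<And>i. i \<le> s \<Longrightarrow> y i \<in> copy Ob (k i)) \<Longrightarrow>
        (\<Sum>i<s. norm (x (Suc i) - x i)) \<le> (\<Sum>i<s. norm (y (Suc i) - y i))"
    using shortest_exists[of k s] by metis
  define l where "l i = norm (x (Suc i) - x i)" for i
  define \<tau> where "\<tau> i = (\<Sum>j<i. l j)" for i
  define v where "v i = sgn (x (Suc i) - x i)" for i
  \<comment> \<open>Each link contributes its vector scaled by the clamped time spent on it.\<close>
  define h where "h t = x 0 + (\<Sum>i<s. max 0 (min (t - \<tau> i) (l i)) *\<^sub>R v i)" for t
  define T where "T = \<tau> s"
  have ne: "x (Suc i) \<noteq> x i" if "i < s" for i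
    using free[OF that] xin[of i] xin[of "Suc i"] copy_unique unfolding free_step_iff by metis
  have l: "l i > 0" if "i < s" for i using ne[OF that] by (simp add: l_def)
  have \<tau>S: "\<tau> (Suc i) = \<tau> i + l i" for i by (simp add: \<tau>_def)
  have \<tau>less: "\<tau> i < \<tau> j" if "i < j" "j \<le> s" for i j
    using that
  proof (induction j)
    case (Suc j)
    then show ?case using l[of j] by (cases "i = j") (auto simp: \<tau>S intro: less_trans)
  qed simp
  have \<tau>le: "\<tau> i \<le> \<tau> j" if "i \<le> j" "j \<le> s" for i j
    using \<tau>less[of i j] that by (cases "i = j") auto
  have \<tau>0: "\<tau> 0 = 0" by (simp add: \<tau>_def)
  have lv: "l i *\<^sub>R v i = x (Suc i) - x i" for i
    by (cases "x (Suc i) = x i") (simp_all add: l_def v_def sgn_div_norm)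
  have nv: "norm (v i) = 1" if "i < s" for i using ne[OF that] by (simp add: v_def norm_sgn)
  have hform: "h t = x i + (t - \<tau> i) *\<^sub>R v i" if i: "i < s" and t: "t \<in> {\<tau> i..\<tau> (Suc i)}" for i t
  proof -
    define c where "c j = max 0 (min (t - \<tau> j) (l j)) *\<^sub>R v j" for j
    have "{..<s} = {..<Suc i} \<union> {Suc i..<s}" using i by auto
    then have "(\<Sum>j<s. c j) = (\<Sum>j<Suc i. c j) + (\<Sum>j\<in>{Suc i..<s}. c j)"
      by (simp add: sum.union_disjoint ivl_disj_int)
    also have "(\<Sum>j\<in>{Suc i..<s}. c j) = 0"
    proof (rule sum.neutral, intro ballI)
      fix j assume "j \<in> {Suc i..<s}"
      then have "\<tau> (Suc i) \<le> \<tau> j" using \<tau>le[of "Suc i" j] by auto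
      then have "t - \<tau> j \<le> 0" using t by auto
      then have "min (t - \<tau> j) (l j) \<le> 0" by (rule min.coboundedI1)
      then show "c j = 0" by (simp add: c_def max_absorb1)
    qed
    also have "(\<Sum>j<Suc i. c j) = (\<Sum>j<i. x (Suc j) - x j) + c i"
    proof -
      have "c j = x (Suc j) - x j" if "j < i" for j
      proof -
        have "\<tau> (Suc j) \<le> \<tau> i" using \<tau>le[of "Suc j" i] that i by simp
        then have "min (t - \<tau> j) (l j) = l j" using t \<tau>S[of j] by auto
        then show ?thesis using l[of j] that i lv by (simp add: c_def)
      qed
      then show ?thesis by simp
    qed
    also have "(\<Sum>j<i. x (Suc j) - x j) = x i - x 0" by (simp add: sum_lessThan_telescope)
    also have "c i = (t - \<tau> i) *\<^sub>R v i" using t \<tau>S[of i] by (simp add: c_def)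
    finally show ?thesis by (simp add: h_def c_def)
  qed
  have h\<tau>: "h (\<tau> i) = x i" if "i \<le> s" for i
  proof (cases "i < s")
    case True then show ?thesis using hform[OF True, of "\<tau> i"] \<tau>less[of i "Suc i"] by simp
  next
    case False
    then have "i = s" using that by simp
    then obtain j where j: "i = Suc j" "j < s" using s by (cases i) auto
    then have "h (\<tau> i) = x j + l j *\<^sub>R v j"
      using hform[of j "\<tau> i"] \<tau>less[of j "Suc j"] by (simp add: \<tau>S)
    then show ?thesis using j lv[of j] by simp
  qed
  have dep: "departs h t (v i)" if i: "i < s" and t: "t \<in> {\<tau> i..<\<tau> (Suc i)}" for i t
    unfolding departs_def eventually_at_right_field
  proof (intro conjI exI[of _ "\<tau> (Suc i)"] allI impI)
    fix r assume "t < r" "r < \<tau> (Suc i)"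
    then have e: "h r = x i + (r - \<tau> i) *\<^sub>R v i" "h t = x i + (t - \<tau> i) *\<^sub>R v i"
      using hform[OF i] t by auto
    show "h r = h t + (r - t) *\<^sub>R v i" unfolding e by (simp add: algebra_simps)
  qed (use nv[OF i] t in auto)
  have arr: "arrives h t (v i)" if i: "i < s" and t: "t \<in> {\<tau> i<..\<tau> (Suc i)}" for i t
    unfolding arrives_def eventually_at_left_field
  proof (intro conjI exI[of _ "\<tau> i"] allI impI)
    fix r assume "\<tau> i < r" "r < t"
    then have e: "h r = x i + (r - \<tau> i) *\<^sub>R v i" "h t = x i + (t - \<tau> i) *\<^sub>R v i"
      using hform[OF i] t by auto
    show "h r = h t + (r - t) *\<^sub>R v i" unfolding e by (simp add: algebra_simps)
  qed (use nv[OF i] t in auto)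
  have locate: "\<exists>i<s. t \<in> {\<tau> i..<\<tau> (Suc i)}" if t: "0 \<le> t" "t < T" for t
  proof -
    define i where "i = (LEAST i. t < \<tau> i)"
    have ti: "t < \<tau> i" unfolding i_def by (rule LeastI[of _ s]) (use t T_def in simp)
    have is': "i \<le> s" unfolding i_def by (rule Least_le) (use t T_def in simp)
    have "i \<noteq> 0" using ti t \<tau>0 by (cases "i = 0") auto
    then obtain j where j: "i = Suc j" using not0_implies_Suc by blast
    have "\<not> t < \<tau> j" using not_less_Least[of j "\<lambda>i. t < \<tau> i"] j unfolding i_def by simp
    then show ?thesis using j is' ti by (intro exI[of _ j]) auto
  qed
  have normal: "\<exists>n. outward_normal (copy Ob (k (Suc i))) (x (Suc i)) n \<and> v (Suc i) = mirror n (v i)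
      \<and> n \<bullet> v i < 0 \<and> n \<bullet> v (Suc i) > 0" if i: "Suc i < s" for i
  proof -
    have "\<exists>n. norm n = 1 \<and> (\<forall>y\<in>copy Ob (k (Suc i)). n \<bullet> (y - x (Suc i)) \<le> 0) \<and>
        sgn (x (Suc (Suc i)) - x (Suc i)) = mirror n (sgn (x (Suc i) - x i)) \<and>
        n \<bullet> sgn (x (Suc i) - x i) < 0 \<and> n \<bullet> sgn (x (Suc (Suc i)) - x (Suc i)) > 0"
    proof (rule reflection_of_shortest[OF convex_copy xin])
      show "x (Suc i) \<notin> closed_segment (x i) (x (Suc (Suc i)))"
      proof
        assume "x (Suc i) \<in> closed_segment (x i) (x (Suc (Suc i)))"
        also have "\<dots> \<subseteq> convex hull (copy Ob (k i) \<union> copy Ob (k (Suc (Suc i))))"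
          by (intro closed_segment_subset) (auto intro!: hull_inc simp: xin)
        finally have "lies_between Ob (k (Suc i)) (k i) (k (Suc (Suc i)))"
          using xin[of "Suc i"] free[of i] free[of "Suc i"] i unfolding lies_between_def free_step_iff by auto
        then show False using turnable[OF i] unfolding turnable_step_iff by simp
      qed
      fix y assume y: "y \<in> copy Ob (k (Suc i))"
      define y' where "y' = x(Suc i := y)"
      \<comment> \<open>Only the two links at the vertex change.\<close>
      define A where "A = {..<s} - {i, Suc i}"
      have split: "(\<Sum>j<s. norm (f (Suc j) - f j)) = (\<Sum>j\<in>A. norm (f (Suc j) - f j)) +
         (norm (f (Suc i) - f i) + norm (f (Suc (Suc i)) - f (Suc i)))" for f :: "nat \<Rightarrow> complex"
      proof -
        have "{..<s} = insert i (insert (Suc i) A)" using i by (auto simp: A_def)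
        moreover have "i \<notin> A" "Suc i \<notin> A" "finite A" by (auto simp: A_def)
        ultimately show ?thesis by simp
      qed
      have "(\<Sum>j\<in>A. norm (y' (Suc j) - y' j)) = (\<Sum>j\<in>A. norm (x (Suc j) - x j))"
        by (intro sum.cong) (auto simp: A_def y'_def)
      moreover have "(\<Sum>i<s. norm (x (Suc i) - x i)) \<le> (\<Sum>i<s. norm (y' (Suc i) - y' i))"
        by (rule xmin) (use y xin in \<open>auto simp: y'_def\<close>)
      ultimately show "norm (x (Suc i) - x i) + norm (x (Suc (Suc i)) - x (Suc i))
          \<le> norm (y - x i) + norm (x (Suc (Suc i)) - y)"
        unfolding split[of x] split[of y'] by (simp add: y'_def)
    qed
    then show ?thesis unfolding v_def using outside_halfplane_interior[OF xin] by blast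
  qed
  have first: "outward_normal (copy Ob (k 0)) (x 0) (v 0)"
  proof (rule outside_halfplane_interior[OF xin nv[OF s]])
    fix y assume y: "y \<in> copy Ob (k 0)"
    have "(x 1 - x 0) \<bullet> (y - x 0) \<le> 0"
    proof (rule any_closest_point_dot[OF convex_copy closed_copy xin y], intro ballI)
      fix y assume y: "y \<in> copy Ob (k 0)"
      define y' where "y' = x(0 := y)"
      have split: "(\<Sum>j<s. norm (f (Suc j) - f j)) = (\<Sum>j\<in>{..<s} - {0}. norm (f (Suc j) - f j)) + norm (f 1 - f 0)" for f :: "nat \<Rightarrow> complex"
        using s by (simp add: sum.remove[of _ 0])
      have "(\<Sum>j\<in>{..<s} - {0}. norm (y' (Suc j) - y' j)) = (\<Sum>j\<in>{..<s} - {0}. norm (x (Suc j) - x j))"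
        by (intro sum.cong) (auto simp: y'_def)
      moreover have "(\<Sum>i<s. norm (x (Suc i) - x i)) \<le> (\<Sum>i<s. norm (y' (Suc i) - y' i))"
        by (rule xmin) (use y xin in \<open>auto simp: y'_def\<close>)
      ultimately show "dist (x 1) (x 0) \<le> dist (x 1) y"
        unfolding split[of x] split[of y'] by (simp add: y'_def dist_norm)
    qed
    then show "v 0 \<bullet> (y - x 0) \<le> 0"
      using l[OF s] by (simp add: v_def sgn_div_norm mult_le_0_iff divide_le_0_iff)
  qed
  obtain q where q: "s = Suc q" using s by (cases s) auto
  have last: "outward_normal (copy Ob (k s)) (x s) (- v q)"
  proof (rule outside_halfplane_interior[OF xin])
    show "norm (- v q) = 1" using nv[of q] q by simp
    fix y assume y: "y \<in> copy Ob (k s)"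
    have "(x q - x s) \<bullet> (y - x s) \<le> 0"
    proof (rule any_closest_point_dot[OF convex_copy closed_copy xin y], intro ballI)
      fix y assume y: "y \<in> copy Ob (k s)"
      define y' where "y' = x(s := y)"
      have "(\<Sum>j<q. norm (y' (Suc j) - y' j)) = (\<Sum>j<q. norm (x (Suc j) - x j))"
        by (intro sum.cong) (auto simp: y'_def q)
      moreover have "(\<Sum>i<s. norm (x (Suc i) - x i)) \<le> (\<Sum>i<s. norm (y' (Suc i) - y' i))"
        by (rule xmin) (use y xin in \<open>auto simp: y'_def\<close>)
      ultimately show "dist (x q) (x s) \<le> dist (x q) y"
        by (simp add: q y'_def dist_norm norm_minus_commute)
    qed
    moreover have "- v q = (1 / l q) *\<^sub>R (x q - x s)"
      using l[of q] q by (simp add: v_def l_def sgn_div_norm algebra_simps divide_inverse)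
    ultimately show "- v q \<bullet> (y - x s) \<le> 0"
      using l[of q] q by (simp add: divide_le_0_iff)
  qed
  have start_normal: "\<exists>n. outward_normal (copy Ob (k i)) (x i) n \<and> n \<bullet> v i > 0" if "i < s" for i
  proof (cases i)
    case 0
    then show ?thesis using first nv[OF s] by (intro exI[of _ "v 0"]) (simp add: dot_square_norm)
  next
    case (Suc j) then show ?thesis using normal[of j] that by auto
  qed
  have end_normal: "\<exists>n. outward_normal (copy Ob (k (Suc i))) (x (Suc i)) n \<and> n \<bullet> v i < 0" if "i < s" for i
  proof (cases "Suc i = s")
    case True
    then show ?thesis using last nv[of q] q by (intro exI[of _ "- v q"]) (simp add: dot_square_norm)
  next
    case False then show ?thesis using normal[of i] that by auto
  qed
  have clear: "h t \<notin> copy Ob j" if i: "i < s" and t: "t \<in> {\<tau> i<..<\<tau> (Suc i)}" for i t j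
  proof
    assume hj: "h t \<in> copy Ob j"
    define u where "u = (t - \<tau> i) / l i"
    have u: "0 < u" "u < 1" using t l[OF i] by (auto simp: u_def \<tau>S)
    have h1: "h t = x i + (t - \<tau> i) *\<^sub>R v i" using hform[OF i] t by simp
    have h2: "h t = x (Suc i) - (\<tau> (Suc i) - t) *\<^sub>R v i"
      unfolding h1 \<tau>S using lv[of i] by (simp add: algebra_simps)
    have "(t - \<tau> i) *\<^sub>R v i = u *\<^sub>R (x (Suc i) - x i)"
      using l[OF i] by (simp add: u_def lv[symmetric])
    then have "h t = (1 - u) *\<^sub>R x i + u *\<^sub>R x (Suc i)"
      unfolding h1 by (simp add: algebra_simps)
    then have "h t \<in> closed_segment (x i) (x (Suc i))" unfolding closed_segment_def using u by auto
    also have "\<dots> \<subseteq> convex hull (copy Ob (k i) \<union> copy Ob (k (Suc i)))"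
      by (intro closed_segment_subset) (auto intro!: hull_inc simp: xin)
    finally have "j = k i \<or> j = k (Suc i)"
      using hj free[OF i] unfolding free_step_iff lies_between_def by blast
    then show False
    proof
      assume j: "j = k i"
      obtain n where n: "outward_normal (copy Ob (k i)) (x i) n" "n \<bullet> v i > 0" using start_normal[OF i] by blast
      then have "n \<bullet> (h t - x i) \<le> 0" using hj j unfolding outward_normal_def by blast
      then show False using n(2) t unfolding h1 by (simp add: mult_le_0_iff)
    next
      assume j: "j = k (Suc i)"
      obtain n where n: "outward_normal (copy Ob (k (Suc i))) (x (Suc i)) n" "n \<bullet> v i < 0" using end_normal[OF i] by blast
      then have "n \<bullet> (h t - x (Suc i)) \<le> 0" using hj j unfolding outward_normal_def by blast
      then show False using n(2) t unfolding h2 by (simp add: zero_le_mult_iff)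
    qed
  qed
  have fr: "x i \<in> frontier (copy Ob (k i))" if "i \<le> s" for i
    using start_normal[of i] last that by (cases "i = s") (auto simp: outward_normal_def)
  have T0: "0 < T" using \<tau>less[of 0 s] s by (simp add: T_def \<tau>0)
  have cases: "(\<exists>i. Suc i < s \<and> t = \<tau> (Suc i)) \<or> (\<exists>i<s. t \<in> {\<tau> i<..<\<tau> (Suc i)})" if t: "t \<in> {0<..<T}" for t
  proof -
    obtain i where i: "i < s" "t \<in> {\<tau> i..<\<tau> (Suc i)}" using locate[of t] t by auto
    show ?thesis
    proof (cases "t = \<tau> i")
      case True
      then show ?thesis using t i \<tau>0 by (cases i) auto
    qed (use i in auto)
  qed
  have turn_arr: "arrives h (\<tau> (Suc i)) (v i)" "departs h (\<tau> (Suc i)) (v (Suc i))" if "Suc i < s" for i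
    using arr[of i "\<tau> (Suc i)"] dep[of "Suc i" "\<tau> (Suc i)"] \<tau>less[of i "Suc i"] \<tau>less[of "Suc i" "Suc (Suc i)"] that by auto
  have plane: "plane_piece Ob T h"
    unfolding plane_piece_def billiard_piece_def
  proof (intro conjI ballI)
    show "0 < T" by (rule T0)
    show "h ` {0..T} \<subseteq> - (\<Union>k. interior (copy Ob k))"
    proof (rule image_subsetI, rule ComplI)
      fix t assume t: "t \<in> {0..T}" and "h t \<in> (\<Union>k. interior (copy Ob k))"
      then obtain j where j: "h t \<in> interior (copy Ob j)" "h t \<in> copy Ob j" using interior_subset by blast
      have atv: False if "h t = x i" "i \<le> s" for i
      proof -
        have "j = k i" using j(2) that xin copy_unique by metis
        then show False using fr[OF that(2)] j(1) that(1) by (simp add: frontier_def)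
      qed
      consider "t = 0" | "t = T" | "t \<in> {0<..<T}" using t by force
      then show False
      proof cases
        case 1 then show False using atv[of 0] h\<tau>[of 0] \<tau>0 by simp
      next
        case 2 then show False using atv[of s] h\<tau>[of s] by (simp add: T_def)
      next
        case 3 then show False using cases[OF 3] clear j(2) atv h\<tau> by (metis less_imp_le)
      qed
    qed
    show "\<exists>w. departs h 0 w" using dep[of 0 0] s \<tau>less[of 0 1] \<tau>0 by auto
    show "\<exists>v. arrives h T v" using arr[of q T] q \<tau>less[of q s] by (auto simp: T_def)
    show "\<exists>v w. arrives h t v \<and> departs h t w \<and> plane_law Ob (h t) v w" if t: "t \<in> {0<..<T}" for t
      using cases[OF t]
    proof
      assume "\<exists>i. Suc i < s \<and> t = \<tau> (Suc i)"
      then obtain i where i: "Suc i < s" "t = \<tau> (Suc i)" by blast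
      have ht: "h t = x (Suc i)" using i h\<tau>[of "Suc i"] by simp
      have ex: "\<exists>k. h t \<in> frontier (copy Ob k)" unfolding ht using fr[of "Suc i"] i by (intro exI[of _ "k (Suc i)"]) auto
      have "plane_law Ob (h t) (v i) (v (Suc i))"
        unfolding plane_law_def ht if_P[OF ex[unfolded ht]] using normal[OF i(1)] by blast
      then show ?thesis using turn_arr i by blast
    next
      assume "\<exists>i<s. t \<in> {\<tau> i<..<\<tau> (Suc i)}"
      then obtain i where i: "i < s" "t \<in> {\<tau> i<..<\<tau> (Suc i)}" by blast
      then have "h t \<notin> frontier (copy Ob j)" for j using clear[OF i] frontier_copy_subset by blast
      then have "plane_law Ob (h t) (v i) (v i)" unfolding plane_law_def by auto
      then show ?thesis using arr[OF i(1)] dep[OF i(1)] i(2) by (meson greaterThanAtMost_iff greaterThanLessThan_iff atLeastLessThan_iff less_imp_le)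
    qed
  qed
  define g where "g t = fold_plane (h t)" for t
  have "square_piece Ob T g" unfolding g_def by (rule fold_piece[OF plane])
  moreover have "has_type Ob T g (map k [0..<Suc s])"
    unfolding has_type_def Let_def
  proof (intro conjI exI[of _ h] exI[of _ \<tau>])
    have len: "length (map k [0..<Suc s]) - 1 = s" by simp
    have nth: "map k [0..<Suc s] ! i = k i" if "i \<le> s" for i using that by (simp add: nth_append del: upt_Suc)
    show "map k [0..<Suc s] \<noteq> []" "map k [0..<Suc s] ! 0 = (0,0)" using nth[of 0] k0 by auto
    show "unfolding_of Ob T g h" unfolding unfolding_of_def g_def using plane ex_cell_map_fold by blast
    show "\<tau> 0 = 0" by (rule \<tau>0)
    show "\<tau> (length (map k [0..<Suc s]) - 1) = T" unfolding len T_def ..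
    show "strict_mono_on {0..length (map k [0..<Suc s]) - 1} \<tau>"
      unfolding len by (auto intro!: strict_mono_onI \<tau>less)
    show "\<forall>i\<le>length (map k [0..<Suc s]) - 1. h (\<tau> i) \<in> frontier (copy Ob (map k [0..<Suc s] ! i))"
      unfolding len using nth h\<tau> fr by simp
    show "{t \<in> {0<..<T}. reflects_at h t} = \<tau> ` {0<..<length (map k [0..<Suc s]) - 1}"
      unfolding len
    proof (intro equalityI subsetI)
      fix t assume "t \<in> {t \<in> {0<..<T}. reflects_at h t}"
      then have t: "t \<in> {0<..<T}" "reflects_at h t" by auto
      have "\<not> (\<exists>i<s. t \<in> {\<tau> i<..<\<tau> (Suc i)})"
      proof
        assume "\<exists>i<s. t \<in> {\<tau> i<..<\<tau> (Suc i)}"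
        then obtain i where i: "i < s" "t \<in> {\<tau> i<..<\<tau> (Suc i)}" by blast
        have "arrives h t (v i)" "departs h t (v i)" using arr[OF i(1), of t] dep[OF i(1), of t] i(2) by auto
        then show False using t(2) arrives_unique departs_unique unfolding reflects_at_def by metis
      qed
      then show "t \<in> \<tau> ` {0<..<s}" using cases[OF t(1)] by auto
    next
      fix t assume "t \<in> \<tau> ` {0<..<s}"
      then obtain j where j: "t = \<tau> j" "0 < j" "j < s" by auto
      obtain i where i: "j = Suc i" using j by (cases j) auto
      obtain n where n: "n \<bullet> v i < 0" "n \<bullet> v (Suc i) > 0" using normal[of i] j i by auto
      then have "v i \<noteq> v (Suc i)" by auto
      then have "reflects_at h t" unfolding reflects_at_def using turn_arr[of i] j i by blast
      moreover have "t \<in> {0<..<T}" using \<tau>less[of 0 j] \<tau>less[of j s] j \<tau>0 by (simp add: T_def)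
      ultimately show "t \<in> {t \<in> {0<..<T}. reflects_at h t}" by simp
    qed
  qed
  ultimately show ?thesis by blast
qed

end

section \<open>Words of steps\<close>

lemma sum_lessThan_split: "(\<Sum>i<a + c. f i) = (\<Sum>i<a. f i) + (\<Sum>i<(c::nat). f (a + i))"
  for f :: "nat \<Rightarrow> real"
  by (induction c) (simp_all add: algebra_simps)

context small_obstacle
begin

definition adm :: "(int \<times> int) list \<Rightarrow> bool" where
  "adm w \<longleftrightarrow> (\<forall>m\<in>set w. free m) \<and> successively turnable w"

definition steps :: "(int \<times> int) list \<Rightarrow> (int \<times> int) list" where
  "steps ks = map (\<lambda>i. act (cell_inv (ks ! i)) (ks ! Suc i)) [0..<length ks - 1]"

definition walk :: "(int \<times> int) list \<Rightarrow> nat \<Rightarrow> int \<times> int" where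
  "walk w i = foldl act (0,0) (take i w)"

text \<open>
  The vertices are given in folded coordinates, so \<open>b\<close> may be any sequence in the obstacle.
\<close>
definition len :: "(int \<times> int) list \<Rightarrow> (nat \<Rightarrow> complex) \<Rightarrow> real" where
  "len w b = (\<Sum>i<length w. norm (b i - cell_map (w ! i) (b (Suc i))))"

definition minlen :: "(int \<times> int) list \<Rightarrow> real" where
  "minlen w = Inf {len w b | b. \<forall>i\<le>length w. b i \<in> Ob}"

text \<open>
  All points of the obstacle are possible vertices; taking \<open>z\<close> itself makes the rotation of a word compatible with the
  symmetries of the group.
\<close>
definition rot :: "(int \<times> int) list \<Rightarrow> real" where
  "rot w = path_swing (\<lambda>i. w ! i) (\<lambda>_. z) (length w)"

lemma walk_0 [simp]: "walk w 0 = (0,0)"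
  by (simp add: walk_def)

lemma walk_Suc: "i < length w \<Longrightarrow> walk w (Suc i) = act (walk w i) (w ! i)"
  by (simp add: walk_def take_Suc_conv_app_nth)

lemma walk_step: "i < length w \<Longrightarrow> act (cell_inv (walk w i)) (walk w (Suc i)) = w ! i"
  by (simp add: walk_Suc)

lemma steps_walk: "steps (map (walk w) [0..<Suc (length w)]) = w"
  by (rule nth_equalityI) (auto simp: steps_def nth_append walk_step simp del: upt_Suc)

lemma adm_nth: "adm w \<longleftrightarrow> (\<forall>i<length w. free (w ! i)) \<and> (\<forall>i. Suc i < length w \<longrightarrow> turnable (w ! i) (w ! Suc i))"
  unfolding adm_def successively_conv_nth by (auto simp: all_set_conv_all_nth)

lemma steps_nth: "Suc i < length ks \<Longrightarrow> steps ks ! i = act (cell_inv (ks ! i)) (ks ! Suc i)"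
  by (simp add: steps_def nth_upt less_diff_conv)

lemma length_steps [simp]: "length (steps ks) = length ks - 1"
  by (simp add: steps_def)

lemma adm_steps: "admissible Ob ks \<Longrightarrow> adm (steps ks)"
  unfolding admissible_iff adm_nth by (auto simp: steps_nth)

text \<open>
  Both facts come from a shortest path in the plane, carried back to folded coordinates.
\<close>
lemma minlen_attained: "\<exists>b. (\<forall>i. b i \<in> Ob) \<and> len w b = minlen w"
  and minlen_le: "(\<And>i. i \<le> length w \<Longrightarrow> b i \<in> Ob) \<Longrightarrow> minlen w \<le> len w b"
proof -
  have conv: "(\<Sum>i<length w. norm (cell_map (walk w (Suc i)) (b (Suc i)) - cell_map (walk w i) (b i))) = len w b" for b
    unfolding len_def by (intro sum.cong refl)
      (simp add: walk_Suc cell_map_act norm_cell_map_diff norm_minus_commute)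
  obtain x where x: "\<And>i. x i \<in> copy Ob (walk w i)"
    "\<And>y. (\<And>i. i \<le> length w \<Longrightarrow> y i \<in> copy Ob (walk w i)) \<Longrightarrow>
        (\<Sum>i<length w. norm (x (Suc i) - x i)) \<le> (\<Sum>i<length w. norm (y (Suc i) - y i))"
    using shortest_exists[of "walk w" "length w"] by metis
  define c where "c i = cell_map (cell_inv (walk w i)) (x i)" for i
  have c: "c i \<in> Ob" for i using x(1)[of i] by (simp add: c_def in_copy_iff)
  have cx: "cell_map (walk w i) (c i) = x i" for i by (simp add: c_def)
  have le: "len w c \<le> len w b" if "\<And>i. i \<le> length w \<Longrightarrow> b i \<in> Ob" for b
    unfolding conv[symmetric] cx by (rule x(2)) (simp add: that)
  then have eq: "minlen w = len w c" unfolding minlen_def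
    by (intro cInf_eq_minimum) (use c in blast)+
  show "\<exists>b. (\<forall>i. b i \<in> Ob) \<and> len w b = minlen w" using c eq by auto
  show "minlen w \<le> len w b" if "\<And>i. i \<le> length w \<Longrightarrow> b i \<in> Ob" using le[OF that] eq by simp
qed

lemma path_swing_cong:
  assumes "\<And>i. i < s \<Longrightarrow> m i = m' i" shows "path_swing m b s = path_swing m' b s"
  unfolding path_swing_def by (intro arg_cong2[of _ _ _ _ "(+)"] sum.cong refl) (use assms in auto)

theorem piece_estimates:
  assumes sq: "square_piece Ob T g" and adm: "admissible Ob ks" and ty: "has_type Ob T g ks"
    and d: "has_displacement z T g d"
  shows "steps ks \<noteq> []" "\<bar>T - minlen (steps ks)\<bar> \<le> 2" "\<bar>2 * pi * d - rot (steps ks)\<bar> \<le> 6 * pi"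
proof -
  define w where "w = steps ks"
  obtain h \<tau> v where "trajectory Ob z T g h (\<lambda>i. ks ! i) \<tau> v (length ks - 1)"
    using piece_trajectory[OF sq adm ty] by blast
  then interpret t: trajectory Ob z T g h "\<lambda>i. ks ! i" \<tau> v "length ks - 1" .
  have lw: "length w = length ks - 1" by (simp add: w_def)
  show "steps ks \<noteq> []" using t.s_pos by (auto simp flip: length_greater_0_conv)
  have m: "t.m i = w ! i" if "i < length w" for i using that by (simp add: t.m_def w_def steps_nth)
  have step: "ks ! Suc i = act (ks ! i) (w ! i)" if "i < length w" for i
    using arg_cong[OF m[OF that], of "act (ks ! i)"] by (simp add: t.m_def)
  have conv: "(\<Sum>i<length w. norm (cell_map (ks ! Suc i) (c (Suc i)) - cell_map (ks ! i) (c i))) = len w c" for c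
    unfolding len_def by (intro sum.cong refl)
      (simp add: step cell_map_act norm_cell_map_diff norm_minus_commute)
  have "T = len w t.b" using t.length_eq unfolding lw[symmetric] t.h_b conv .
  moreover have "minlen w \<le> len w t.b" by (rule minlen_le) (use t.b_Ob lw in auto)
  moreover obtain c where c: "\<And>i. c i \<in> Ob" "len w c = minlen w" using minlen_attained by blast
  have "T \<le> len w c + 2"
    using t.length_le[of "\<lambda>i. cell_map (ks ! i) (c i)"] c(1) unfolding lw[symmetric] conv by simp
  ultimately show "\<bar>T - minlen (steps ks)\<bar> \<le> 2" using c(2) unfolding w_def[symmetric] by linarith
  obtain \<phi> where \<phi>: "continuous_on {0..T} \<phi>" "\<And>t. t\<in>{0..T} \<Longrightarrow> is_Arg (g t - z) (2 * pi * \<phi> t)" "d = \<phi> T - \<phi> 0"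
    using d unfolding has_displacement_def by blast
  have "\<bar>path_swing t.m t.b (length w) - (2 * pi * \<phi> T - 2 * pi * \<phi> 0)\<bar> \<le> 4 * pi"
    unfolding lw by (rule t.displacement_path_swing) (use \<phi> in \<open>auto intro!: continuous_intros\<close>)
  moreover have "path_swing t.m t.b (length w) = path_swing (\<lambda>i. w ! i) t.b (length w)" by (rule path_swing_cong) (rule m)
  moreover have "\<bar>path_swing (\<lambda>i. w ! i) t.b (length w) - path_swing (\<lambda>i. w ! i) (\<lambda>_. z) (length w)\<bar> \<le> 2 * pi"
    by (rule path_swing_change) (use adm_steps[OF adm] z_Ob t.b_Ob lw in \<open>auto simp: adm_nth w_def[symmetric]\<close>)
  moreover have "2 * pi * \<phi> T - 2 * pi * \<phi> 0 = 2 * pi * d" unfolding \<phi>(3) by (simp add: algebra_simps)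
  ultimately show "\<bar>2 * pi * d - rot (steps ks)\<bar> \<le> 6 * pi"
    unfolding rot_def w_def[symmetric] by linarith
qed

definition pieces :: "(real \<times> real) set" where
  "pieces = {(T, d). \<exists>g ks. square_piece Ob T g \<and> admissible Ob ks \<and> has_type Ob T g ks \<and> has_displacement z T g d}"

lemma pieces_word:
  assumes "(T, d) \<in> pieces"
  shows "\<exists>w. adm w \<and> w \<noteq> [] \<and> \<bar>T - minlen w\<bar> \<le> 2 \<and> \<bar>2 * pi * d - rot w\<bar> \<le> 6 * pi"
  using assms piece_estimates adm_steps unfolding pieces_def by blast

lemma word_pieces:
  assumes "adm w" "w \<noteq> []"
  shows "\<exists>T d. (T, d) \<in> pieces \<and> \<bar>T - minlen w\<bar> \<le> 2 \<and> \<bar>2 * pi * d - rot w\<bar> \<le> 6 * pi"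
proof -
  define ks where "ks = map (walk w) [0..<Suc (length w)]"
  have nth: "ks ! i = walk w i" if "i \<le> length w" for i
    using that by (simp add: ks_def nth_append del: upt_Suc)
  have lk: "length ks = Suc (length w)" by (simp add: ks_def)
  have adm: "admissible Ob ks"
    using assms lk unfolding admissible_iff adm_nth by (auto simp: nth walk_step)
  obtain T g where g: "square_piece Ob T g" "has_type Ob T g ks"
    using shortest_piece[of "length w" "walk w"] assms unfolding ks_def
    by (auto simp: adm_nth walk_step)
  obtain h \<tau> v where "trajectory Ob z T g h (\<lambda>i. ks ! i) \<tau> v (length ks - 1)"
    using piece_trajectory[OF g(1) adm g(2)] by blast
  then interpret t: trajectory Ob z T g h "\<lambda>i. ks ! i" \<tau> v "length ks - 1" .
  have cg: "continuous_on {0..T} (\<lambda>t. g t - z)"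
    by (intro continuous_intros lipschitz_on_continuous_on[of 1] lipschitz_onI)
       (use t.Lipschitz in \<open>auto simp: dist_norm\<close>)
  then obtain e where "has_swing (\<lambda>t. g t - z) 0 T e" using has_swing_exists t.g_not_z by blast
  then obtain \<theta> where "continuous_on {0..T} \<theta>" "\<And>t. t\<in>{0..T} \<Longrightarrow> is_Arg (g t - z) (\<theta> t)"
    unfolding has_swing_def by blast
  then have "has_displacement z T g (\<theta> T / (2 * pi) - \<theta> 0 / (2 * pi))"
    unfolding has_displacement_def
    by (intro exI[of _ "\<lambda>t. \<theta> t / (2 * pi)"]) (auto intro!: continuous_intros)
  then have d: "(T, \<theta> T / (2 * pi) - \<theta> 0 / (2 * pi)) \<in> pieces" "steps ks = w"
    "has_displacement z T g (\<theta> T / (2 * pi) - \<theta> 0 / (2 * pi))"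
    using g adm steps_walk unfolding pieces_def ks_def by blast+
  from piece_estimates(2,3)[OF g(1) adm g(2) d(3)] show ?thesis using d by auto
qed

lemma pieces_bounded:
  obtains K where "0 \<le> K" "\<And>T d. (T, d) \<in> pieces \<Longrightarrow> \<bar>d\<bar> \<le> K * T + 1"
proof -
  obtain \<rho> where \<rho>: "0 < \<rho>" "ball z \<rho> \<subseteq> interior Ob"
    using z_interior open_interior open_contains_ball by metis
  have "\<bar>d\<bar> \<le> 1 / \<rho> * T + 1" if Td: "(T, d) \<in> pieces" for T d
  proof -
    obtain g ks where g: "square_piece Ob T g" "admissible Ob ks" "has_type Ob T g ks" "has_displacement z T g d"
      using Td unfolding pieces_def by blast
    obtain h \<tau> v where "trajectory Ob z T g h (\<lambda>i. ks ! i) \<tau> v (length ks - 1)"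
      using piece_trajectory[OF g(1-3)] by blast
    then interpret t: trajectory Ob z T g h "\<lambda>i. ks ! i" \<tau> v "length ks - 1" .
    obtain \<phi> where \<phi>: "continuous_on {0..T} \<phi>" "\<And>t. t\<in>{0..T} \<Longrightarrow> is_Arg (g t - z) (2 * pi * \<phi> t)" "d = \<phi> T - \<phi> 0"
      using g(4) unfolding has_displacement_def by blast
    have "has_swing (\<lambda>t. g t - z) 0 T (2 * pi * \<phi> T - 2 * pi * \<phi> 0)"
      by (rule has_swing_sub[of "{0..T}"]) (use \<phi> in \<open>auto intro!: continuous_intros\<close>)
    then have "\<bar>2 * pi * \<phi> T - 2 * pi * \<phi> 0\<bar> \<le> pi * (T / \<rho> + 2)"
    proof (rule swing_Lipschitz_bound)
      show "\<rho> \<le> norm (g t - z)" if "t \<in> {0..T}" for t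
        using t.outside[OF that] \<rho>(2) by (force simp: dist_norm norm_minus_commute)
    qed (use t.T_pos \<rho> t.Lipschitz in auto)
    moreover have "2 * pi * \<phi> T - 2 * pi * \<phi> 0 = pi * (2 * d)" unfolding \<phi>(3) by (simp add: algebra_simps)
    ultimately have "pi * \<bar>2 * d\<bar> \<le> pi * (T / \<rho> + 2)" by (simp add: abs_mult)
    then have "\<bar>2 * d\<bar> \<le> T / \<rho> + 2" by (simp only: mult_le_cancel_left_pos pi_gt_zero)
    moreover have "0 \<le> T / \<rho>" using t.T_pos \<rho>(1) by simp
    ultimately show ?thesis by (simp add: abs_mult)
  qed
  then show thesis using that[of "1 / \<rho>"] \<rho> by simp
qed

lemma rot_Nil [simp]: "rot [] = 0"
  by (simp add: rot_def path_swing_def)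

lemma rot_Cons: "rot (m # w) = link_swing m z z + (if w = [] then 0 else corner m (hd w) z z z) + rot w"
proof (cases w)
  case (Cons m' w')
  have "(\<Sum>i<length w. corner ((m # w) ! i) ((m # w) ! Suc i) z z z)
      = corner m m' z z z + (\<Sum>i<length w'. corner (w ! i) (w ! Suc i) z z z)"
    using Cons by (simp add: sum.lessThan_Suc_shift del: sum.lessThan_Suc)
  moreover have "(\<Sum>i<length (m # w). link_swing ((m # w) ! i) z z) = link_swing m z z + (\<Sum>i<length w. link_swing (w ! i) z z)"
    by (simp add: sum.lessThan_Suc_shift del: sum.lessThan_Suc)
  ultimately show ?thesis using Cons by (simp add: rot_def path_swing_def)
qed (simp add: rot_def path_swing_def)

lemma rot_append: "rot (u @ v) = rot u + (if u = [] \<or> v = [] then 0 else corner (last u) (hd v) z z z) + rot v"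
  by (induction u) (auto simp: rot_Cons)

lemma rot_append_le: "\<bar>rot (u @ v) - rot u - rot v\<bar> \<le> pi"
  using abs_turn_le by (simp add: rot_append corner_def)

lemma len_append: "len (u @ v) b = len u b + len v (\<lambda>i. b (length u + i))"
proof -
  have "(\<Sum>i<length u. norm (b i - cell_map ((u @ v) ! i) (b (Suc i)))) = len u b"
    unfolding len_def by (intro sum.cong) (auto simp: nth_append)
  then show ?thesis unfolding len_def by (simp add: sum_lessThan_split nth_append)
qed

lemma minlen_append_ge: "minlen u + minlen v \<le> minlen (u @ v)"
proof -
  obtain b where b: "\<And>i. b i \<in> Ob" "len (u @ v) b = minlen (u @ v)" using minlen_attained by blast
  have "minlen u \<le> len u b" "minlen v \<le> len v (\<lambda>i. b (length u + i))" by (intro minlen_le b)+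
  then show ?thesis using b(2) by (simp add: len_append)
qed

text \<open>
  Follow a shortest path for \<open>u\<close>, then one for \<open>v\<close>; they are joined at the common obstacle by moving one vertex
  by at most 18/25.
\<close>
lemma minlen_append_le: "minlen (u @ v) \<le> minlen u + minlen v + 1"
proof -
  obtain b where b: "\<And>i. b i \<in> Ob" "len u b = minlen u" using minlen_attained by blast
  obtain c where c: "\<And>i. c i \<in> Ob" "len v c = minlen v" using minlen_attained by blast
  define e where "e i = (if i \<le> length u then b i else c (i - length u))" for i
  have "len u e = len u b" unfolding len_def by (intro sum.cong) (auto simp: e_def)
  moreover have "len v (\<lambda>i. e (length u + i)) \<le> len v c + 1"
  proof (cases v)
    case (Cons m v')
    have "norm (b (length u) - c 0) \<le> 1"
      using Ob_norm[OF b(1)[of "length u"]] Ob_norm[OF c(1)[of 0]] norm_triangle_ineq4[of "b (length u)" "c 0"] by linarith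
    then have "norm (b (length u) - cell_map m (c 1)) \<le> norm (c 0 - cell_map m (c 1)) + 1"
      using norm_triangle_ineq[of "b (length u) - c 0" "c 0 - cell_map m (c 1)"] by simp
    then show ?thesis
      unfolding len_def Cons e_def by (simp add: sum.lessThan_Suc_shift del: sum.lessThan_Suc)
  qed (simp add: len_def)
  moreover have "minlen (u @ v) \<le> len (u @ v) e" by (rule minlen_le) (auto simp: e_def b c)
  ultimately show ?thesis using b c by (simp add: len_append)
qed

lemma minlen_ge: "adm w \<Longrightarrow> 7/25 * real (length w) \<le> minlen w"
proof -
  assume w: "adm w"
  obtain b where b: "\<And>i. b i \<in> Ob" "len w b = minlen w" using minlen_attained by blast
  have "7/25 \<le> norm (b i - cell_map (w ! i) (b (Suc i)))" if "i < length w" for i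
  proof -
    have "w ! i \<noteq> (0,0)" using w that unfolding adm_nth free_def by blast
    then have "1 \<le> norm (centre (w ! i))" by (rule norm_centre_ge_1)
    moreover have "norm (cell_map (w ! i) (b (Suc i)) - centre (w ! i)) \<le> 9/25"
      by (rule copy_centre) (simp add: b)
    moreover have "norm (centre (w ! i)) \<le> norm (centre (w ! i) - cell_map (w ! i) (b (Suc i)))
        + norm (cell_map (w ! i) (b (Suc i)) - b i) + norm (b i)"
      using norm_triangle_ineq[of "centre (w ! i) - cell_map (w ! i) (b (Suc i))" "cell_map (w ! i) (b (Suc i)) - b i"]
        norm_triangle_ineq[of "centre (w ! i) - b i" "b i"] by simp
    ultimately show ?thesis using Ob_norm[OF b(1)[of i]] by (simp add: norm_minus_commute)
  qed
  then have "(\<Sum>i<length w. 7/25) \<le> len w b" unfolding len_def by (intro sum_mono) auto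
  then show ?thesis using b by simp
qed

lemma adm_append: "adm (u @ v) \<longleftrightarrow> adm u \<and> adm v \<and> (u = [] \<or> v = [] \<or> turnable (last u) (hd v))"
  unfolding adm_def by (auto simp: successively_append_iff)

definition units :: "(int \<times> int) set" where
  "units = {(1,0), (-1,0), (0,1), (0,-1)}"

text \<open>
  The projections of two copies to direction \<open>n\<close> are disjoint if those of their centres differ by at least 1,
  because 9/25 is less than one half.
\<close>
lemma separated_not_between:
  assumes "norm n = 1" "n \<bullet> centre k + 1 \<le> n \<bullet> centre i" "n \<bullet> centre k + 1 \<le> n \<bullet> centre j"
  shows "\<not> lies_between Ob k i j"
proof -
  have near: "\<bar>n \<bullet> x - n \<bullet> centre l\<bar> \<le> 9/25" if "x \<in> copy Ob l" for x l
    using Cauchy_Schwarz_ineq2[of n "x - centre l"] copy_centre[OF that] assms(1)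
    by (simp add: inner_diff_right)
  have "convex hull (copy Ob i \<union> copy Ob j) \<subseteq> {x. n \<bullet> x \<ge> n \<bullet> centre k + 16/25}"
  proof (rule hull_minimal)
    show "copy Ob i \<union> copy Ob j \<subseteq> {x. n \<bullet> x \<ge> n \<bullet> centre k + 16/25}"
    proof
      fix x assume "x \<in> copy Ob i \<union> copy Ob j"
      then have "\<bar>n \<bullet> x - n \<bullet> centre i\<bar> \<le> 9/25 \<or> \<bar>n \<bullet> x - n \<bullet> centre j\<bar> \<le> 9/25" using near by blast
      then have "n \<bullet> centre k + 16/25 \<le> n \<bullet> x" using assms(2,3) by linarith
      then show "x \<in> {x. n \<bullet> x \<ge> n \<bullet> centre k + 16/25}" by simp
    qed
    show "convex {x. n \<bullet> x \<ge> n \<bullet> centre k + 16/25}"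
      using convex_halfspace_ge[of "n \<bullet> centre k + 16/25" n] by simp
  qed
  then show ?thesis using near[of _ k] unfolding lies_between_def by force
qed

lemma unit_free: assumes "u \<in> units" shows "free u"
proof -
  define c where "c = centre u"
  have c: "norm c = 1" "c \<bullet> c = 1" "(\<i> * c) \<bullet> c = 0" "norm (\<i> * c) = 1"
    using assms by (auto simp: c_def units_def cmod_def inner_complex_def)
  have "\<not> lies_between Ob k (0,0) u" for k
  proof
    assume l: "lies_between Ob k (0,0) u"
    then have ne: "k \<noteq> (0,0)" "k \<noteq> u" by (auto simp: lies_between_def)
    define \<alpha> \<beta> where "\<alpha> = fst u * fst k + snd u * snd k" and "\<beta> = fst u * snd k - snd u * fst k"
    have \<alpha>: "c \<bullet> centre k = of_int \<alpha>" and \<beta>: "(\<i> * c) \<bullet> centre k = of_int \<beta>"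
      by (simp_all add: c_def inner_complex_def \<alpha>_def \<beta>_def)
    have u: "c \<bullet> centre u = 1" "(\<i> * c) \<bullet> centre u = 0" using c by (simp_all add: c_def)
    have nz: "\<beta> \<noteq> 0 \<or> \<alpha> \<ge> 2 \<or> \<alpha> \<le> -1"
      using ne assms unfolding \<alpha>_def \<beta>_def units_def by (cases k) auto
    have "\<not> \<beta> \<le> -1" using l separated_not_between[of "\<i> * c" k "(0,0)" u] c u \<beta> by auto
    moreover have "\<not> \<beta> \<ge> 1" using l separated_not_between[of "- (\<i> * c)" k "(0,0)" u] c u \<beta> by auto
    moreover have "\<not> \<alpha> \<le> -1" using l separated_not_between[of c k "(0,0)" u] c u \<alpha> by auto
    moreover have "\<not> \<alpha> \<ge> 2" using l separated_not_between[of "- c" k "(0,0)" u] c u \<alpha> by auto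
    ultimately show False using nz by linarith
  qed
  moreover have "u \<noteq> (0,0)" using assms by (auto simp: units_def)
  ultimately show ?thesis by (simp add: free_def)
qed

lemma unit_inv: "u \<in> units \<Longrightarrow> cell_inv u = u"
  by (auto simp: units_def cell_inv_def sg_def)

text \<open>
  The unit vector \<open>u\<close> is chosen such that \<open>e\<close> has a positive, hence at least unit, component in its direction.
\<close>
lemma unit_near:
  assumes "e \<noteq> (0,0)" shows "\<exists>u\<in>units. \<not> lies_between Ob (0,0) e u \<and> \<not> lies_between Ob (0,0) u e"
proof -
  have "\<exists>u\<in>units. 1 \<le> fst u * fst e + snd u * snd e" using assms
    by (cases e) (auto simp: units_def)
  then obtain u where u: "u \<in> units" "1 \<le> fst u * fst e + snd u * snd e" by blast
  have "1 \<le> centre u \<bullet> centre e"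
  proof -
    have "centre u \<bullet> centre e = of_int (fst u * fst e + snd u * snd e)" by (simp add: inner_complex_def)
    then show ?thesis using u(2) by linarith
  qed
  moreover have "norm (centre u) = 1" "centre u \<bullet> centre u = 1"
    using u(1) by (auto simp: units_def cmod_def inner_complex_def)
  ultimately have "\<not> lies_between Ob (0,0) e u" "\<not> lies_between Ob (0,0) u e"
    using separated_not_between[of "centre u" "(0,0)" e u] separated_not_between[of "centre u" "(0,0)" u e]
    by simp_all
  then show ?thesis using u(1) by blast
qed

text \<open>
  The line \<open>n \<bullet> x = 1/2\<close> at distance \<open>\<surd>2 / 4\<close> from the origin separates the obstacle from its two neighbours. This is what the
  bound on the size of a small obstacle means.
\<close>
lemma unit_perpendicular:
  assumes u: "u \<in> units" "v \<in> units" "fst u * fst v + snd u * snd v = 0"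
  shows "turnable u v"
proof -
  define n where "n = centre u + centre v"
  have n: "norm n = sqrt 2" "n \<bullet> centre u = 1" "n \<bullet> centre v = 1"
    using u by (auto simp: n_def units_def cmod_def inner_complex_def)
  have near: "\<bar>n \<bullet> x - n \<bullet> centre l\<bar> < 1/2" if "x \<in> copy Ob l" for x l
  proof -
    obtain y where "y \<in> Ob" "x = cell_map l y" using \<open>x \<in> copy Ob l\<close> by (auto simp: copy_def)
    then have "norm (x - centre l) < sqrt 2 / 4" using Ob_norm_less by (simp add: cell_map_eq)
    then have "norm n * norm (x - centre l) < sqrt 2 * (sqrt 2 / 4)"
      unfolding n(1) by (intro mult_strict_left_mono) auto
    then show ?thesis using Cauchy_Schwarz_ineq2[of n "x - centre l"] by (simp add: inner_diff_right)
  qed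
  have "convex hull (copy Ob u \<union> copy Ob v) \<subseteq> {x. n \<bullet> x > 1/2}"
  proof (rule hull_minimal)
    show "copy Ob u \<union> copy Ob v \<subseteq> {x. n \<bullet> x > 1/2}"
    proof
      fix x assume "x \<in> copy Ob u \<union> copy Ob v"
      then have "\<bar>n \<bullet> x - n \<bullet> centre u\<bar> < 1/2 \<or> \<bar>n \<bullet> x - n \<bullet> centre v\<bar> < 1/2" using near by blast
      then have "1/2 < n \<bullet> x" using n by linarith
      then show "x \<in> {x. n \<bullet> x > 1/2}" by simp
    qed
  qed (rule convex_halfspace_gt)
  then show ?thesis using near[of _ "(0,0)"] unit_inv[OF u(1)] unfolding turnable_def lies_between_def by force
qed

text \<open>
  Only a unit step followed by its opposite may be forbidden; then a perpendicular step is put in between.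
\<close>
lemma connect_units:
  assumes "u \<in> units" "v \<in> units"
  shows "\<exists>c. c \<noteq> [] \<and> hd c = u \<and> last c = v \<and> length c \<le> 3 \<and> set c \<subseteq> units \<and> adm c"
proof -
  have single: "adm [u]" "adm [v]" using unit_free assms by (auto simp: adm_def)
  consider "u = v" | "fst u * fst v + snd u * snd v = 0" | "v = (- fst u, - snd u)"
    using assms by (auto simp: units_def)
  then show ?thesis
  proof cases
    case 1 then show ?thesis using single assms by (intro exI[of _ "[u]"]) auto
  next
    case 2
    then have "adm [u, v]" using unit_free assms unit_perpendicular by (auto simp: adm_def)
    then show ?thesis using assms by (intro exI[of _ "[u, v]"]) auto
  next
    case 3
    define m where "m = (snd u, fst u)"
    have m: "m \<in> units" "fst u * fst m + snd u * snd m = 0" "fst m * fst v + snd m * snd v = 0"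
      using assms 3 by (auto simp: units_def m_def)
    then have "adm [u, m, v]" using unit_free assms unit_perpendicular by (auto simp: adm_def)
    then show ?thesis using assms m by (intro exI[of _ "[u, m, v]"]) auto
  qed
qed

lemma spoke_z: "spoke (cell_inv m) z z (1 - t) = spoke m z z t"
  by (rule spoke_reverse)

text \<open>
  With both vertices at \<open>z\<close>, the link of the inverse step is the same folded curve run backwards.
\<close>
lemma link_swing_inv: assumes "free m" shows "link_swing (cell_inv m) z z = - link_swing m z z"
proof -
  have "has_swing (\<lambda>t. spoke (cell_inv m) z z (margin m + (1 - margin m) - t)) (margin m) (1 - margin m) (- link_swing (cell_inv m) z z)"
    using has_swing_reverse[OF has_swing_link[OF free_cell_inv[OF assms] z_Ob z_Ob]] by simp
  then have "has_swing (spoke m z z) (margin m) (1 - margin m) (- link_swing (cell_inv m) z z)"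
    by (rule has_swing_cong) (simp add: spoke_z)
  from link_swing_eqI[OF assms z_Ob z_Ob this] show ?thesis by simp
qed

text \<open>
  A unit step is its own inverse, so its rotation equals its own negative.
\<close>
lemma link_swing_unit: "u \<in> units \<Longrightarrow> link_swing u z z = 0"
  using link_swing_inv[OF unit_free, of u] unit_inv[of u] by simp

lemma rot_units: "set c \<subseteq> units \<Longrightarrow> \<bar>rot c\<bar> \<le> pi * length c"
proof (induction c)
  case (Cons u c)
  then show ?case using abs_turn_le[of "cell_map (cell_inv u) z - z" "cell_map (hd c) z - z"]
    by (auto simp: rot_Cons link_swing_unit corner_def algebra_simps intro: order_trans)
qed simp

lemma minlen_units: "set c \<subseteq> units \<Longrightarrow> minlen c \<le> 2 * length c"
proof -
  assume c: "set c \<subseteq> units"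
  have "minlen c \<le> len c (\<lambda>_. z)" by (rule minlen_le) (rule z_Ob)
  also have "\<dots> \<le> (\<Sum>i<length c. 2)" unfolding len_def
  proof (rule sum_mono)
    fix i assume "i \<in> {..<length c}"
    then have "c ! i \<in> units" using c nth_mem by blast
    then have "norm (centre (c ! i)) = 1" by (auto simp: units_def cmod_def)
    then show "norm (z - cell_map (c ! i) z) \<le> 2"
      using step_length_le[OF z_Ob z_Ob, of "c ! i"] by (simp add: norm_minus_commute)
  qed
  finally show ?thesis by simp
qed

lemma join:
  assumes "adm u" "u \<noteq> []" "adm v" "v \<noteq> []"
  shows "\<exists>w. adm w \<and> w \<noteq> [] \<and> \<bar>minlen w - minlen u - minlen v\<bar> \<le> 8 \<and> \<bar>rot w - rot u - rot v\<bar> \<le> 5 * pi"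
proof -
  have "free (last u)" "free (hd v)" using assms unfolding adm_def by auto
  then have "cell_inv (last u) \<noteq> (0,0)" "hd v \<noteq> (0,0)" by (auto simp: free_def)
  then obtain a b where a: "a \<in> units" "\<not> lies_between Ob (0,0) (cell_inv (last u)) a"
    and b: "b \<in> units" "\<not> lies_between Ob (0,0) b (hd v)" using unit_near by meson
  obtain c where c: "c \<noteq> []" "hd c = a" "last c = b" "length c \<le> 3" "set c \<subseteq> units" "adm c"
    using connect_units[OF a(1) b(1)] by blast
  have "turnable (last u) a" "turnable b (hd v)"
    using a b unit_inv by (auto simp: turnable_def)
  then have "adm (u @ c @ v)" using assms c by (simp add: adm_append)
  moreover have "\<bar>minlen (u @ c @ v) - minlen u - minlen v\<bar> \<le> 8"
    using minlen_append_le[of u "c @ v"] minlen_append_ge[of u "c @ v"] minlen_append_le[of c v]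
      minlen_append_ge[of c v] minlen_units[OF c(5)] minlen_ge[OF c(6)] c(4) by auto
  moreover have "\<bar>rot (u @ c @ v) - rot u - rot v\<bar> \<le> 5 * pi"
  proof -
    have "pi * real (length c) \<le> pi * 3" using c(4) by (intro mult_left_mono) auto
    then show ?thesis using rot_append_le[of u "c @ v"] rot_append_le[of c v] rot_units[OF c(5)] by linarith
  qed
  ultimately show ?thesis using assms by (intro exI[of _ "u @ c @ v"]) auto
qed

definition reversed :: "(int \<times> int) list \<Rightarrow> (int \<times> int) list" where
  "reversed w = rev (map cell_inv w)"

lemma reversed_reversed: "reversed (reversed w) = w"
  by (simp add: reversed_def rev_map o_def)

lemma adm_reversed: "adm w \<Longrightarrow> adm (reversed w)"
  unfolding adm_def reversed_def
  by (auto simp: successively_map intro: free_cell_inv elim!: successively_mono dest: turnable_cell_inv)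

lemma corner_reversed:
  assumes "free m" "free m'" "turnable m m'"
  shows "corner (cell_inv m') (cell_inv m) z z z = - corner m m' z z z"
  unfolding corner_def cell_inv_inv
  by (rule turn_swap) (use turnable_segment[OF assms(3,1,2) z_Ob z_Ob z_Ob] in simp)

lemma rot_reversed: "adm w \<Longrightarrow> rot (reversed w) = - rot w"
proof (induction w)
  case (Cons m w)
  have w: "adm w" "free m" using Cons.prems adm_append[of "[m]" w] by (auto simp: adm_def)
  have b: "reversed (m # w) = reversed w @ [cell_inv m]" by (simp add: reversed_def)
  show ?case
  proof (cases "w = []")
    case True then show ?thesis using link_swing_inv[OF w(2)] by (simp add: reversed_def rot_Cons)
  next
    case False
    have t: "turnable m (hd w)" using Cons.prems adm_append[of "[m]" w] False by auto
    have "free (hd w)" using w(1) False by (auto simp: adm_def)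
    have "last (reversed w) = cell_inv (hd w)" using False by (simp add: reversed_def last_rev hd_map)
    moreover have "reversed w \<noteq> []" using False by (simp add: reversed_def)
    ultimately show ?thesis
      unfolding b rot_append using False Cons.IH[OF w(1)] link_swing_inv[OF w(2)]
        corner_reversed[OF w(2) \<open>free (hd w)\<close> t] by (simp add: rot_Cons)
  qed
qed (simp add: reversed_def)

lemma minlen_reversed: "minlen (reversed w) = minlen w"
proof -
  have "minlen (reversed w) \<le> minlen w" for w
  proof -
    obtain b where b: "\<And>i. b i \<in> Ob" "len w b = minlen w" using minlen_attained by blast
    define n where "n = length w"
    have "len (reversed w) (\<lambda>i. b (n - i)) = (\<Sum>i<n. norm (b (n - Suc i) - cell_map (w ! (n - Suc i)) (b (Suc (n - Suc i)))))"
      unfolding len_def reversed_def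
    proof (intro sum.cong)
      fix i assume "i \<in> {..<n}"
      then have i: "i < n" "Suc (n - Suc i) = n - i" by auto
      have e: "rev (map cell_inv w) ! i = cell_inv (w ! (n - Suc i))" using i by (simp add: rev_nth n_def)
      have "norm (b (n - i) - cell_map (cell_inv (w ! (n - Suc i))) (b (n - Suc i)))
          = norm (cell_map (w ! (n - Suc i)) (b (n - i)) - b (n - Suc i))"
        using norm_cell_map_diff[of "w ! (n - Suc i)" "b (n - i)" "cell_map (cell_inv (w ! (n - Suc i))) (b (n - Suc i))"] by simp
      then show "norm (b (n - i) - cell_map (rev (map cell_inv w) ! i) (b (n - Suc i)))
          = norm (b (n - Suc i) - cell_map (w ! (n - Suc i)) (b (Suc (n - Suc i))))"
        unfolding e i by (simp add: norm_minus_commute)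
    qed (simp add: n_def)
    also have "\<dots> = len w b"
      unfolding len_def n_def by (rule sum.nat_diff_reindex)
    finally have "len (reversed w) (\<lambda>i. b (n - i)) = minlen w" using b by simp
    moreover have "minlen (reversed w) \<le> len (reversed w) (\<lambda>i. b (n - i))" by (rule minlen_le) (rule b)
    ultimately show ?thesis by simp
  qed
  from this[of w] this[of "reversed w"] show ?thesis by (simp add: reversed_reversed)
qed

text \<open>
  Going back and forth between two neighbouring obstacles is its own reversal.
\<close>
lemma unit_power: "adm (replicate n (1,0))" "rot (replicate n (1,0)) = 0"
proof -
  have u: "(1,0) \<in> units" by (simp add: units_def)
  have "\<not> lies_between Ob (0,0) (1,0) (1,0)"
    by (rule separated_not_between[of 1]) (simp_all add: inner_complex_def)
  then have "turnable (1,0) (1,0)" by (simp add: turnable_def unit_inv[OF u])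
  then show adm: "adm (replicate n (1,0))" using unit_free[OF u] by (auto simp: adm_nth)
  have "reversed (replicate n (1,0)) = replicate n (1,0)" by (simp add: reversed_def unit_inv[OF u])
  then show "rot (replicate n (1,0)) = 0" using rot_reversed[OF adm] by simp
qed

end

section \<open>Asymptotic slopes\<close>

text \<open>
  A form of the definition of the rotation set without sequences, suited to sets closed under operations up to bounded errors.
\<close>
definition slopes :: "(real \<times> real) set \<Rightarrow> real set" where
  "slopes Q = {\<rho>. \<forall>\<epsilon>>0. \<forall>N. \<exists>(l, r)\<in>Q. N \<le> l \<and> \<bar>r - \<rho> * l\<bar> \<le> \<epsilon> * l}"

lemma slopesI:
  assumes "\<And>\<epsilon> N. 0 < \<epsilon> \<Longrightarrow> 0 < N \<Longrightarrow> \<exists>l r. (l, r) \<in> Q \<and> N \<le> l \<and> \<bar>r - \<rho> * l\<bar> \<le> \<epsilon> * l"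
  shows "\<rho> \<in> slopes Q"
proof -
  have "\<exists>(l, r)\<in>Q. N \<le> l \<and> \<bar>r - \<rho> * l\<bar> \<le> \<epsilon> * l" if \<epsilon>: "0 < \<epsilon>" for \<epsilon> N
  proof -
    have "0 < max N 1" by simp
    then obtain l r where "(l, r) \<in> Q" "max N 1 \<le> l" "\<bar>r - \<rho> * l\<bar> \<le> \<epsilon> * l" using assms[OF \<epsilon>] by blast
    then show ?thesis by (intro bexI[of _ "(l, r)"]) auto
  qed
  then show ?thesis by (simp add: slopes_def)
qed

lemma slopesD:
  assumes "\<rho> \<in> slopes Q" "0 < \<epsilon>"
  obtains l r where "(l, r) \<in> Q" "N \<le> l" "\<bar>r - \<rho> * l\<bar> \<le> \<epsilon> * l"
  using assms unfolding slopes_def by blast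

lemma closed_slopes: "closed (slopes Q)"
proof -
  have "\<rho> \<in> slopes Q" if \<rho>: "\<rho> \<in> closure (slopes Q)" for \<rho>
  proof (rule slopesI)
    fix \<epsilon> N :: real assume e: "0 < \<epsilon>" "0 < N"
    obtain \<sigma> where \<sigma>: "\<sigma> \<in> slopes Q" "\<bar>\<sigma> - \<rho>\<bar> < \<epsilon> / 2"
      using \<rho> e unfolding closure_approachable dist_real_def by (meson half_gt_zero)
    obtain l r where lr: "(l, r) \<in> Q" "N \<le> l" "\<bar>r - \<sigma> * l\<bar> \<le> \<epsilon> / 2 * l"
      using slopesD[OF \<sigma>(1), of "\<epsilon>/2" N] e by auto
    have "\<bar>(\<sigma> - \<rho>) * l\<bar> \<le> \<epsilon> / 2 * l" using \<sigma>(2) lr(2) e by (auto simp: abs_mult intro!: mult_right_mono)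
    moreover have "r - \<rho> * l = (r - \<sigma> * l) + (\<sigma> - \<rho>) * l" by (simp add: algebra_simps)
    ultimately have "\<bar>r - \<rho> * l\<bar> \<le> \<epsilon> / 2 * l + \<epsilon> / 2 * l" using lr(3) by linarith
    then show "\<exists>l r. (l, r) \<in> Q \<and> N \<le> l \<and> \<bar>r - \<rho> * l\<bar> \<le> \<epsilon> * l" using lr by auto
  qed
  then show ?thesis using closure_subset closure_closed by (metis subsetI subset_antisym closed_closure)
qed

lemma near_multiple:
  assumes add: "\<And>l1 r1 l2 r2. (l1, r1) \<in> Q \<Longrightarrow> (l2, r2) \<in> Q \<Longrightarrow>
      \<exists>l r. (l, r) \<in> Q \<and> \<bar>l - (l1 + l2)\<bar> \<le> C \<and> \<bar>r - (r1 + r2)\<bar> \<le> C"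
    and p: "(l, r) \<in> Q"
  shows "\<exists>L R. (L, R) \<in> Q \<and> \<bar>L - real (Suc n) * l\<bar> \<le> real n * C \<and> \<bar>R - real (Suc n) * r\<bar> \<le> real n * C"
proof (induction n)
  case 0 then show ?case using p by (intro exI[of _ l] exI[of _ r]) auto
next
  case (Suc n)
  then obtain L R where LR: "(L, R) \<in> Q" "\<bar>L - real (Suc n) * l\<bar> \<le> real n * C" "\<bar>R - real (Suc n) * r\<bar> \<le> real n * C"
    by blast
  obtain L' R' where "(L', R') \<in> Q" "\<bar>L' - (L + l)\<bar> \<le> C" "\<bar>R' - (R + r)\<bar> \<le> C"
    using add[OF LR(1) p] by blast
  then show ?case using LR(2,3)
    by (intro exI[of _ L'] exI[of _ R']) (auto simp: algebra_simps abs_le_iff)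
qed

text \<open>
  Combine about \<open>M a / l1\<close> copies of one long pair with about \<open>M b / l2\<close> copies of the other. The errors of the
  additions are at most \<open>C\<close> per copy, hence small compared to the length if \<open>l1\<close> and \<open>l2\<close> are large compared to \<open>C\<close>;
  the rounding errors in the numbers of copies disappear for large \<open>M\<close>.
\<close>
theorem convex_slopes:
  assumes add: "\<And>l1 r1 l2 r2. (l1, r1) \<in> Q \<Longrightarrow> (l2, r2) \<in> Q \<Longrightarrow>
      \<exists>l r. (l, r) \<in> Q \<and> \<bar>l - (l1 + l2)\<bar> \<le> C \<and> \<bar>r - (r1 + r2)\<bar> \<le> C"
    and C: "0 < C"
  shows "convex (slopes Q)"
proof (rule convexI)
  fix \<rho>1 \<rho>2 a b :: real
  assume \<rho>: "\<rho>1 \<in> slopes Q" "\<rho>2 \<in> slopes Q" and ab: "0 \<le> a" "0 \<le> b" "a + b = 1"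
  define \<rho> where "\<rho> = a * \<rho>1 + b * \<rho>2"
  have "\<rho> \<in> slopes Q"
  proof (rule slopesI)
    fix \<epsilon> N :: real assume e: "0 < \<epsilon>" "0 < N"
    define K where "K = 1 + \<bar>\<rho>\<bar> + \<bar>\<rho>1\<bar> + \<bar>\<rho>2\<bar>"
    have K: "1 \<le> K" "\<bar>\<rho>\<bar> \<le> K" "\<bar>\<rho>1\<bar> + \<bar>\<rho>2\<bar> \<le> K" "1 + \<bar>\<rho>\<bar> \<le> K" by (auto simp: K_def)
    \<comment> \<open>Lower bound for the lengths of the two pairs: it makes \<open>C / N1 * K \<le> \<epsilon> / 8\<close> and \<open>C / N1 \<le> 1 / 2\<close>.\<close>
    define N1 where "N1 = 2 * C + 8 * C * K / \<epsilon>"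
    have N1: "0 < N1" "2 * C \<le> N1" using C e K by (auto simp: N1_def intro!: add_pos_pos)
    have CN1: "C / N1 * K \<le> \<epsilon> / 8" "C / N1 \<le> 1 / 2"
    proof -
      have "8 * C * K / \<epsilon> \<le> N1" using C by (simp add: N1_def)
      then have "8 * C * K \<le> N1 * \<epsilon>" using e by (simp add: pos_divide_le_eq)
      then show "C / N1 * K \<le> \<epsilon> / 8" using N1(1) by (simp add: pos_divide_le_eq algebra_simps)
      show "C / N1 \<le> 1 / 2" using N1 by (simp add: pos_divide_le_eq)
    qed
    obtain l1 r1 where 1: "(l1, r1) \<in> Q" "N1 \<le> l1" "\<bar>r1 - \<rho>1 * l1\<bar> \<le> \<epsilon> / 8 * l1"
      using slopesD[OF \<rho>(1), of "\<epsilon>/8" N1] e by auto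
    obtain l2 r2 where 2: "(l2, r2) \<in> Q" "N1 \<le> l2" "\<bar>r2 - \<rho>2 * l2\<bar> \<le> \<epsilon> / 8 * l2"
      using slopesD[OF \<rho>(2), of "\<epsilon>/8" N1] e by auto
    have lpos: "0 < l1" "0 < l2" using 1 2 N1 by auto
    define D where "D = 2 * (l1 + l2)"
    \<comment> \<open>Approximate total length: it makes the rounding error \<open>K * D\<close> at most \<open>\<epsilon> / 8 * M\<close>.\<close>
    define M where "M = 2 * N + 8 * K * D / \<epsilon>"
    have M: "0 < M" "2 * N \<le> M" "8 * K * D / \<epsilon> \<le> M"
      using e K lpos by (auto simp: M_def D_def intro!: add_pos_nonneg)
    define n1 where "n1 = nat \<lfloor>M * a / l1\<rfloor>"
    define n2 where "n2 = nat \<lfloor>M * b / l2\<rfloor>"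
    define A where "A = real (Suc n1) * l1"
    define B where "B = real (Suc n2) * l2"
    have count: "M * c \<le> real (Suc (nat \<lfloor>M * c / l\<rfloor>)) * l \<and> real (Suc (nat \<lfloor>M * c / l\<rfloor>)) * l \<le> M * c + 2 * l"
      if "0 \<le> c" "0 < l" for c l
    proof -
      define q where "q = M * c / l"
      have "0 \<le> q" using that M by (simp add: q_def)
      then have "real (nat \<lfloor>q\<rfloor>) = of_int \<lfloor>q\<rfloor>" by simp
      then have "q \<le> real (Suc (nat \<lfloor>q\<rfloor>))" "real (Suc (nat \<lfloor>q\<rfloor>)) \<le> q + 2" by linarith+
      then have "q * l \<le> real (Suc (nat \<lfloor>q\<rfloor>)) * l" "real (Suc (nat \<lfloor>q\<rfloor>)) * l \<le> (q + 2) * l"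
        using that by (intro mult_right_mono; simp)+
      moreover have "q * l = M * c" "(q + 2) * l = M * c + 2 * l" using that by (simp_all add: q_def algebra_simps)
      ultimately show ?thesis unfolding q_def by simp
    qed
    have A: "M * a \<le> A" "A \<le> M * a + 2 * l1" using count[OF ab(1) lpos(1)] by (auto simp: A_def n1_def)
    have B: "M * b \<le> B" "B \<le> M * b + 2 * l2" using count[OF ab(2) lpos(2)] by (auto simp: B_def n2_def)
    define L where "L = A + B"
    have Mab: "M * a + M * b = M" using ab(3) by (simp flip: distrib_left)
    have L: "M \<le> L" "L \<le> M + D" using A B Mab by (auto simp: L_def D_def)
    have L0: "0 < L" using L M by simp
    obtain L1 R1 where m1: "(L1, R1) \<in> Q" "\<bar>L1 - A\<bar> \<le> real n1 * C" "\<bar>R1 - real (Suc n1) * r1\<bar> \<le> real n1 * C"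
      using near_multiple[OF add 1(1), of n1] unfolding A_def by blast
    obtain L2 R2 where m2: "(L2, R2) \<in> Q" "\<bar>L2 - B\<bar> \<le> real n2 * C" "\<bar>R2 - real (Suc n2) * r2\<bar> \<le> real n2 * C"
      using near_multiple[OF add 2(1), of n2] unfolding B_def by blast
    obtain l r where lr: "(l, r) \<in> Q" "\<bar>l - (L1 + L2)\<bar> \<le> C" "\<bar>r - (R1 + R2)\<bar> \<le> C"
      using add[OF m1(1) m2(1)] by blast
    \<comment> \<open>Total error of the additions; \<open>n1 + n2 + 1\<close> of them are needed.\<close>
    define E where "E = (real n1 + real n2 + 1) * C"
    define S where "S = real (Suc n1) * r1 + real (Suc n2) * r2"
    have lL: "\<bar>l - L\<bar> \<le> E" and rS: "\<bar>r - S\<bar> \<le> E"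
      using lr m1 m2 unfolding E_def L_def S_def by (simp_all add: algebra_simps abs_le_iff)
    have "E \<le> C / N1 * L"
    proof -
      have "real (Suc n1) * N1 \<le> A" "real (Suc n2) * N1 \<le> B"
        unfolding A_def B_def using 1(2) 2(2) by (intro mult_left_mono; simp)+
      then have "(real n1 + real n2 + 1) * N1 \<le> L" using N1(1) by (simp add: L_def algebra_simps)
      then have "real n1 + real n2 + 1 \<le> L / N1" using N1(1) by (simp add: pos_le_divide_eq)
      from mult_right_mono[OF this, of C] show ?thesis using C by (simp add: E_def algebra_simps)
    qed
    then have EK: "E * K \<le> \<epsilon> / 8 * L" and E2: "E \<le> L / 2"
    proof -
      assume E: "E \<le> C / N1 * L"
      have "E * K \<le> C / N1 * L * K" using E K by (intro mult_right_mono) auto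
      also have "\<dots> = C / N1 * K * L" by simp
      also have "\<dots> \<le> \<epsilon> / 8 * L" using CN1 L0 by (intro mult_right_mono) auto
      finally show "E * K \<le> \<epsilon> / 8 * L" .
      have "C / N1 * L \<le> 1 / 2 * L" using CN1 L0 by (intro mult_right_mono) auto
      then show "E \<le> L / 2" using E by linarith
    qed
    have l2: "L / 2 \<le> l" using lL E2 by linarith
    have multiple: "\<bar>c * r - \<sigma> * (c * l)\<bar> \<le> \<epsilon> / 8 * (c * l)"
      if "\<bar>r - \<sigma> * l\<bar> \<le> \<epsilon> / 8 * l" "0 \<le> c" for c r \<sigma> l
    proof -
      have "c * r - \<sigma> * (c * l) = c * (r - \<sigma> * l)" by (simp add: algebra_simps)
      then have "\<bar>c * r - \<sigma> * (c * l)\<bar> = c * \<bar>r - \<sigma> * l\<bar>" using that(2) by (simp add: abs_mult)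
      also have "\<dots> \<le> c * (\<epsilon> / 8 * l)" using that by (intro mult_left_mono) auto
      finally show ?thesis by (simp add: mult.left_commute)
    qed
    have "\<bar>real (Suc n1) * r1 - \<rho>1 * A\<bar> \<le> \<epsilon> / 8 * A" "\<bar>real (Suc n2) * r2 - \<rho>2 * B\<bar> \<le> \<epsilon> / 8 * B"
      unfolding A_def B_def by (rule multiple[OF 1(3)] multiple[OF 2(3)]; simp)+
    moreover have "\<epsilon> / 8 * L = \<epsilon> / 8 * A + \<epsilon> / 8 * B" by (simp add: L_def distrib_left)
    ultimately have SAB: "\<bar>S - (\<rho>1 * A + \<rho>2 * B)\<bar> \<le> \<epsilon> / 8 * L"
      unfolding S_def by linarith
    \<comment> \<open>Rounding error in the proportions.\<close>
    define x where "x = A - a * L"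
    have bx: "b * L - B = x"
    proof -
      have "a * L + b * L = L" using ab(3) by (simp flip: distrib_right)
      then show ?thesis by (simp add: x_def L_def)
    qed
    have xD: "\<bar>x\<bar> \<le> D"
    proof -
      have "a * L \<le> a * (M + D)" "b * L \<le> b * (M + D)" using L ab by (auto intro!: mult_left_mono)
      moreover have "a * D \<le> 1 * D" "b * D \<le> 1 * D" using ab lpos by (auto intro!: mult_right_mono simp: D_def)
      ultimately have "- D \<le> A - a * L" "- D \<le> B - b * L" using A B by (auto simp: algebra_simps)
      then show ?thesis using bx unfolding x_def by (simp add: abs_le_iff)
    qed
    have "\<rho>1 * A + \<rho>2 * B - \<rho> * L = (\<rho>1 - \<rho>2) * x"
    proof -
      have "A = a * L + x" "B = b * L - x" using bx by (auto simp: x_def)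
      then show ?thesis by (simp only: \<rho>_def) (simp add: algebra_simps)
    qed
    then have "\<bar>\<rho>1 * A + \<rho>2 * B - \<rho> * L\<bar> = \<bar>\<rho>1 - \<rho>2\<bar> * \<bar>x\<bar>" by (simp add: abs_mult)
    also have "\<dots> \<le> K * D" using xD K by (intro mult_mono) auto
    also have "\<dots> \<le> \<epsilon> / 8 * L"
    proof -
      have "8 * K * D \<le> M * \<epsilon>" using M(3) e by (simp add: pos_divide_le_eq)
      also have "\<dots> \<le> L * \<epsilon>" using L e by (intro mult_right_mono) auto
      finally show ?thesis by (simp add: mult.commute)
    qed
    finally have AB: "\<bar>\<rho>1 * A + \<rho>2 * B - \<rho> * L\<bar> \<le> \<epsilon> / 8 * L" .
    have "\<rho> * L - \<rho> * l = - (\<rho> * (l - L))" by (simp add: algebra_simps)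
    then have "\<bar>\<rho> * L - \<rho> * l\<bar> = \<bar>\<rho>\<bar> * \<bar>l - L\<bar>" by (simp only: abs_minus_cancel abs_mult)
    also have "\<dots> \<le> \<bar>\<rho>\<bar> * E" using lL by (intro mult_left_mono) auto
    finally have "\<bar>r - S\<bar> + \<bar>\<rho> * L - \<rho> * l\<bar> \<le> E * (1 + \<bar>\<rho>\<bar>)" using rS by (simp add: algebra_simps)
    also have "\<dots> \<le> E * K" using K lL by (intro mult_left_mono) auto
    finally have "\<bar>r - S\<bar> + \<bar>\<rho> * L - \<rho> * l\<bar> \<le> \<epsilon> / 8 * L" using EK by linarith
    then have "\<bar>r - \<rho> * l\<bar> \<le> 3 * (\<epsilon> / 8 * L)" using AB SAB by linarith
    also have "\<dots> \<le> \<epsilon> * l"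
    proof -
      have "\<epsilon> * (L / 2) \<le> \<epsilon> * l" using l2 e by (intro mult_left_mono) auto
      moreover have "3 * (\<epsilon> / 8 * L) \<le> \<epsilon> * (L / 2)" using e L0 by simp
      ultimately show ?thesis by linarith
    qed
    finally have "\<bar>r - \<rho> * l\<bar> \<le> \<epsilon> * l" .
    moreover have "N \<le> l" using l2 L M by linarith
    ultimately show "\<exists>l r. (l, r) \<in> Q \<and> N \<le> l \<and> \<bar>r - \<rho> * l\<bar> \<le> \<epsilon> * l" using lr(1) by blast
  qed
  then show "a *\<^sub>R \<rho>1 + b *\<^sub>R \<rho>2 \<in> slopes Q" by (simp add: \<rho>_def)
qed

text \<open>
  The errors are bounded while the length \<open>l\<close> can be taken arbitrarily large; \<open>N1\<close> makes them at most \<open>\<epsilon> / 4 * l\<close>.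
\<close>
lemma uminus_slopes:
  assumes neg: "\<And>l r. (l, r) \<in> Q \<Longrightarrow> \<exists>l' r'. (l', r') \<in> Q \<and> \<bar>l' - l\<bar> \<le> C \<and> \<bar>r' + r\<bar> \<le> C"
    and "0 < C" and \<rho>: "\<rho> \<in> slopes Q"
  shows "- \<rho> \<in> slopes Q"
proof (rule slopesI)
  fix \<epsilon> N :: real assume e: "0 < \<epsilon>" "0 < N"
  define N1 where "N1 = N + 2 * C + 4 * (C * (1 + \<bar>\<rho>\<bar>)) / \<epsilon>"
  obtain l r where lr: "(l, r) \<in> Q" "N1 \<le> l" "\<bar>r - \<rho> * l\<bar> \<le> \<epsilon> / 4 * l"
    using slopesD[OF \<rho>, of "\<epsilon>/4" N1] e by auto
  obtain l' r' where n: "(l', r') \<in> Q" "\<bar>l' - l\<bar> \<le> C" "\<bar>r' + r\<bar> \<le> C" using neg[OF lr(1)] by blast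
  have nn: "0 \<le> 4 * (C * (1 + \<bar>\<rho>\<bar>)) / \<epsilon>" using e \<open>0 < C\<close> by simp
  have l: "N + 2 * C \<le> l" "4 * (C * (1 + \<bar>\<rho>\<bar>)) / \<epsilon> \<le> l" using lr(2) nn e \<open>0 < C\<close> unfolding N1_def by linarith+
  have half: "l / 2 \<le> l'" using n(2) l(1) e \<open>0 < C\<close> by linarith
  have "4 * (C * (1 + \<bar>\<rho>\<bar>)) \<le> l * \<epsilon>" using l(2) e by (simp only: pos_divide_le_eq)
  moreover have "\<bar>\<rho> * (l' - l)\<bar> \<le> \<bar>\<rho>\<bar> * C" unfolding abs_mult using n(2) by (intro mult_left_mono) auto
  moreover have "r' - (- \<rho>) * l' = (r' + r) - (r - \<rho> * l) + \<rho> * (l' - l)" by (simp add: algebra_simps)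
  ultimately have "\<bar>r' - (- \<rho>) * l'\<bar> \<le> C + \<epsilon> / 4 * l + \<bar>\<rho>\<bar> * C" using n(3) lr(3) by linarith
  also have "\<dots> \<le> \<epsilon> * (l / 2)" using \<open>4 * (C * (1 + \<bar>\<rho>\<bar>)) \<le> l * \<epsilon>\<close> by (simp add: algebra_simps)
  also have "\<dots> \<le> \<epsilon> * l'" using half e by (intro mult_left_mono) auto
  finally show "\<exists>l r. (l, r) \<in> Q \<and> N \<le> l \<and> \<bar>r - - \<rho> * l\<bar> \<le> \<epsilon> * l"
    using n(1) half l(1) n(2) \<open>0 < C\<close> by (intro exI[of _ l'] exI[of _ r']) auto
qed

lemma slopes_bounded:
  assumes "0 \<le> K" "\<And>l r. (l, r) \<in> Q \<Longrightarrow> \<bar>r\<bar> \<le> K * l + 1" "\<rho> \<in> slopes Q"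
  shows "\<bar>\<rho>\<bar> \<le> K + 2"
proof -
  obtain l r where lr: "(l, r) \<in> Q" "1 \<le> l" "\<bar>r - \<rho> * l\<bar> \<le> 1 * l"
    using slopesD[OF assms(3), of 1 1] by auto
  have "\<bar>\<rho>\<bar> * l = \<bar>\<rho> * l\<bar>" using lr(2) by (simp add: abs_mult)
  also have "\<dots> \<le> (K + 2) * l" using assms(2)[OF lr(1)] lr(2,3) by (simp add: algebra_simps)
  finally show ?thesis using lr(2) by simp
qed

context small_obstacle
begin

text \<open>
  From approximations of slope \<open>\<rho>\<close> with error \<open>1 / (n + 1)\<close> and length at least \<open>n + 1\<close> one obtains a sequence as in the definition.
\<close>
lemma rotation_set_eq_slopes: "admissible_rotation_set Ob z = slopes pieces"
proof (intro equalityI subsetI)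
  fix \<rho> assume "\<rho> \<in> admissible_rotation_set Ob z"
  then obtain d t where dt: "\<And>n. (t n, d n) \<in> pieces" "filterlim t at_top sequentially" "(\<lambda>n. d n / t n) \<longlonglongrightarrow> \<rho>"
    unfolding admissible_rotation_set_def pieces_def by blast
  show "\<rho> \<in> slopes pieces"
  proof (rule slopesI)
    fix \<epsilon> N :: real assume e: "0 < \<epsilon>" "0 < N"
    have "\<forall>\<^sub>F n in sequentially. \<bar>d n / t n - \<rho>\<bar> < \<epsilon> \<and> N \<le> t n"
      using tendstoD[OF dt(3) e(1)] dt(2) unfolding filterlim_at_top dist_real_def by (auto intro: eventually_conj)
    then obtain n where n: "\<bar>d n / t n - \<rho>\<bar> < \<epsilon>" "N \<le> t n" using eventually_happens by fastforce
    have t: "0 < t n" using n e by simp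
    have "\<bar>d n - \<rho> * t n\<bar> = \<bar>d n / t n - \<rho>\<bar> * t n"
      using t by (simp add: abs_mult_pos' field_simps flip: abs_of_pos abs_mult)
    also have "\<dots> \<le> \<epsilon> * t n" using n t by (intro mult_right_mono) auto
    finally show "\<exists>l r. (l, r) \<in> pieces \<and> N \<le> l \<and> \<bar>r - \<rho> * l\<bar> \<le> \<epsilon> * l" using dt(1) n(2) by blast
  qed
next
  fix \<rho> assume \<rho>: "\<rho> \<in> slopes pieces"
  have "\<exists>t d. (t, d) \<in> pieces \<and> real (Suc n) \<le> t \<and> \<bar>d - \<rho> * t\<bar> \<le> 1 / real (Suc n) * t" for n
    using slopesD[OF \<rho>, of "1 / real (Suc n)" "real (Suc n)"] by (metis zero_less_divide_1_iff of_nat_0_less_iff zero_less_Suc)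
  then obtain t d where td: "\<And>n. (t n, d n) \<in> pieces" "\<And>n. real (Suc n) \<le> t n"
     "\<And>n. \<bar>d n - \<rho> * t n\<bar> \<le> 1 / real (Suc n) * t n" by metis
  have "filterlim t at_top sequentially"
  proof (rule filterlim_at_top_mono[OF filterlim_real_sequentially], intro always_eventually allI)
    show "real n \<le> t n" for n using td(2)[of n] by simp
  qed
  moreover have "(\<lambda>n. d n / t n) \<longlonglongrightarrow> \<rho>"
  proof (rule LIM_zero_cancel, rule Lim_null_comparison)
    show "\<forall>\<^sub>F n in sequentially. norm (d n / t n - \<rho>) \<le> 1 / real (Suc n)"
    proof (intro always_eventually allI)
      fix n
      have t: "0 < t n" using td(2)[of n] by (meson less_le_trans of_nat_0_less_iff zero_less_Suc)
      have "\<bar>d n / t n - \<rho>\<bar> * t n = \<bar>d n - \<rho> * t n\<bar>"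
        using t by (simp add: abs_mult_pos' field_simps flip: abs_of_pos abs_mult)
      also have "\<dots> \<le> 1 / real (Suc n) * t n" by (rule td)
      finally show "norm (d n / t n - \<rho>) \<le> 1 / real (Suc n)" using t by (simp only: mult_le_cancel_right_pos real_norm_def)
    qed
    show "(\<lambda>n. 1 / real (Suc n)) \<longlonglongrightarrow> 0" using LIMSEQ_inverse_real_of_nat by (simp add: inverse_eq_divide)
  qed
  ultimately show "\<rho> \<in> admissible_rotation_set Ob z"
    using td(1) unfolding admissible_rotation_set_def pieces_def by blast
qed

lemma pi_cancel: "\<bar>2 * pi * x\<bar> \<le> 2 * pi * y \<Longrightarrow> \<bar>x\<bar> \<le> y"
  by (simp add: abs_mult)

lemma pieces_add:
  assumes "(l1, r1) \<in> pieces" "(l2, r2) \<in> pieces"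
  shows "\<exists>l r. (l, r) \<in> pieces \<and> \<bar>l - (l1 + l2)\<bar> \<le> 14 \<and> \<bar>r - (r1 + r2)\<bar> \<le> 14"
proof -
  obtain u where u: "adm u" "u \<noteq> []" "\<bar>l1 - minlen u\<bar> \<le> 2" "\<bar>2 * pi * r1 - rot u\<bar> \<le> 6 * pi"
    using pieces_word[OF assms(1)] by blast
  obtain v where v: "adm v" "v \<noteq> []" "\<bar>l2 - minlen v\<bar> \<le> 2" "\<bar>2 * pi * r2 - rot v\<bar> \<le> 6 * pi"
    using pieces_word[OF assms(2)] by blast
  obtain w where w: "adm w" "w \<noteq> []" "\<bar>minlen w - minlen u - minlen v\<bar> \<le> 8" "\<bar>rot w - rot u - rot v\<bar> \<le> 5 * pi"
    using join[OF u(1,2) v(1,2)] by blast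
  obtain l r where lr: "(l, r) \<in> pieces" "\<bar>l - minlen w\<bar> \<le> 2" "\<bar>2 * pi * r - rot w\<bar> \<le> 6 * pi"
    using word_pieces[OF w(1,2)] by blast
  have "2 * pi * (r - (r1 + r2)) = 2 * pi * r - 2 * pi * r1 - 2 * pi * r2" by (simp add: algebra_simps)
  then have "\<bar>2 * pi * (r - (r1 + r2))\<bar> \<le> 2 * pi * 14" using u(4) v(4) w(4) lr(3) pi_gt_zero by linarith
  then have "\<bar>r - (r1 + r2)\<bar> \<le> 14" by (rule pi_cancel)
  moreover have "\<bar>l - (l1 + l2)\<bar> \<le> 14" using u(3) v(3) w(3) lr(2) by linarith
  ultimately show ?thesis using lr(1) by blast
qed

lemma pieces_reversed:
  assumes "(l, r) \<in> pieces"
  shows "\<exists>l' r'. (l', r') \<in> pieces \<and> \<bar>l' - l\<bar> \<le> 6 \<and> \<bar>r' + r\<bar> \<le> 6"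
proof -
  obtain w where w: "adm w" "w \<noteq> []" "\<bar>l - minlen w\<bar> \<le> 2" "\<bar>2 * pi * r - rot w\<bar> \<le> 6 * pi"
    using pieces_word[OF assms] by blast
  have "reversed w \<noteq> []" using w by (simp add: reversed_def)
  then obtain l' r' where lr: "(l', r') \<in> pieces" "\<bar>l' - minlen w\<bar> \<le> 2" "\<bar>2 * pi * r' + rot w\<bar> \<le> 6 * pi"
    using word_pieces[OF adm_reversed[OF w(1)]] rot_reversed[OF w(1)] minlen_reversed by auto
  have "2 * pi * (r' + r) = 2 * pi * r' + 2 * pi * r" by (simp add: algebra_simps)
  then have "\<bar>2 * pi * (r' + r)\<bar> \<le> 2 * pi * 6" using w(4) lr(3) by linarith
  then have "\<bar>r' + r\<bar> \<le> 6" by (rule pi_cancel)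
  moreover have "\<bar>l' - l\<bar> \<le> 6" using w(3) lr(2) by linarith
  ultimately show ?thesis using lr(1) by blast
qed

text \<open>
  Powers of a unit step have rotation 0 and, by \<open>minlen_ge\<close>, length at least 7/25 per step.
\<close>
lemma zero_slope: "0 \<in> slopes pieces"
proof (rule slopesI)
  fix \<epsilon> N :: real assume e: "0 < \<epsilon>" "0 < N"
  obtain n :: nat where n: "4 * (N + 3 / \<epsilon> + 2) \<le> real n" using real_arch_simple by blast
  have pos: "0 < 3 / \<epsilon>" using e by simp
  have "n \<noteq> 0"
  proof
    assume "n = 0"
    then show False using n pos e by simp
  qed
  then have "n > 0" by simp
  define w where "w = replicate n (1::int, 0::int)"
  have w: "adm w" "rot w = 0" "w \<noteq> []" using unit_power \<open>n > 0\<close> by (auto simp: w_def)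
  obtain l r where lr: "(l, r) \<in> pieces" "\<bar>l - minlen w\<bar> \<le> 2" "\<bar>2 * pi * r - rot w\<bar> \<le> 6 * pi"
    using word_pieces[OF w(1,3)] by blast
  have "N + 3 / \<epsilon> + 2 \<le> minlen w" using minlen_ge[OF w(1)] n pos e by (simp add: w_def)
  then have l: "N + 3 / \<epsilon> \<le> l" using lr(2) by linarith
  have "\<bar>2 * pi * r\<bar> \<le> 2 * pi * 3" using lr(3) w(2) by simp
  then have "\<bar>r\<bar> \<le> 3" by (rule pi_cancel)
  moreover have "3 \<le> \<epsilon> * l"
  proof -
    have "\<epsilon> * (3 / \<epsilon>) \<le> \<epsilon> * l" using l e by (intro mult_left_mono) auto
    then show ?thesis using e by simp
  qed
  ultimately have "\<bar>r - 0 * l\<bar> \<le> \<epsilon> * l" by simp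
  moreover have "N \<le> l" using l pos by linarith
  ultimately show "\<exists>l r. (l, r) \<in> pieces \<and> N \<le> l \<and> \<bar>r - 0 * l\<bar> \<le> \<epsilon> * l"
    using lr(1) by blast
qed

end

lemma symmetric_interval:
  fixes S :: "real set"
  assumes "convex S" "closed S" "0 \<in> S" "\<And>x. x \<in> S \<Longrightarrow> - x \<in> S" "\<And>x. x \<in> S \<Longrightarrow> \<bar>x\<bar> \<le> K"
  shows "\<exists>r\<ge>0. S = {-r..r}"
proof -
  have "bounded S" using assms(5) by (auto simp: bounded_iff)
  then have "compact S" using assms(2) by (simp add: compact_eq_bounded_closed)
  then obtain r where r: "r \<in> S" "\<And>x. x \<in> S \<Longrightarrow> x \<le> r" using compact_attains_sup[of S] assms(3) by blast
  have "0 \<le> r" using r assms(3) by blast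
  have "{-r..r} \<subseteq> S"
    using closed_segment_subset[OF assms(4)[OF r(1)] r(1) assms(1)] \<open>0 \<le> r\<close> by (simp add: closed_segment_eq_real_ivl)
  moreover have "S \<subseteq> {-r..r}" using r(2) r(2)[OF assms(4)] by force
  ultimately show ?thesis using \<open>0 \<le> r\<close> by blast
qed

theorem theorem5p2:
  fixes Ob :: "complex set" and z :: complex
  assumes "obstacle Ob" and "small Ob" and "z \<in> interior Ob"
  shows "convex (admissible_rotation_set Ob z) \<and> (\<exists>r\<ge>0. admissible_rotation_set Ob z = {-r..r})"
proof -
  interpret small_obstacle Ob z by unfold_locales (use assms in auto)
  obtain K where K: "0 \<le> K" "\<And>T d. (T, d) \<in> pieces \<Longrightarrow> \<bar>d\<bar> \<le> K * T + 1" using pieces_bounded by blast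
  have "convex (slopes pieces)" by (rule convex_slopes[OF pieces_add]) simp_all
  moreover have "\<exists>r\<ge>0. slopes pieces = {-r..r}"
    by (rule symmetric_interval[OF \<open>convex (slopes pieces)\<close> closed_slopes zero_slope
          uminus_slopes[OF pieces_reversed] slopes_bounded[OF K]]) simp_all
  ultimately show ?thesis unfolding rotation_set_eq_slopes by blast
qed

end
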